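(* Let $\lambda$ be a Radon measure on a locally compact Polish space $\mathbb X$, let $K$ be a locally trace-class positive contraction on $L_2(\mathbb X,\lambda)$, and let $\eta_K$ be the determinantal point process generated by $K$. Then $\eta_K<_{dcx}\eta_2$, where $\eta_2$ denotes a Poisson point process on $\mathbb X$ with intensity measure $\mathbb E\eta_K$.
   Context: $K$ is a positive contraction if it is self-adjoint with $0\le K\le I$; it is locally trace-class if $\mathbf 1_BK\mathbf 1_B$ is trace class for every relatively compact Borel $B$. Such a $K$ is locally an integral operator, with a Hermitian kernel $K(x,y)$ obtained on $B\times B$ from the spectral decomposition $\sum_k\lambda_k\varphi_k(x)\overline{\varphi_k(y)}$ of $\mathbf 1_BK\mathbf 1_B$. The determinantal point process $\eta_K$ is the (unique in law) simple, locally finite point process on $\mathbb X$ whose $n$-point correlation functions with respect to $\lambda$ are $\det[K(x_i,x_j)]_{1\le i,j\le n}$, $n\ge1$; in particular $\mathbb E[\eta_K(B_1)\cdots\eta_K(B_n)]=\int_{B_1\times\cdots\times B_n}\det[K(x_i,x_j)]_{i,j}\,\lambda(dx_1)\cdots\lambda(dx_n)$ for disjoint relatively compact Borel sets $B_1,\dots,B_n$. $\mathbb E\eta_K$ denotes the measure $B\mapsto\mathbb E[\eta_K(B)]$. Bounded sets are understood as relatively compact sets. Order: for $f:\mathbb R^n\to\mathbb R$ and $\epsilon>0$ put $\Delta_i^{\epsilon}f(\mathbf x)=f(\mathbf x+\epsilon \mathbf e_i)-f(\mathbf x)$, $\mathbf e_i$ the $i$-th unit vector. $f$ is directionally convex if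 $\Delta_j^{\delta}\Delta_i^{\epsilon}f(\mathbf x)\ge0$ for all $1\le i\le j\le n$, $\epsilon,\delta>0$, $\mathbf x\in\mathbb R^n$. For random vectors, $\mathbf X<_{dcx}\mathbf Y$ means $\mathbb Ef(\mathbf X)\le\mathbb Ef(\mathbf Y)$ for all directionally convex $f$ for which the expectations exist. For point processes on $\mathbb X$, $\eta_1<_{dcx}\eta_2$ means $(\eta_1(B_1),\dots,\eta_1(B_n))<_{dcx}(\eta_2(B_1),\dots,\eta_2(B_n))$ for all $n\ge1$ and all disjoint bounded Borel sets $B_1,\dots,B_n$. *)

theory Defs
  imports "HOL-Probability.Probability" "Jordan_Normal_Form.Determinant"
begin

definition relatively_compact :: "'a::topological_space set \<Rightarrow> bool" where
  "relatively_compact B \<longleftrightarrow> compact (closure B)"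

text \<open>On a locally compact Polish space inner regularity follows from the other two conditions.\<close>

definition radon_measure :: "'a::topological_space measure \<Rightarrow> bool" where
  "radon_measure M \<longleftrightarrow> sets M = sets borel
     \<and> (\<forall>C. compact C \<longrightarrow> emeasure M C < \<infinity>)
     \<and> (\<forall>B\<in>sets borel. emeasure M B = (SUP C\<in>{C. compact C \<and> C \<subseteq> B}. emeasure M C))"

text \<open>
  Elements of \<open>L\<^sub>2\<close> are represented by square-integrable functions, and all identities between
  them are almost everywhere identities. An operator is a map on representatives; linearity and
  boundedness together make it compatible with almost everywhere equality. Its values on functions
  outside \<open>L\<^sub>2\<close> are irrelevant.
\<close>

definition L2_space :: "'a measure \<Rightarrow> ('a \<Rightarrow> complex) set" where
  "L2_space M = {f \<in> borel_measurable M. integrable M (\<lambda>x. (cmod (f x))\<^sup>2)}"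

definition L2_inner :: "'a measure \<Rightarrow> ('a \<Rightarrow> complex) \<Rightarrow> ('a \<Rightarrow> complex) \<Rightarrow> complex" where
  "L2_inner M f g = (\<integral>x. f x * cnj (g x) \<partial>M)"

definition L2_norm :: "'a measure \<Rightarrow> ('a \<Rightarrow> complex) \<Rightarrow> real" where
  "L2_norm M f = sqrt (\<integral>x. (cmod (f x))\<^sup>2 \<partial>M)"

definition L2_operator :: "'a measure \<Rightarrow> (('a \<Rightarrow> complex) \<Rightarrow> 'a \<Rightarrow> complex) \<Rightarrow> bool" where
  "L2_operator M T \<longleftrightarrow>
     (\<forall>f\<in>L2_space M. T f \<in> L2_space M)
     \<and> (\<forall>f\<in>L2_space M. \<forall>g\<in>L2_space M. AE x in M. T (\<lambda>y. f y + g y) x = T f x + T g x)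
     \<and> (\<forall>c. \<forall>f\<in>L2_space M. AE x in M. T (\<lambda>y. c * f y) x = c * T f x)
     \<and> (\<exists>C. \<forall>f\<in>L2_space M. L2_norm M (T f) \<le> C * L2_norm M f)"

definition L2_selfadjoint :: "'a measure \<Rightarrow> (('a \<Rightarrow> complex) \<Rightarrow> 'a \<Rightarrow> complex) \<Rightarrow> bool" where
  "L2_selfadjoint M T \<longleftrightarrow> L2_operator M T
     \<and> (\<forall>f\<in>L2_space M. \<forall>g\<in>L2_space M. L2_inner M (T f) g = L2_inner M f (T g))"

text \<open>For self-adjoint \<open>T\<close> the quadratic form is real, so \<open>Re\<close> loses nothing.\<close>

definition L2_positive :: "'a measure \<Rightarrow> (('a \<Rightarrow> complex) \<Rightarrow> 'a \<Rightarrow> complex) \<Rightarrow> bool" where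
  "L2_positive M T \<longleftrightarrow> L2_selfadjoint M T \<and> (\<forall>f\<in>L2_space M. 0 \<le> Re (L2_inner M (T f) f))"

definition positive_contraction :: "'a measure \<Rightarrow> (('a \<Rightarrow> complex) \<Rightarrow> 'a \<Rightarrow> complex) \<Rightarrow> bool" where
  "positive_contraction M K \<longleftrightarrow> L2_positive M K \<and> L2_positive M (\<lambda>f x. f x - K f x)"

definition L2_orthonormal_basis :: "'a measure \<Rightarrow> ('a \<Rightarrow> complex) set \<Rightarrow> bool" where
  "L2_orthonormal_basis M E \<longleftrightarrow> E \<subseteq> L2_space M
     \<and> (\<forall>e\<in>E. \<forall>e'\<in>E. L2_inner M e e' = (if e = e' then 1 else 0))
     \<and> (\<forall>f\<in>L2_space M. (\<forall>e\<in>E. L2_inner M f e = 0) \<longrightarrow> (AE x in M. f x = 0))"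

text \<open>
  \<open>T\<close> is trace class iff \<open>\<bar>T\<bar>\<close> has finite trace. Here \<open>A\<close> is \<open>\<bar>T\<bar>\<close>: the unique positive
  operator with \<open>A\<^sup>2 = T\<^sup>*T\<close>, the latter identity being written as
  \<open>\<langle>A f, A g\<rangle> = \<langle>T f, T g\<rangle>\<close>.
\<close>

definition L2_trace_class :: "'a measure \<Rightarrow> (('a \<Rightarrow> complex) \<Rightarrow> 'a \<Rightarrow> complex) \<Rightarrow> bool" where
  "L2_trace_class M T \<longleftrightarrow> L2_operator M T \<and>
     (\<exists>A. L2_positive M A
        \<and> (\<forall>f\<in>L2_space M. \<forall>g\<in>L2_space M. L2_inner M (A f) (A g) = L2_inner M (T f) (T g))
        \<and> (\<forall>E. L2_orthonormal_basis M E \<longrightarrow> (\<lambda>e. Re (L2_inner M (A e) e)) summable_on E))"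

definition compression ::
    "'a set \<Rightarrow> (('a \<Rightarrow> complex) \<Rightarrow> 'a \<Rightarrow> complex) \<Rightarrow> ('a \<Rightarrow> complex) \<Rightarrow> 'a \<Rightarrow> complex" where
  "compression B T f = (\<lambda>x. indicator B x * T (\<lambda>y. indicator B y * f y) x)"

definition locally_trace_class ::
    "'a::topological_space measure \<Rightarrow> (('a \<Rightarrow> complex) \<Rightarrow> 'a \<Rightarrow> complex) \<Rightarrow> bool" where
  "locally_trace_class M K \<longleftrightarrow>
     (\<forall>B\<in>sets borel. relatively_compact B \<longrightarrow> L2_trace_class M (compression B K))"

text \<open>
  \<open>T = (\<Sum>k\<in>I. l\<^sub>k \<langle>\<cdot>, \<phi>\<^sub>k\<rangle> \<phi>\<^sub>k)\<close> with orthonormal \<open>\<phi>\<^sub>k\<close>. The index set \<open>I\<close> is part of the data because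
  \<open>T\<close> may have finite rank and \<open>L\<^sub>2\<close> finite dimension.
\<close>

definition spectral_decomposition ::
    "'a measure \<Rightarrow> (('a \<Rightarrow> complex) \<Rightarrow> 'a \<Rightarrow> complex)
      \<Rightarrow> nat set \<Rightarrow> (nat \<Rightarrow> real) \<Rightarrow> (nat \<Rightarrow> 'a \<Rightarrow> complex) \<Rightarrow> bool" where
  "spectral_decomposition M T I l \<phi> \<longleftrightarrow>
     (\<forall>k\<in>I. \<phi> k \<in> L2_space M)
     \<and> (\<forall>j\<in>I. \<forall>k\<in>I. L2_inner M (\<phi> j) (\<phi> k) = (if j = k then 1 else 0))
     \<and> (\<forall>f\<in>L2_space M. \<forall>g\<in>L2_space M.
          ((\<lambda>k. complex_of_real (l k) * L2_inner M f (\<phi> k) * L2_inner M (\<phi> k) g)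
             has_sum L2_inner M (T f) g) I)"

text \<open>
  The eigenfunctions are only defined almost everywhere, so on \<open>B \<times> B\<close> the kernel is prescribed off
  a null set of \<open>B\<close>. (An exceptional null set of \<open>B \<times> B\<close> would leave the diagonal undetermined.)
\<close>

definition local_kernel ::
    "'a::topological_space measure \<Rightarrow> (('a \<Rightarrow> complex) \<Rightarrow> 'a \<Rightarrow> complex)
      \<Rightarrow> ('a \<Rightarrow> 'a \<Rightarrow> complex) \<Rightarrow> bool" where
  "local_kernel M K \<kappa> \<longleftrightarrow>
     (\<lambda>(x, y). \<kappa> x y) \<in> borel_measurable (M \<Otimes>\<^sub>M M)
     \<and> (\<forall>x y. \<kappa> y x = cnj (\<kappa> x y))
     \<and> (\<forall>B\<in>sets borel. relatively_compact B \<longrightarrow>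
          (\<exists>I l \<phi>. spectral_decomposition M (compression B K) I l \<phi>
             \<and> (\<exists>N\<in>null_sets M. \<forall>x\<in>B - N. \<forall>y\<in>B - N.
                  ((\<lambda>k. complex_of_real (l k) * \<phi> k x * cnj (\<phi> k y)) has_sum \<kappa> x y) I)))"

text \<open>Points may have multiplicities, as in a Poisson process whose intensity has atoms.\<close>

definition point_process :: "'w measure \<Rightarrow> ('w \<Rightarrow> 'a::topological_space measure) \<Rightarrow> bool" where
  "point_process P \<eta> \<longleftrightarrow> prob_space P
     \<and> (\<forall>\<omega>\<in>space P. sets (\<eta> \<omega>) = sets borel
          \<and> (\<forall>B\<in>sets borel. relatively_compact B \<longrightarrow> (\<exists>n::nat. emeasure (\<eta> \<omega>) B = of_nat n)))
     \<and> (\<forall>B\<in>sets borel. (\<lambda>\<omega>. emeasure (\<eta> \<omega>) B) \<in> borel_measurable P)"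

definition simple_point_process ::
    "'w measure \<Rightarrow> ('w \<Rightarrow> 'a::topological_space measure) \<Rightarrow> bool" where
  "simple_point_process P \<eta> \<longleftrightarrow> point_process P \<eta> \<and> (AE \<omega> in P. \<forall>x. emeasure (\<eta> \<omega>) {x} \<le> 1)"

definition intensity_measure ::
    "'w measure \<Rightarrow> ('w \<Rightarrow> 'a::topological_space measure) \<Rightarrow> 'a measure" where
  "intensity_measure P \<eta> = measure_of UNIV (sets borel) (\<lambda>B. \<integral>\<^sup>+\<omega>. emeasure (\<eta> \<omega>) B \<partial>P)"

lemma sets_intensity_measure [simp]: "sets (intensity_measure P \<eta>) = sets borel"
  unfolding intensity_measure_def
  by (simp add: sets_measure_of sigma_algebra.sigma_sets_eq sets.sigma_algebra_axioms
      flip: space_borel)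

lemma emeasure_intensity_measure:
  fixes \<eta> :: "'w \<Rightarrow> 'a::topological_space measure"
  assumes "point_process P \<eta>" and "B \<in> sets borel"
  shows "emeasure (intensity_measure P \<eta>) B = (\<integral>\<^sup>+\<omega>. emeasure (\<eta> \<omega>) B \<partial>P)"
proof -
  have sets_\<eta>: "sets (\<eta> \<omega>) = sets borel" if "\<omega> \<in> space P" for \<omega>
    using assms(1) that by (auto simp: point_process_def)
  have meas: "(\<lambda>\<omega>. emeasure (\<eta> \<omega>) A) \<in> borel_measurable P" if "A \<in> sets borel" for A
    using assms(1) that by (auto simp: point_process_def)
  show ?thesis
  proof (rule emeasure_measure_of[OF intensity_measure_def])
    show "countably_additive (sets (intensity_measure P \<eta>)) (\<lambda>B. \<integral>\<^sup>+\<omega>. emeasure (\<eta> \<omega>) B \<partial>P)"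
    proof (rule countably_additiveI)
      fix A :: "nat \<Rightarrow> 'a set"
      assume "range A \<subseteq> sets (intensity_measure P \<eta>)" and dA: "disjoint_family A"
      then have rA: "range A \<subseteq> sets borel" by simp
      then have "(\<Sum>i. \<integral>\<^sup>+\<omega>. emeasure (\<eta> \<omega>) (A i) \<partial>P) = (\<integral>\<^sup>+\<omega>. (\<Sum>i. emeasure (\<eta> \<omega>) (A i)) \<partial>P)"
        by (intro nn_integral_suminf[symmetric] meas) auto
      also have "\<dots> = (\<integral>\<^sup>+\<omega>. emeasure (\<eta> \<omega>) (\<Union>(range A)) \<partial>P)"
        using rA dA by (intro nn_integral_cong suminf_emeasure) (auto simp: sets_\<eta>)
      finally show "(\<Sum>i. \<integral>\<^sup>+\<omega>. emeasure (\<eta> \<omega>) (A i) \<partial>P)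
          = (\<integral>\<^sup>+\<omega>. emeasure (\<eta> \<omega>) (\<Union>(range A)) \<partial>P)" .
    qed
  qed (use assms(2) in \<open>auto simp: positive_def\<close>)
qed

text \<open>
  \<open>\<rho>\<close> is the density with respect to \<open>M\<^sup>n\<close> of the \<open>n\<close>-th factorial moment measure. For a simple
  process the latter assigns to \<open>B\<^sub>1 \<times> \<dots> \<times> B\<^sub>n\<close> the expected number of \<open>n\<close>-tuples of
  distinct points \<open>x\<^sub>i \<in> B\<^sub>i\<close>; for disjoint sets this is \<open>E[\<eta>(B\<^sub>1) \<cdots> \<eta>(B\<^sub>n)]\<close>. The points of
  \<open>\<eta> \<omega>\<close> are its atoms. Only product sets with relatively compact sides are used; these
  determine the measure.
\<close>

definition correlation_function ::
    "'w measure \<Rightarrow> ('w \<Rightarrow> 'a::topological_space measure) \<Rightarrow> 'a measure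
      \<Rightarrow> nat \<Rightarrow> ((nat \<Rightarrow> 'a) \<Rightarrow> real) \<Rightarrow> bool" where
  "correlation_function P \<eta> M n \<rho> \<longleftrightarrow>
     \<rho> \<in> borel_measurable (\<Pi>\<^sub>M i\<in>{..<n}. M)
     \<and> (AE x in (\<Pi>\<^sub>M i\<in>{..<n}. M). 0 \<le> \<rho> x)
     \<and> (\<forall>B. (\<forall>i<n. B i \<in> sets borel \<and> relatively_compact (B i)) \<longrightarrow>
          (\<integral>\<^sup>+\<omega>. of_nat (card {x \<in> \<Pi>\<^sub>E i\<in>{..<n}. B i.
                inj_on x {..<n} \<and> (\<forall>i<n. emeasure (\<eta> \<omega>) {x i} \<noteq> 0)}) \<partial>P)
          = (\<integral>\<^sup>+x\<in>(\<Pi>\<^sub>E i\<in>{..<n}. B i). ennreal (\<rho> x) \<partial>(\<Pi>\<^sub>M i\<in>{..<n}. M)))"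

text \<open>The determinant of a Hermitian matrix is real, so \<open>Re\<close> loses nothing.\<close>

definition determinantal_process ::
    "'w measure \<Rightarrow> ('w \<Rightarrow> 'a::topological_space measure)
      \<Rightarrow> 'a measure \<Rightarrow> (('a \<Rightarrow> complex) \<Rightarrow> 'a \<Rightarrow> complex) \<Rightarrow> bool" where
  "determinantal_process P \<eta> M K \<longleftrightarrow> simple_point_process P \<eta>
     \<and> (\<exists>\<kappa>. local_kernel M K \<kappa> \<and>
          (\<forall>n\<ge>1. correlation_function P \<eta> M n
             (\<lambda>x. Re (Determinant.det (Matrix.mat n n (\<lambda>(i, j). \<kappa> (x i) (x j)))))))"

text \<open>
  The explicit mass function also covers rate \<open>0\<close>, which \<^const>\<open>poisson_pmf\<close> excludes. The Poisson
  distribution with infinite mean is the point mass at \<open>\<infinity>\<close>.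
\<close>

definition poisson_process ::
    "'w measure \<Rightarrow> ('w \<Rightarrow> 'a::topological_space measure) \<Rightarrow> 'a measure \<Rightarrow> bool" where
  "poisson_process P \<eta> \<Lambda> \<longleftrightarrow> point_process P \<eta>
     \<and> (\<forall>B\<in>sets borel.
          if emeasure \<Lambda> B = \<infinity> then (AE \<omega> in P. emeasure (\<eta> \<omega>) B = \<infinity>)
          else (\<forall>k::nat. measure P {\<omega> \<in> space P. emeasure (\<eta> \<omega>) B = of_nat k}
                  = measure \<Lambda> B ^ k / fact k * exp (- measure \<Lambda> B)))
     \<and> (\<forall>(n::nat) B. (\<forall>i<n. B i \<in> sets borel) \<and> disjoint_family_on B {..<n} \<longrightarrow>
          prob_space.indep_vars P (\<lambda>_. borel) (\<lambda>i \<omega>. emeasure (\<eta> \<omega>) (B i)) {..<n})"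

text \<open>Vectors in \<open>\<real>\<^sup>n\<close> are elements of \<^term>\<open>carrier_vec n\<close>; coordinates are numbered from \<open>0\<close>.\<close>

definition diff_op :: "nat \<Rightarrow> nat \<Rightarrow> real \<Rightarrow> (real Matrix.vec \<Rightarrow> real) \<Rightarrow> real Matrix.vec \<Rightarrow> real" where
  "diff_op n i \<epsilon> f x = f (x + \<epsilon> \<cdot>\<^sub>v unit_vec n i) - f x"

definition directionally_convex :: "nat \<Rightarrow> (real Matrix.vec \<Rightarrow> real) \<Rightarrow> bool" where
  "directionally_convex n f \<longleftrightarrow>
     (\<forall>i j \<epsilon> \<delta>. \<forall>x\<in>carrier_vec n. i \<le> j \<and> j < n \<and> 0 < \<epsilon> \<and> 0 < \<delta> \<longrightarrow>
        0 \<le> diff_op n j \<delta> (diff_op n i \<epsilon> f) x)"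

text \<open>
  An expectation exists when the integral is finite. No measurability of \<open>f\<close> itself is
  required, only of \<open>f \<circ> X\<close> and \<open>f \<circ> Y\<close>, as part of \<^const>\<open>integrable\<close>.
\<close>

definition dcx_less :: "nat \<Rightarrow> 'w measure \<Rightarrow> ('w \<Rightarrow> real Matrix.vec)
    \<Rightarrow> 'v measure \<Rightarrow> ('v \<Rightarrow> real Matrix.vec) \<Rightarrow> bool" where
  "dcx_less n P X Q Y \<longleftrightarrow>
     (\<forall>f. directionally_convex n f \<and> integrable P (\<lambda>\<omega>. f (X \<omega>)) \<and> integrable Q (\<lambda>\<omega>. f (Y \<omega>))
        \<longrightarrow> (\<integral>\<omega>. f (X \<omega>) \<partial>P) \<le> (\<integral>\<omega>. f (Y \<omega>) \<partial>Q))"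

definition count_vec :: "nat \<Rightarrow> (nat \<Rightarrow> 'a set) \<Rightarrow> 'a measure \<Rightarrow> real Matrix.vec" where
  "count_vec n B \<mu> = Matrix.vec n (\<lambda>i. measure \<mu> (B i))"

definition dcx_less_pp :: "'w measure \<Rightarrow> ('w \<Rightarrow> 'a::topological_space measure)
    \<Rightarrow> 'v measure \<Rightarrow> ('v \<Rightarrow> 'a measure) \<Rightarrow> bool" where
  "dcx_less_pp P \<eta> Q \<zeta> \<longleftrightarrow>
     (\<forall>n\<ge>1. \<forall>B. (\<forall>i<n. B i \<in> sets borel \<and> relatively_compact (B i))
          \<and> disjoint_family_on B {..<n} \<longrightarrow>
        dcx_less n P (\<lambda>\<omega>. count_vec n B (\<eta> \<omega>)) Q (\<lambda>\<omega>. count_vec n B (\<zeta> \<omega>)))"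

end

theory Submission
  imports Defs
begin

text \<open>
  For finitely many disjoint sets, spectral decomposition and Gram matrices of truncated
  eigenfunctions reduce the counts to a determinantal probability measure
  \<open>S \<mapsto> \<bar>det (v\<^sub>e : e \<in> S)\<bar>\<^sup>2\<close> on the \<open>d\<close>-subsets of a finite set. The generating polynomial
  of such a measure is real stable, hence satisfies the Rayleigh inequalities also after conditioning,
  and the Feder--Mihail argument yields that every element is negatively associated with increasing
  functions of the others. This allows the indicators of the elements to be replaced one by one by
  independent Poisson variables with the same means, each replacement increasing the expectation of an
  increasing directionally convex function. Correlation functions determine the factorial moments,
  the latter the generating function, so the truncated counts converge in law and Fatou's lemma
  passes the inequality to the limit. An arbitrary directionally convex function on the lattice becomes
  nonnegative and increasing after adding an affine function, which does not matter as the
  means agree.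
\<close>

section \<open>Determinants over finite index sets\<close>

text \<open>The truncated Gram matrices \<open>A b\<close> of the sets add up to diag(l), not to the
  identity. As the contraction property gives l \<le> 1, the defect diag(1 - l) is positive
  semidefinite and can serve as the matrix of one more class, numbered \<open>m\<close>. With it the
  matrices form a partition of unity, and det (sum of z_b A_b) is homogeneous in all its variables
  and equal to 1 at z = 1; this is what produces a probability measure on sets of fixed size, and
  the fixed size drives the Feder--Mihail step. A function of the first \<open>m\<close> counts does
  not see the extra class. Each matrix is a sum of rank one terms, the elements of the finite set,
  and the count of a class is the number of its selected elements. Monotonicity is needed twice: the
  correlation inequality holds only against increasing functions, and the truncated Poisson means
  must be replaced by the larger exact ones. Nonnegativity is what admits Fatou's lemma, since the
  functions are unbounded and only convergence of point probabilities is known.\<close>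

text \<open>The Leibniz formula over an arbitrary finite index set. Principal minors
  \<open>ldet S T\<close> can then be formed for any subset \<open>S\<close>, without renumbering it
  as a matrix dimension would require.\<close>

definition ldet :: "'i set \<Rightarrow> ('i \<Rightarrow> 'i \<Rightarrow> 'c::comm_ring_1) \<Rightarrow> 'c" where
  "ldet S T = (\<Sum>p | p permutes S. of_int (sign p) * (\<Prod>i\<in>S. T i (p i)))"

lemma ldet_cong:
  assumes "\<And>i j. i \<in> S \<Longrightarrow> j \<in> S \<Longrightarrow> T i j = T' i j"
  shows "ldet S T = ldet S T'"
  unfolding ldet_def
  by (intro sum.cong arg_cong2[where f = times] prod.cong) (auto simp: assms permutes_in_image)

text \<open>Bridge to matrices, through which equal rows, row permutations and kernel vectors of
  singular matrices become available.\<close>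

lemma ldet_eq_det: "ldet {..<n} T = Determinant.det (Matrix.mat n n (\<lambda>(i, j). T i j))"
proof -
  have "(\<Prod>i = 0..<n. Matrix.mat n n (\<lambda>(i, j). T i j) $$ (i, p i)) = (\<Prod>i = 0..<n. T i (p i))"
    if p: "p permutes {0..<n}" for p
  proof (rule prod.cong[OF refl])
    fix i assume "i \<in> {0..<n}"
    then show "Matrix.mat n n (\<lambda>(i, j). T i j) $$ (i, p i) = T i (p i)"
      using permutes_in_image[OF p, of i] by simp
  qed
  then have "Determinant.det (Matrix.mat n n (\<lambda>(i, j). T i j))
      = (\<Sum>p | p permutes {0..<n}. of_int (sign p) * (\<Prod>i = 0..<n. T i (p i)))"
    by (subst det_def'[of _ n]) (auto intro!: sum.cong)
  then show ?thesis by (simp only: ldet_def lessThan_atLeast0)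
qed

lemma ldet_transpose:
  assumes "finite S"
  shows "ldet S (\<lambda>i j. T j i) = ldet S T"
  unfolding ldet_def
proof (rule sum.reindex_bij_witness[where i = "inv_into UNIV" and j = "inv_into UNIV"])
  fix p assume p: "p \<in> {p. p permutes S}"
  then have perm: "permutation p" using assms by (auto simp: permutation_permutes)
  have "(\<Prod>i\<in>S. T (p i) i) = (\<Prod>i\<in>S. T i (inv_into UNIV p i))"
    using p by (intro prod.reindex_bij_witness[where i = "inv_into UNIV p" and j = p])
      (auto simp: permutes_inverses permutes_in_image permutes_inv)
  then show "of_int (sign (inv_into UNIV p)) * (\<Prod>i\<in>S. T i (inv_into UNIV p i)) = of_int (sign p) * (\<Prod>i\<in>S. T (p i) i)"
    using perm by (simp add: sign_inverse)
qed (auto simp: permutes_inv permutes_inv_inv)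

text \<open>Conjugation by \<open>k\<close> carries the permutations of \<open>A\<close> to those of
  the image and preserves their signs.\<close>

lemma ldet_reindex:
  assumes "finite A" "inj_on k A"
  shows "ldet (k ` A) T = ldet A (\<lambda>i j. T (k i) (k j))"
proof -
  have bij: "bij_betw k A (k ` A)" using assms(2) by (simp add: inj_on_imp_bij_betw)
  have bij': "bij_betw (inv_into A k) (k ` A) A" using bij by (rule bij_betw_inv_into)
  show ?thesis
    unfolding ldet_def
  proof (rule sum.reindex_bij_witness[symmetric, where
        i = "map_permutation (k ` A) (inv_into A k)" and j = "map_permutation A k"])
    fix p assume p: "p \<in> {p. p permutes A}"
    then have "map_permutation A k p permutes k ` A"
      using bij by (auto intro!: map_permutation_permutes)
    then show "map_permutation A k p \<in> {p. p permutes k ` A}" by simp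
    show "map_permutation (k ` A) (inv_into A k) (map_permutation A k p) = p"
      using p assms by (intro map_permutation_compose_inv) (auto simp: bij)
    have "(\<Prod>i\<in>k ` A. T i (map_permutation A k p i)) = (\<Prod>i\<in>A. T (k i) (k (p i)))"
      using assms(2) by (simp add: prod.reindex map_permutation_apply)
    then show "of_int (sign (map_permutation A k p)) * (\<Prod>i\<in>k ` A. T i (map_permutation A k p i))
        = of_int (sign p) * (\<Prod>i\<in>A. T (k i) (k (p i)))"
      using p assms by (simp add: sign_map_permutation)
  next
    fix p assume p: "p \<in> {p. p permutes k ` A}"
    then have "map_permutation (k ` A) (inv_into A k) p permutes A"
      using bij' by (auto intro!: map_permutation_permutes)
    then show "map_permutation (k ` A) (inv_into A k) p \<in> {p. p permutes A}" by simp
    show "map_permutation A k (map_permutation (k ` A) (inv_into A k) p) = p"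
      using p assms bij' by (intro map_permutation_compose_inv) (auto simp: f_inv_into_f)
  qed
qed

lemma ldet_identical_rows:
  fixes n :: nat
  assumes "i < n" "j < n" "i \<noteq> j" "\<And>m. m < n \<Longrightarrow> T i m = T j m"
  shows "ldet {..<n} T = 0"
proof -
  have "Matrix.row (Matrix.mat n n (\<lambda>(i, j). T i j)) i = Matrix.row (Matrix.mat n n (\<lambda>(i, j). T i j)) j"
    using assms by (intro eq_vecI) simp_all
  then show ?thesis
    unfolding ldet_eq_det by (intro det_identical_rows[of _ n i j]) (simp_all add: assms)
qed

lemma ldet_permute_rows:
  fixes n :: nat
  assumes "q permutes {..<n}"
  shows "ldet {..<n} (\<lambda>i j. T (q i) j) = of_int (sign q) * ldet {..<n} T"
proof -
  have q: "q i < n" if "i < n" for i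
    using permutes_in_image[OF assms, of i] that by simp
  have "Matrix.mat n n (\<lambda>(i, j). Matrix.mat n n (\<lambda>(i, j). T i j) $$ (q i, j))
      = Matrix.mat n n (\<lambda>(i, j). T (q i) j)"
    by (rule eq_matI) (simp_all add: q)
  moreover have "Determinant.det (Matrix.mat n n (\<lambda>(i, j). Matrix.mat n n (\<lambda>(i, j). T i j) $$ (q i, j)))
      = of_int (sign q) * Determinant.det (Matrix.mat n n (\<lambda>(i, j). T i j))"
    by (rule det_permute_rows) (use assms in \<open>simp_all add: lessThan_atLeast0\<close>)
  ultimately show ?thesis by (simp only: ldet_eq_det)
qed

text \<open>Expansion of det(I + T) into principal minors: multiply out the factors of each
  permutation product. Choosing the entry of the identity on \<open>U - S\<close> forces the
  permutation to fix \<open>U - S\<close> pointwise, so exactly the permutations of \<open>S\<close>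
  survive.\<close>

lemma ldet_add_identity:
  assumes "finite U"
  shows "ldet U (\<lambda>i j. (if i = j then 1 else 0) + T i j) = (\<Sum>S\<in>Pow U. ldet S T)"
proof -
  have "(\<Sum>p | p permutes U. of_int (sign p) * (\<Prod>i\<in>S. T i (p i)) * (\<Prod>i\<in>U - S. if i = p i then 1 else 0))
      = ldet S T" if S: "S \<subseteq> U" for S
  proof -
    have fin: "finite (U - S)" "finite {p. p permutes U}" using assms by (auto intro: finite_permutations)
    have sub: "{p. p permutes S} \<subseteq> {p. p permutes U}" using S by (auto intro: permutes_subset)
    have zero: "(\<Prod>i\<in>U - S. if i = p i then 1 else (0::'b)) = 0"
      if "p permutes U" "\<not> p permutes S" for p
    proof -
      have "\<exists>i\<in>U - S. p i \<noteq> i"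
        using that by (metis Diff_iff permutes_superset)
      then obtain i where "i \<in> U - S" "i \<noteq> p i" by metis
      then show ?thesis using fin(1) by (intro prod_zero bexI[of _ i]) simp_all
    qed
    have one: "(\<Prod>i\<in>U - S. if i = p i then 1 else (0::'b)) = 1" if "p permutes S" for p
      using that by (intro prod.neutral) (auto simp: permutes_not_in)
    show ?thesis
      unfolding ldet_def
      by (rule sum.mono_neutral_cong_right) (use fin sub zero one in auto)
  qed
  then have "(\<Sum>S\<in>Pow U. ldet S T) = (\<Sum>S\<in>Pow U. \<Sum>p | p permutes U.
      of_int (sign p) * (\<Prod>i\<in>S. T i (p i)) * (\<Prod>i\<in>U - S. if i = p i then 1 else 0))"
    by (intro sum.cong) auto
  also have "\<dots> = (\<Sum>p | p permutes U. \<Sum>S\<in>Pow U.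
      of_int (sign p) * ((\<Prod>i\<in>S. T i (p i)) * (\<Prod>i\<in>U - S. if i = p i then 1 else 0)))"
    by (subst sum.swap) (simp add: mult.assoc)
  also have "\<dots> = ldet U (\<lambda>i j. (if i = j then 1 else 0) + T i j)"
  proof -
    have "(\<Sum>S\<in>Pow U. (\<Prod>i\<in>S. T i (p i)) * (\<Prod>i\<in>U - S. if i = p i then 1 else 0))
        = (\<Prod>i\<in>U. (if i = p i then 1 else 0) + T i (p i))" for p
      by (subst add.commute, subst prod_add[OF assms]) (rule refl)
    then show ?thesis by (simp add: ldet_def sum_distrib_left[symmetric])
  qed
  finally show ?thesis by simp
qed

lemma ldet_sum_product:
  fixes n :: nat
  assumes "finite E"
  shows "ldet {..<n} (\<lambda>i j. \<Sum>e\<in>E. a i e * b e j)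
    = (\<Sum>\<alpha>\<in>{..<n} \<rightarrow>\<^sub>E E. (\<Prod>i<n. a i (\<alpha> i)) * ldet {..<n} (\<lambda>i j. b (\<alpha> i) j))"
proof -
  have "ldet {..<n} (\<lambda>i j. \<Sum>e\<in>E. a i e * b e j)
      = (\<Sum>p | p permutes {..<n}. of_int (sign p) *
          (\<Sum>\<alpha>\<in>{..<n} \<rightarrow>\<^sub>E E. \<Prod>i<n. a i (\<alpha> i) * b (\<alpha> i) (p i)))"
    unfolding ldet_def by (subst prod_sum_PiE) (use assms in auto)
  also have "\<dots> = (\<Sum>\<alpha>\<in>{..<n} \<rightarrow>\<^sub>E E. \<Sum>p | p permutes {..<n}.
        (\<Prod>i<n. a i (\<alpha> i)) * (of_int (sign p) * (\<Prod>i<n. b (\<alpha> i) (p i))))"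
    by (subst sum.swap) (simp add: sum_distrib_left prod.distrib mult_ac)
  finally show ?thesis by (simp add: ldet_def sum_distrib_left)
qed

text \<open>Cauchy--Binet for a weighted Gram matrix. Reordering \<open>\<alpha>\<close> by a
  permutation q does not change the multilinear expansion; summing over all q costs the factor n!
  and assembles the products of the v into a second determinant, the conjugate of the first.\<close>

lemma fact_smult_ldet_gram:
  fixes v :: "'e \<Rightarrow> nat \<Rightarrow> complex"
  assumes "finite E"
  shows "fact n * ldet {..<n} (\<lambda>i j. \<Sum>e\<in>E. z e * v e i * cnj (v e j))
    = (\<Sum>\<alpha>\<in>{..<n} \<rightarrow>\<^sub>E E. (\<Prod>i<n. z (\<alpha> i)) *
        of_real ((cmod (ldet {..<n} (\<lambda>i j. v (\<alpha> i) j)))\<^sup>2))"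
proof -
  define L where "L \<alpha> = ldet {..<n} (\<lambda>i j. v (\<alpha> i) j)" for \<alpha>
  define G where "G \<alpha> = (\<Prod>i<n. z (\<alpha> i)) * (\<Prod>i<n. v (\<alpha> i) i) * cnj (L \<alpha>)" for \<alpha>
  have cnjL: "ldet {..<n} (\<lambda>i j. cnj (v (\<alpha> i) j)) = cnj (L \<alpha>)" for \<alpha>
    by (simp add: L_def ldet_def)
  have D: "ldet {..<n} (\<lambda>i j. \<Sum>e\<in>E. z e * v e i * cnj (v e j)) = (\<Sum>\<alpha>\<in>{..<n} \<rightarrow>\<^sub>E E. G \<alpha>)"
    using ldet_sum_product[OF assms, of n "\<lambda>i e. z e * v e i" "\<lambda>e j. cnj (v e j)"]
    by (simp add: cnjL G_def prod.distrib)
  have perm: "(\<Sum>\<alpha>\<in>{..<n} \<rightarrow>\<^sub>E E. G \<alpha>) = (\<Sum>\<alpha>\<in>{..<n} \<rightarrow>\<^sub>E E. G (\<alpha> \<circ> q))"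
    if q: "q permutes {..<n}" for q
  proof (rule sum.reindex_bij_witness[symmetric, where i = "\<lambda>\<alpha>. \<alpha> \<circ> inv_into UNIV q" and j = "\<lambda>\<alpha>. \<alpha> \<circ> q"])
    have *: "\<alpha> \<circ> p \<in> {..<n} \<rightarrow>\<^sub>E E" if "p permutes {..<n}" "\<alpha> \<in> {..<n} \<rightarrow>\<^sub>E E" for p \<alpha>
    proof (rule PiE_I)
      fix i assume "i \<in> {..<n}"
      then show "(\<alpha> \<circ> p) i \<in> E"
        using permutes_in_image[OF that(1), of i] PiE_mem[OF that(2), of "p i"] by simp
    next
      fix i assume "i \<notin> {..<n}"
      then show "(\<alpha> \<circ> p) i = undefined"
        using permutes_not_in[OF that(1), of i] PiE_arb[OF that(2), of i] by simp
    qed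
    fix \<alpha> assume \<alpha>: "\<alpha> \<in> {..<n} \<rightarrow>\<^sub>E E"
    show "\<alpha> \<circ> q \<in> {..<n} \<rightarrow>\<^sub>E E" using * q \<alpha> by blast
    show "\<alpha> \<circ> inv_into UNIV q \<in> {..<n} \<rightarrow>\<^sub>E E" using * permutes_inv[OF q] \<alpha> by blast
    show "\<alpha> \<circ> q \<circ> inv_into UNIV q = \<alpha>" "\<alpha> \<circ> inv_into UNIV q \<circ> q = \<alpha>"
      by (auto simp: o_assoc[symmetric] permutes_inv_o[OF q])
  qed simp
  have Gq: "G (\<alpha> \<circ> q) = (\<Prod>i<n. z (\<alpha> i)) * cnj (L \<alpha>) * (of_int (sign q) * (\<Prod>i<n. v (\<alpha> (q i)) i))"
    if q: "q permutes {..<n}" for q \<alpha>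
  proof -
    have "L (\<alpha> \<circ> q) = of_int (sign q) * L \<alpha>"
      using ldet_permute_rows[OF q, of "\<lambda>i j. v (\<alpha> i) j"] by (simp add: L_def)
    moreover have "(\<Prod>i<n. z (\<alpha> (q i))) = (\<Prod>i<n. z (\<alpha> i))"
      using q by (intro prod.permute[symmetric, unfolded o_def]) auto
    ultimately show ?thesis by (simp add: G_def)
  qed
  have "fact n * (\<Sum>\<alpha>\<in>{..<n} \<rightarrow>\<^sub>E E. G \<alpha>) = (\<Sum>q | q permutes {..<n}. \<Sum>\<alpha>\<in>{..<n} \<rightarrow>\<^sub>E E. G \<alpha>)"
    by (simp add: card_permutations)
  also have "\<dots> = (\<Sum>q | q permutes {..<n}. \<Sum>\<alpha>\<in>{..<n} \<rightarrow>\<^sub>E E. G (\<alpha> \<circ> q))"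
    by (rule sum.cong[OF refl], rule perm) simp
  also have "\<dots> = (\<Sum>\<alpha>\<in>{..<n} \<rightarrow>\<^sub>E E. \<Sum>q | q permutes {..<n}.
      (\<Prod>i<n. z (\<alpha> i)) * cnj (L \<alpha>) * (of_int (sign q) * (\<Prod>i<n. v (\<alpha> (q i)) i)))"
    by (subst sum.swap) (intro sum.cong refl, simp add: Gq)
  also have "\<dots> = (\<Sum>\<alpha>\<in>{..<n} \<rightarrow>\<^sub>E E. (\<Prod>i<n. z (\<alpha> i)) * cnj (L \<alpha>) *
      ldet {..<n} (\<lambda>i j. v (\<alpha> j) i))"
    by (simp add: sum_distrib_left[symmetric] ldet_def)
  also have "\<dots> = (\<Sum>\<alpha>\<in>{..<n} \<rightarrow>\<^sub>E E. (\<Prod>i<n. z (\<alpha> i)) * of_real ((cmod (L \<alpha>))\<^sup>2))"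
  proof (rule sum.cong[OF refl])
    fix \<alpha>
    have "ldet {..<n} (\<lambda>i j. v (\<alpha> j) i) = L \<alpha>"
      using ldet_transpose[of "{..<n}" "\<lambda>i j. v (\<alpha> i) j"] by (simp add: L_def)
    moreover have "of_real ((cmod (L \<alpha>))\<^sup>2) = L \<alpha> * cnj (L \<alpha>)"
      by (rule complex_norm_square)
    ultimately show "(\<Prod>i<n. z (\<alpha> i)) * cnj (L \<alpha>) * ldet {..<n} (\<lambda>i j. v (\<alpha> j) i)
        = (\<Prod>i<n. z (\<alpha> i)) * of_real ((cmod (L \<alpha>))\<^sup>2)"
      by (simp only: mult_ac)
  qed
  finally show ?thesis by (simp add: D L_def)
qed

section \<open>Negative association\<close>

lemma sum_Pow_remove:
  fixes g :: "'e set \<Rightarrow> 'c::comm_monoid_add"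
  assumes "finite F" "b \<in> F"
  shows "(\<Sum>S\<in>Pow F. g S) = (\<Sum>S\<in>Pow (F - {b}). g S) + (\<Sum>S\<in>Pow (F - {b}). g (insert b S))"
proof -
  have F: "Pow F = Pow (F - {b}) \<union> insert b ` Pow (F - {b})"
    using Pow_insert[of b "F - {b}"] assms(2) by (simp add: insert_absorb)
  have inj: "inj_on (insert b) (Pow (F - {b}))"
    by (rule inj_onI) blast
  show ?thesis
    unfolding F using assms(1) inj by (subst sum.union_disjoint) (auto simp: sum.reindex)
qed

text \<open>Elements of \<open>I\<close> are conditioned to be present, those of \<open>F\<close>
  are free, and all others are conditioned to be absent. For \<open>h = 1\<close> this is the
  unnormalized probability of the condition; \<open>h\<close> is evaluated at the free part
  alone.\<close>

definition minor_sum :: "('e set \<Rightarrow> real) \<Rightarrow> 'e set \<Rightarrow> 'e set \<Rightarrow> ('e set \<Rightarrow> real) \<Rightarrow> real" where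
  "minor_sum w I F h = (\<Sum>S\<in>Pow F. w (I \<union> S) * h S)"

lemma minor_sum_remove:
  assumes "finite F" "b \<in> F"
  shows "minor_sum w I F h = minor_sum w I (F - {b}) h + minor_sum w (insert b I) (F - {b}) (\<lambda>S. h (insert b S))"
  unfolding minor_sum_def by (subst sum_Pow_remove[OF assms]) simp

lemma minor_sum_insert_eq:
  assumes "finite F" "b \<in> F"
  shows "minor_sum w (insert b I) (F - {b}) (\<lambda>S. h (insert b S)) = (\<Sum>S\<in>Pow F. of_bool (b \<in> S) * (w (I \<union> S) * h S))"
  unfolding minor_sum_def by (subst sum_Pow_remove[OF assms]) (auto intro!: sum.neutral)

text \<open>Double counting of pairs (b, S) with b in S: by homogeneity every \<open>S\<close> of
  nonzero weight has \<open>d - card I\<close> elements. The subtraction is real, so that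
  \<open>card I > d\<close>, where all the weights vanish, is covered too.\<close>

lemma sum_minor_sum_insert:
  fixes w :: "'e set \<Rightarrow> real"
  assumes "finite F" "finite I" "I \<inter> F = {}" and homog: "\<And>S. w S \<noteq> 0 \<Longrightarrow> card S = d"
  shows "(\<Sum>b\<in>F. minor_sum w (insert b I) (F - {b}) (\<lambda>S. h (insert b S))) = (real d - real (card I)) * minor_sum w I F h"
proof -
  have "(\<Sum>b\<in>F. minor_sum w (insert b I) (F - {b}) (\<lambda>S. h (insert b S)))
      = (\<Sum>b\<in>F. \<Sum>S\<in>Pow F. of_bool (b \<in> S) * (w (I \<union> S) * h S))"
    using assms(1) by (intro sum.cong refl minor_sum_insert_eq)
  also have "\<dots> = (\<Sum>S\<in>Pow F. (\<Sum>b\<in>F. of_bool (b \<in> S)) * (w (I \<union> S) * h S))"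
    by (subst sum.swap) (simp add: sum_distrib_right)
  also have "\<dots> = (\<Sum>S\<in>Pow F. (real d - real (card I)) * (w (I \<union> S) * h S))"
  proof (rule sum.cong[OF refl])
    fix S assume S: "S \<in> Pow F"
    have "(\<Sum>b\<in>F. of_bool (b \<in> S)) = real (card S)"
      using S assms(1) by (auto simp: of_bool_def sum.If_cases Int_absorb1)
    moreover have "real (card S) = real d - real (card I)" if "w (I \<union> S) \<noteq> 0"
    proof -
      have "finite S" using S assms(1) by (auto intro: finite_subset)
      then have "card (I \<union> S) = card I + card S"
        using S assms by (intro card_Un_disjoint) auto
      then show ?thesis using homog[OF that] by simp
    qed
    ultimately show "(\<Sum>b\<in>F. of_bool (b \<in> S)) * (w (I \<union> S) * h S) = (real d - real (card I)) * (w (I \<union> S) * h S)"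
      by (cases "w (I \<union> S) = 0") simp_all
  qed
  finally show ?thesis by (simp add: minor_sum_def sum_distrib_left)
qed

text \<open>Indices 1 and 0 stand for presence and absence of b; \<open>p\<close> and
  \<open>h\<close> are the mass and the weighted sum with a present, \<open>q\<close> and
  \<open>k\<close> those with a absent. In each of the two cases dropping a raises the mean;
  moreover (\<open>r\<close>) it moves mass towards b, where (\<open>s\<close>) the mean is larger.
  So the mixed mean rises as well. The assumptions \<open>z\<close> take care of vanishing
  masses.\<close>

lemma weighted_ratio_mono:
  fixes p0 p1 q0 q1 h0 h1 k0 k1 :: real
  assumes nn: "0 \<le> p0" "0 < p1" "0 \<le> q0" "0 \<le> q1"
    and 1: "h1 * q1 \<le> k1 * p1" and 0: "h0 * q0 \<le> k0 * p0"
    and r: "p1 * q0 \<le> p0 * q1" and s: "h0 * p1 \<le> h1 * p0"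
    and z: "p0 = 0 \<Longrightarrow> h0 = 0" "q0 = 0 \<Longrightarrow> k0 = 0"
  shows "(h0 + h1) * (q0 + q1) \<le> (k0 + k1) * (p0 + p1)"
proof (cases "p0 = 0")
  case True
  then have "q0 = 0" using r nn by (simp add: mult_le_0_iff)
  then show ?thesis using True z 1 by simp
next
  case False
  then have p0: "0 < p0" using nn by simp
  define \<alpha> \<beta> where "\<alpha> = h1 / p1" and "\<beta> = h0 / p0"
  have h: "h1 = \<alpha> * p1" "h0 = \<beta> * p0" using p0 nn by (simp_all add: \<alpha>_def \<beta>_def)
  have k1: "\<alpha> * q1 \<le> k1" using 1 nn by (simp add: h mult.assoc mult.commute[of p1] flip: mult.assoc)
  have k0: "\<beta> * q0 \<le> k0" using 0 p0 by (simp add: h mult.assoc mult.commute[of p0] flip: mult.assoc)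
  have "\<beta> * (p0 * p1) \<le> \<alpha> * (p0 * p1)" using s by (simp add: h mult_ac)
  then have ab: "\<beta> \<le> \<alpha>" using p0 nn by simp
  have "(\<alpha> - \<beta>) * (p1 * q0 - p0 * q1) \<le> 0" using ab r by (intro mult_nonneg_nonpos) auto
  then have "(h0 + h1) * (q0 + q1) \<le> (\<beta> * q0 + \<alpha> * q1) * (p0 + p1)"
    by (simp add: h algebra_simps)
  also have "\<dots> \<le> (k0 + k1) * (p0 + p1)"
    using k0 k1 nn by (intro mult_right_mono add_mono) auto
  finally show ?thesis .
qed

text \<open>The Feder--Mihail induction: by homogeneity, some element of \<open>F\<close> is positively correlated with \<open>h\<close>
  conditionally on \<open>a\<close>, and conditioning on that element reduces \<open>F\<close>.\<close>

lemma negative_association_singleton: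
  fixes w h :: "'e set \<Rightarrow> real"
  assumes nonneg: "\<And>S. 0 \<le> w S" and homog: "\<And>S. w S \<noteq> 0 \<Longrightarrow> card S = d"
    and rayleigh: "\<And>I F a b. finite I \<Longrightarrow> finite F \<Longrightarrow> I \<inter> F = {} \<Longrightarrow> a \<noteq> b \<Longrightarrow> a \<notin> I \<union> F \<Longrightarrow> b \<notin> I \<union> F \<Longrightarrow>
        minor_sum w (insert a (insert b I)) F (\<lambda>_. 1) * minor_sum w I F (\<lambda>_. 1)
        \<le> minor_sum w (insert a I) F (\<lambda>_. 1) * minor_sum w (insert b I) F (\<lambda>_. 1)"
    and "finite F" "finite I" "I \<inter> F = {}" "a \<notin> I \<union> F"
    and mono: "\<And>S T. S \<subseteq> T \<Longrightarrow> T \<subseteq> F \<Longrightarrow> h S \<le> h T"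
  shows "minor_sum w (insert a I) F h * minor_sum w I F (\<lambda>_. 1) \<le> minor_sum w I F h * minor_sum w (insert a I) F (\<lambda>_. 1)"
  using \<open>finite F\<close> \<open>finite I\<close> \<open>I \<inter> F = {}\<close> \<open>a \<notin> I \<union> F\<close> mono
proof (induction "card F" arbitrary: F I h rule: less_induct)
  case less
  note fin = \<open>finite F\<close> \<open>finite I\<close> and disj = \<open>I \<inter> F = {}\<close> and a = \<open>a \<notin> I \<union> F\<close>
  let ?Z = "\<lambda>I F. minor_sum w I F (\<lambda>_. 1)"
  have Z_nonneg: "0 \<le> ?Z J G" for J G
    unfolding minor_sum_def by (intro sum_nonneg) (simp add: nonneg)
  have H_zero: "minor_sum w J G k = 0" if "?Z J G = 0" "finite G" for J G k
  proof -
    have "\<forall>S\<in>Pow G. w (J \<union> S) = 0"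
      using that by (simp add: minor_sum_def sum_nonneg_eq_0_iff nonneg)
    then show ?thesis by (simp add: minor_sum_def)
  qed
  \<comment> \<open>The number of free elements in every set of positive weight that contains
    \<open>insert a I\<close>.\<close>
  define r where "r = real d - real (card (insert a I))"
  have sumH: "(\<Sum>b\<in>F. minor_sum w (insert b (insert a I)) (F - {b}) (\<lambda>S. k (insert b S))) = r * minor_sum w (insert a I) F k" for k
    unfolding r_def using fin disj a homog by (intro sum_minor_sum_insert) auto
  show ?case
  proof (cases "?Z (insert a I) F = 0 \<or> r = 0")
    \<comment> \<open>Either no mass has \<open>a\<close> present, or all such mass sits at
      \<open>S = {}\<close>. In both cases the sum of \<open>h\<close> is \<open>h {}\<close> times
      the mass, and \<open>h {}\<close> is the minimum of \<open>h\<close>.\<close>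
    case True
    have base: "h {} * minor_sum w J F (\<lambda>_. 1) \<le> minor_sum w J F h" for J
      unfolding minor_sum_def sum_distrib_left
      by (intro sum_mono) (auto simp: mult.commute[of "h _"] intro!: mult_left_mono nonneg less.prems(5))
    have "minor_sum w (insert a I) F h = h {} * ?Z (insert a I) F"
    proof (cases "?Z (insert a I) F = 0")
      case True
      then show ?thesis using H_zero fin by simp
    next
      case False
      then have r: "r = 0" using True by simp
      have "w (insert a I \<union> S) = 0" if "S \<in> Pow F - {{}}" for S
      proof (rule ccontr)
        assume "w (insert a I \<union> S) \<noteq> 0"
        moreover have "card (insert a I \<union> S) = card (insert a I) + card S"
          using that fin disj a by (intro card_Un_disjoint) (auto intro: finite_subset)
        ultimately have "card S = 0" using homog[of "insert a I \<union> S"] r by (simp add: r_def)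
        then show False using that fin by (auto dest: finite_subset)
      qed
      then have "minor_sum w (insert a I) F k = w (insert a I) * k {}" for k
        unfolding minor_sum_def
        by (subst sum.mono_neutral_right[where S = "{{}}"]) (use fin in auto)
      then show ?thesis by simp
    qed
    then show ?thesis
      using mult_right_mono[OF base[of I] Z_nonneg[of "insert a I" F]] by (simp add: mult_ac)
  next
    case False
    then have Za: "0 < ?Z (insert a I) F" and r: "r \<noteq> 0"
      using Z_nonneg[of "insert a I" F] by auto
    define p1 h1 where "p1 b = ?Z (insert b (insert a I)) (F - {b})"
      and "h1 b = minor_sum w (insert b (insert a I)) (F - {b}) (\<lambda>S. h (insert b S))" for b
    have sp: "(\<Sum>b\<in>F. p1 b) = r * ?Z (insert a I) F"
      unfolding p1_def by (rule sumH)
    have sh: "(\<Sum>b\<in>F. h1 b) = r * minor_sum w (insert a I) F h"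
      unfolding h1_def by (rule sumH)
    have p1_nonneg: "0 \<le> p1 b" for b by (simp add: p1_def Z_nonneg)
    \<comment> \<open>By \<open>sp\<close> and \<open>sh\<close> the two sides of the inequality
      have equal sums over \<open>b\<close>. If it failed for every \<open>b\<close> with
      \<open>p1 b > 0\<close>, the sums would differ strictly, since \<open>r\<close> and the mass
      are nonzero and hence some \<open>p1 b\<close> is.\<close>
    have "\<exists>b\<in>F. 0 < p1 b \<and> minor_sum w (insert a I) F h * p1 b \<le> h1 b * ?Z (insert a I) F"
    proof (rule ccontr)
      assume "\<not> ?thesis"
      then have *: "0 < p1 b \<Longrightarrow> h1 b * ?Z (insert a I) F < minor_sum w (insert a I) F h * p1 b" if "b \<in> F" for b
        using that by force
      have le: "h1 b * ?Z (insert a I) F \<le> minor_sum w (insert a I) F h * p1 b" if "b \<in> F" for b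
      proof (cases "p1 b = 0")
        case True
        then have "h1 b = 0" using H_zero fin by (simp add: p1_def h1_def)
        then show ?thesis using True by simp
      next
        case False
        then show ?thesis using *[OF that] p1_nonneg[of b] by simp
      qed
      have "(\<Sum>b\<in>F. p1 b) \<noteq> 0" using sp r Za by simp
      then obtain b where b: "b \<in> F" "p1 b \<noteq> 0" by (metis sum.neutral)
      have "(\<Sum>b\<in>F. h1 b * ?Z (insert a I) F) < (\<Sum>b\<in>F. minor_sum w (insert a I) F h * p1 b)"
        using fin b * le p1_nonneg[of b] by (intro sum_strict_mono_ex1) (auto intro!: bexI[of _ b])
      then show False
        by (simp add: sum_distrib_left[symmetric] sum_distrib_right[symmetric] sp sh mult_ac)
    qed
    then obtain b where b: "b \<in> F" and p1: "0 < p1 b"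
      and corr: "minor_sum w (insert a I) F h * p1 b \<le> h1 b * ?Z (insert a I) F" by blast
    let ?F = "F - {b}" and ?h = "\<lambda>S. h (insert b S)"
    have cardF: "card ?F < card F" using fin(1) b by (rule card_Diff1_less)
    have ab: "a \<noteq> b" "insert b (insert a I) = insert a (insert b I)" using a b by auto
    have mono': "h S \<le> h T" if "S \<subseteq> T" "T \<subseteq> F" for S T
      using less.prems(5) that by blast
    have IH1: "minor_sum w (insert a (insert b I)) ?F ?h * ?Z (insert b I) ?F
        \<le> minor_sum w (insert b I) ?F ?h * ?Z (insert a (insert b I)) ?F"
      using fin disj a b cardF by (intro less.hyps) (auto intro!: mono')
    have IH0: "minor_sum w (insert a I) ?F h * ?Z I ?F \<le> minor_sum w I ?F h * ?Z (insert a I) ?F"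
      using fin disj a b cardF by (intro less.hyps) (auto intro!: mono')
    have R: "?Z (insert a (insert b I)) ?F * ?Z I ?F \<le> ?Z (insert a I) ?F * ?Z (insert b I) ?F"
      using fin disj a b ab by (intro rayleigh) auto
    have split: "minor_sum w J F h = minor_sum w J ?F h + minor_sum w (insert b J) ?F ?h"
      "?Z J F = ?Z J ?F + ?Z (insert b J) ?F" for J
      using minor_sum_remove[OF fin(1) b] by auto
    \<comment> \<open>The choice of \<open>b\<close> compares its presence with the unconditioned
      mean; cancelling the part common to both sides compares presence with absence.\<close>
    have s: "minor_sum w (insert a I) ?F h * ?Z (insert a (insert b I)) ?F
        \<le> minor_sum w (insert a (insert b I)) ?F ?h * ?Z (insert a I) ?F"
      using corr by (simp add: split p1_def h1_def ab algebra_simps)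
    show ?thesis
      unfolding split[of I] split[of "insert a I"] ab(2)
      by (rule weighted_ratio_mono)
        (use Z_nonneg p1 IH1 IH0 R s fin H_zero in \<open>auto simp: p1_def ab(2)\<close>)
  qed
qed

section \<open>Determinantal weights\<close>

text \<open>The squared modulus of the minor with rows \<open>S\<close>, written as an average over
  the d! enumerations of \<open>S\<close> so that the elements need no order. If \<open>S\<close>
  does not have \<open>d\<close> elements, either no map has image \<open>S\<close> or every such
  map repeats a row.\<close>

definition det_weight :: "nat \<Rightarrow> 'e set \<Rightarrow> ('e \<Rightarrow> nat \<Rightarrow> complex) \<Rightarrow> 'e set \<Rightarrow> real" where
  "det_weight d E v S =
    (\<Sum>\<alpha>\<in>{\<alpha> \<in> {..<d} \<rightarrow>\<^sub>E E. \<alpha> ` {..<d} = S}. (cmod (ldet {..<d} (\<lambda>i j. v (\<alpha> i) j)))\<^sup>2) / fact d"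

lemma det_weight_nonneg: "0 \<le> det_weight d E v S"
  unfolding det_weight_def by (intro divide_nonneg_nonneg sum_nonneg) auto

lemma det_weight_outside: "det_weight d E v S = 0" if "\<not> S \<subseteq> E"
proof -
  have empty: "{\<alpha> \<in> {..<d} \<rightarrow>\<^sub>E E. \<alpha> ` {..<d} = S} = {}" using that by (auto dest: PiE_mem)
  show ?thesis unfolding det_weight_def empty by simp
qed

lemma ldet_rows_not_inj:
  fixes d :: nat
  assumes "\<not> inj_on \<alpha> {..<d}"
  shows "ldet {..<d} (\<lambda>i j. v (\<alpha> i) j) = 0"
proof -
  obtain i j where "i < d" "j < d" "i \<noteq> j" "\<alpha> i = \<alpha> j"
    using assms by (auto simp: inj_on_def)
  then show ?thesis by (intro ldet_identical_rows[of i d j]) auto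
qed

lemma det_weight_homogeneous: "card S = d" if "det_weight d E v S \<noteq> 0"
proof (rule ccontr)
  assume card: "card S \<noteq> d"
  have "ldet {..<d} (\<lambda>i j. v (\<alpha> i) j) = 0" if "\<alpha> ` {..<d} = S" for \<alpha>
    using that card card_image[of \<alpha> "{..<d}"] by (intro ldet_rows_not_inj) auto
  then have "det_weight d E v S = 0" unfolding det_weight_def by simp
  then show False using that by simp
qed

text \<open>Cauchy--Binet with the maps grouped by their image. Read as a polynomial in
  \<open>z\<close>, this is the generating polynomial of the weights.\<close>

lemma ldet_weighted_gram:
  assumes "finite E"
  shows "ldet {..<d} (\<lambda>i j. \<Sum>e\<in>E. z e * v e i * cnj (v e j))
    = (\<Sum>S\<in>Pow E. complex_of_real (det_weight d E v S) * (\<Prod>e\<in>S. z e))"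
proof -
  define c where "c \<alpha> = complex_of_real ((cmod (ldet {..<d} (\<lambda>i j. v (\<alpha> i) j)))\<^sup>2)" for \<alpha>
  have fin: "finite ({..<d} \<rightarrow>\<^sub>E E)" using assms by (intro finite_PiE) auto
  have prod: "(\<Prod>i<d. z (\<alpha> i)) * c \<alpha> = (\<Prod>e\<in>\<alpha> ` {..<d}. z e) * c \<alpha>" for \<alpha>
  proof (cases "inj_on \<alpha> {..<d}")
    case True
    then show ?thesis by (simp add: prod.reindex)
  next
    case False
    then have "c \<alpha> = 0" using ldet_rows_not_inj[of \<alpha> d v] by (simp add: c_def)
    then show ?thesis by simp
  qed
  have "fact d * ldet {..<d} (\<lambda>i j. \<Sum>e\<in>E. z e * v e i * cnj (v e j))
      = (\<Sum>\<alpha>\<in>{..<d} \<rightarrow>\<^sub>E E. (\<Prod>e\<in>\<alpha> ` {..<d}. z e) * c \<alpha>)"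
    unfolding fact_smult_ldet_gram[OF assms] c_def[symmetric] by (intro sum.cong refl prod)
  also have "\<dots> = (\<Sum>S\<in>Pow E. \<Sum>\<alpha>\<in>{\<alpha> \<in> {..<d} \<rightarrow>\<^sub>E E. \<alpha> ` {..<d} = S}. (\<Prod>e\<in>\<alpha> ` {..<d}. z e) * c \<alpha>)"
    using assms fin by (intro sum.group[symmetric]) (auto dest: PiE_mem)
  also have "\<dots> = (\<Sum>S\<in>Pow E. fact d * (complex_of_real (det_weight d E v S) * (\<Prod>e\<in>S. z e)))"
  proof (rule sum.cong[OF refl])
    fix S
    have "(\<Sum>\<alpha>\<in>{\<alpha> \<in> {..<d} \<rightarrow>\<^sub>E E. \<alpha> ` {..<d} = S}. (\<Prod>e\<in>\<alpha> ` {..<d}. z e) * c \<alpha>)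
        = (\<Prod>e\<in>S. z e) * (\<Sum>\<alpha>\<in>{\<alpha> \<in> {..<d} \<rightarrow>\<^sub>E E. \<alpha> ` {..<d} = S}. c \<alpha>)"
      unfolding sum_distrib_left by (intro sum.cong) auto
    also have "(\<Sum>\<alpha>\<in>{\<alpha> \<in> {..<d} \<rightarrow>\<^sub>E E. \<alpha> ` {..<d} = S}. c \<alpha>) = fact d * complex_of_real (det_weight d E v S)"
      by (simp add: det_weight_def c_def)
    finally show "(\<Sum>\<alpha>\<in>{\<alpha> \<in> {..<d} \<rightarrow>\<^sub>E E. \<alpha> ` {..<d} = S}. (\<Prod>e\<in>\<alpha> ` {..<d}. z e) * c \<alpha>)
        = fact d * (complex_of_real (det_weight d E v S) * (\<Prod>e\<in>S. z e))" by (simp add: mult_ac)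
  qed
  finally have "fact d * ldet {..<d} (\<lambda>i j. \<Sum>e\<in>E. z e * v e i * cnj (v e j))
    = fact d * (\<Sum>S\<in>Pow E. complex_of_real (det_weight d E v S) * (\<Prod>e\<in>S. z e))"
    by (simp add: sum_distrib_left)
  then show ?thesis by simp
qed

text \<open>Pairing a kernel vector \<open>u\<close> with its image gives \<open>\<Sum>\<^sub>e z\<^sub>e \<bar>\<langle>u, v\<^sub>e\<rangle>\<bar>\<^sup>2 = 0\<close>. Imaginary and real
  parts then force \<open>\<langle>u, v\<^sub>e\<rangle> = 0\<close> whenever \<open>z\<^sub>e \<noteq> 0\<close>.\<close>

lemma ldet_weighted_gram_eq_0:
  fixes v :: "'e \<Rightarrow> nat \<Rightarrow> complex"
  assumes "finite E" and zero: "ldet {..<d} (\<lambda>i j. \<Sum>e\<in>E. z e * v e i * cnj (v e j)) = 0"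
    and z: "\<And>e. e \<in> E \<Longrightarrow> 0 \<le> Im (z e)" "\<And>e. e \<in> E \<Longrightarrow> Im (z e) = 0 \<Longrightarrow> 0 \<le> Re (z e)"
    and z': "\<And>e. e \<in> E \<Longrightarrow> z e = 0 \<Longrightarrow> z' e = 0"
  shows "ldet {..<d} (\<lambda>i j. \<Sum>e\<in>E. z' e * v e i * cnj (v e j)) = 0"
proof -
  define A where "A z = Matrix.mat d d (\<lambda>(i, j). \<Sum>e\<in>E. z e * v e i * cnj (v e j))" for z
  have A: "A z \<in> carrier_mat d d" for z by (simp add: A_def)
  have det: "ldet {..<d} (\<lambda>i j. \<Sum>e\<in>E. z e * v e i * cnj (v e j)) = Determinant.det (A z)" for z
    unfolding ldet_eq_det A_def ..
  obtain u where u: "u \<in> carrier_vec d" "u \<noteq> 0\<^sub>v d" "A z *\<^sub>v u = 0\<^sub>v d"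
    using zero det_0_iff_vec_prod_zero[OF A, of z] by (auto simp: det)
  define s where "s e = (\<Sum>j<d. cnj (v e j) * u $ j)" for e
  have Au: "(A z *\<^sub>v u) $ i = (\<Sum>e\<in>E. z e * v e i * s e)" if "i < d" for z i
  proof -
    have "(A z *\<^sub>v u) $ i = (\<Sum>j<d. (\<Sum>e\<in>E. z e * v e i * cnj (v e j)) * u $ j)"
      using u that by (simp add: A_def scalar_prod_def lessThan_atLeast0)
    also have "\<dots> = (\<Sum>e\<in>E. \<Sum>j<d. z e * v e i * (cnj (v e j) * u $ j))"
      by (subst sum.swap) (simp add: sum_distrib_right sum_distrib_left mult_ac)
    finally show ?thesis by (simp add: s_def sum_distrib_left)
  qed
  have "0 = (\<Sum>i<d. cnj (u $ i) * (A z *\<^sub>v u) $ i)"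
    using u by simp
  also have "\<dots> = (\<Sum>i<d. \<Sum>e\<in>E. z e * s e * (v e i * cnj (u $ i)))"
    by (intro sum.cong refl) (simp add: Au sum_distrib_left mult_ac)
  also have "\<dots> = (\<Sum>e\<in>E. z e * s e * cnj (s e))"
    by (subst sum.swap) (simp add: s_def sum_distrib_left[symmetric])
  also have "\<dots> = (\<Sum>e\<in>E. z e * complex_of_real ((cmod (s e))\<^sup>2))"
    by (simp only: complex_norm_square mult.assoc)
  finally have sum0: "(\<Sum>e\<in>E. z e * complex_of_real ((cmod (s e))\<^sup>2)) = 0" by simp
  have "(\<Sum>e\<in>E. Im (z e) * (cmod (s e))\<^sup>2) = 0"
    using arg_cong[OF sum0, of Im] by simp
  then have im: "Im (z e) * (cmod (s e))\<^sup>2 = 0" if "e \<in> E" for e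
    using that assms(1) z by (subst (asm) sum_nonneg_eq_0_iff) auto
  have re_nonneg: "0 \<le> Re (z e) * (cmod (s e))\<^sup>2" if "e \<in> E" for e
    using im[OF that] z[OF that] by auto
  have "(\<Sum>e\<in>E. Re (z e) * (cmod (s e))\<^sup>2) = 0"
    using arg_cong[OF sum0, of Re] by simp
  then have re: "Re (z e) * (cmod (s e))\<^sup>2 = 0" if "e \<in> E" for e
    using that assms(1) re_nonneg by (subst (asm) sum_nonneg_eq_0_iff) auto
  \<comment> \<open>The same kernel vector serves for \<open>z'\<close>: each term dies either
    through \<open>s e = 0\<close> or through \<open>z' e = 0\<close>.\<close>
  have "z' e * v e i * s e = 0" if "e \<in> E" for e i
    using im[OF that] re[OF that] z'[OF that] by (auto simp: complex_eq_iff)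
  then have "(A z' *\<^sub>v u) $ i = 0" if "i < d" for i
    unfolding Au[OF that] by (intro sum.neutral) blast
  then have "A z' *\<^sub>v u = 0\<^sub>v d"
    by (intro eq_vecI) (simp_all add: A_def del: index_mult_mat_vec)
  then show ?thesis
    using u det_0_iff_vec_prod_zero[OF A, of z'] by (auto simp: det)
qed

text \<open>A bilinear polynomial that violates the Rayleigh inequality has a zero with both
  variables in the open upper half-plane: put the first variable equal to \<open>\<i>\<close> and
  solve for the second, whose imaginary part has the sign of \<open>c0 c3 - c1 c2\<close>.\<close>

lemma bilinear_root_upper_half_plane:
  fixes c0 c1 c2 c3 :: real
  assumes "0 \<le> c1 * c2" and "c1 * c2 < c0 * c3"
  shows "\<exists>y::complex. 0 < Im y \<and> c0 + c1 * \<i> + c2 * y + c3 * \<i> * y = 0"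
proof -
  define y where "y = - (c0 + c1 * \<i>) / (c2 + c3 * \<i>)"
  have c3: "c3 \<noteq> 0" using assms by auto
  then have nz: "c2 + c3 * \<i> \<noteq> 0" by (simp add: complex_eq_iff)
  have "(c2 + c3 * \<i>) * y = - (c0 + c1 * \<i>)" using nz by (simp add: y_def)
  then have root: "c0 + c1 * \<i> + c2 * y + c3 * \<i> * y = 0" by (simp add: algebra_simps)
  have "Im y = (c0 * c3 - c1 * c2) / (c2\<^sup>2 + c3\<^sup>2)"
    by (simp add: y_def Im_divide algebra_simps)
  moreover have "0 < c2\<^sup>2 + c3\<^sup>2" using c3 by (simp add: add_nonneg_pos)
  ultimately have "0 < Im y" using assms by simp
  with root show ?thesis by blast
qed

text \<open>With all variables except those of \<open>a\<close> and \<open>b\<close> frozen at the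
  nonnegative values \<open>t\<close>, the determinant is bilinear with nonnegative coefficients
  \<open>c J\<close>. A violation yields a zero with both free variables in the upper half-plane;
  the zero persists when both are set to 0, so \<open>c {} = 0\<close>, which makes the inequality
  true after all.\<close>

lemma det_weight_rayleigh:
  fixes v :: "'e \<Rightarrow> nat \<Rightarrow> complex" and t :: "'e \<Rightarrow> real" and d :: nat
  assumes "finite E" "a \<in> E" "b \<in> E" "a \<noteq> b" and t: "\<And>e. 0 \<le> t e"
  defines "c \<equiv> \<lambda>J. \<Sum>S\<in>Pow (E - {a, b}). det_weight d E v (J \<union> S) * (\<Prod>e\<in>S. t e)"
  shows "c {a, b} * c {} \<le> c {a} * c {b}"
proof (rule ccontr)
  assume neg: "\<not> ?thesis"
  define D where "D z = ldet {..<d} (\<lambda>i j. \<Sum>e\<in>E. z e * v e i * cnj (v e j))" for z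
  define z where "z x y = (\<lambda>e. complex_of_real (t e))(a := x, b := y)" for x y :: complex
  have fin: "finite (E - {a, b})" using assms by simp
  have E: "E - {a} - {b} = E - {a, b}" "b \<in> E - {a}" using assms by auto
  have expand: "D (z x y) = c {} + c {a} * x + c {b} * y + c {a, b} * x * y" for x y :: complex
  proof -
    let ?w = "\<lambda>S. complex_of_real (det_weight d E v S)"
    have pr: "(\<Prod>e\<in>S. z x y e) = complex_of_real (\<Prod>e\<in>S. t e)"
      "(\<Prod>e\<in>insert a S. z x y e) = x * complex_of_real (\<Prod>e\<in>S. t e)"
      "(\<Prod>e\<in>insert b S. z x y e) = y * complex_of_real (\<Prod>e\<in>S. t e)"
      "(\<Prod>e\<in>insert a (insert b S). z x y e) = x * y * complex_of_real (\<Prod>e\<in>S. t e)"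
      if "S \<in> Pow (E - {a, b})" for S
    proof -
      have S: "finite S" "a \<notin> S" "b \<notin> S" using that fin by (auto intro: finite_subset)
      show *: "(\<Prod>e\<in>S. z x y e) = complex_of_real (\<Prod>e\<in>S. t e)"
        unfolding of_real_prod using S by (intro prod.cong) (auto simp: z_def)
      show "(\<Prod>e\<in>insert a S. z x y e) = x * complex_of_real (\<Prod>e\<in>S. t e)"
        using S assms(4) by (simp add: * del: of_real_prod) (simp add: z_def)
      show "(\<Prod>e\<in>insert b S. z x y e) = y * complex_of_real (\<Prod>e\<in>S. t e)"
        using S assms(4) by (simp add: * del: of_real_prod) (simp add: z_def)
      show "(\<Prod>e\<in>insert a (insert b S). z x y e) = x * y * complex_of_real (\<Prod>e\<in>S. t e)"
        using S assms(4) by (simp add: * del: of_real_prod) (simp add: z_def)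
    qed
    have "D (z x y) = (\<Sum>S\<in>Pow E. ?w S * (\<Prod>e\<in>S. z x y e))"
      unfolding D_def by (rule ldet_weighted_gram[OF assms(1)])
    also have "\<dots> = (\<Sum>S\<in>Pow (E - {a, b}). ?w S * (\<Prod>e\<in>S. z x y e))
        + (\<Sum>S\<in>Pow (E - {a, b}). ?w (insert b S) * (\<Prod>e\<in>insert b S. z x y e))
        + ((\<Sum>S\<in>Pow (E - {a, b}). ?w (insert a S) * (\<Prod>e\<in>insert a S. z x y e))
        + (\<Sum>S\<in>Pow (E - {a, b}). ?w (insert a (insert b S)) * (\<Prod>e\<in>insert a (insert b S). z x y e)))"
      using assms(1) E(2) by (simp only: sum_Pow_remove[OF assms(1,2)] sum_Pow_remove[OF _ E(2)] finite_Diff E(1))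
    also have "\<dots> = c {} + c {b} * y + (c {a} * x + c {a, b} * (x * y))"
      unfolding c_def of_real_sum sum_distrib_right
      by (intro arg_cong2[where f = "(+)"] sum.cong refl) (simp_all add: pr del: of_real_prod)
    finally show ?thesis by simp
  qed
  have c_nonneg: "0 \<le> c J" for J
    unfolding c_def by (intro sum_nonneg mult_nonneg_nonneg prod_nonneg det_weight_nonneg) (auto simp: t)
  have "0 \<le> c {a} * c {b}" "c {a} * c {b} < c {} * c {a, b}"
    using neg c_nonneg by (simp_all add: mult.commute)
  then obtain y :: complex where y: "0 < Im y" "c {} + c {a} * \<i> + c {b} * y + c {a, b} * \<i> * y = 0"
    using bilinear_root_upper_half_plane[of "c {a}" "c {b}" "c {}" "c {a, b}"] by blast
  then have "D (z \<i> y) = 0" by (simp add: expand)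
  \<comment> \<open>At the root the variables of \<open>a\<close> and \<open>b\<close> are nonzero,
    so passing to 0 there keeps the required implication from \<open>z e = 0\<close> to
    \<open>z' e = 0\<close>; the other variables are unchanged.\<close>
  then have "D (z 0 0) = 0"
    unfolding D_def
    by (rule ldet_weighted_gram_eq_0[OF assms(1)]) (use y(1) t assms(4) in \<open>auto simp: z_def split: if_splits\<close>)
  then have "c {} = 0" by (simp add: expand)
  then show False using neg c_nonneg by simp
qed

text \<open>Conditioning as a limit of weights: elements of \<open>I\<close> get the weight
  1/\<epsilon>, elements of \<open>F\<close> the weight 1 and all others 0. After rescaling by
  \<epsilon> to the power \<open>card I\<close>, only the sets containing \<open>I\<close> survive
  as \<epsilon> tends to 0. If \<open>I\<close>, \<open>a\<close> or \<open>b\<close> leaves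
  \<open>E\<close>, the left-hand side is already 0.\<close>

lemma det_weight_minor_rayleigh:
  fixes v :: "'e \<Rightarrow> nat \<Rightarrow> complex" and d :: nat
  assumes "finite E" "finite I" "finite F" "I \<inter> F = {}" "a \<noteq> b" "a \<notin> I \<union> F" "b \<notin> I \<union> F"
  defines "Z \<equiv> \<lambda>J. minor_sum (det_weight d E v) J F (\<lambda>_. 1)"
  shows "Z (insert a (insert b I)) * Z I \<le> Z (insert a I) * Z (insert b I)"
proof (cases "I \<subseteq> E \<and> a \<in> E \<and> b \<in> E")
  case False
  have zero: "Z J = 0" if "\<not> J \<subseteq> E" for J
    unfolding Z_def minor_sum_def using that by (intro sum.neutral) (auto simp: det_weight_outside)
  have "0 \<le> Z J" for J
    unfolding Z_def minor_sum_def by (intro sum_nonneg) (simp add: det_weight_nonneg)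
  moreover have "Z (insert a (insert b I)) = 0" using False by (intro zero) auto
  ultimately show ?thesis by simp
next
  case True
  let ?w = "det_weight d E v"
  let ?G = "E - {a, b}"
  have finG: "finite ?G" using assms by simp
  \<comment> \<open>The rescaled coefficient. Its exponent \<open>card (I - S)\<close> is never
    negative, so \<epsilon> = 0 is admissible, and there the power is the indicator of
    \<open>I \<subseteq> S\<close>.\<close>
  define P where "P J \<epsilon> = (\<Sum>S\<in>Pow ?G. ?w (J \<union> S) * (of_bool (S \<subseteq> I \<union> F) * \<epsilon> ^ card (I - S)))" for J and \<epsilon> :: real
  have le: "P {a, b} \<epsilon> * P {} \<epsilon> \<le> P {a} \<epsilon> * P {b} \<epsilon>" if "0 < \<epsilon>" for \<epsilon>
  proof -
    define t where "t e = (if e \<in> I then inverse \<epsilon> else if e \<in> F then 1 else 0)" for e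
    define c where "c J = (\<Sum>S\<in>Pow ?G. ?w (J \<union> S) * (\<Prod>e\<in>S. t e))" for J
    have prod: "(\<Prod>e\<in>S. t e) = of_bool (S \<subseteq> I \<union> F) * \<epsilon> ^ card (I - S) * inverse \<epsilon> ^ card I"
      if "S \<in> Pow ?G" for S
    proof -
      have S: "finite S" using that finG by (auto intro: finite_subset)
      show ?thesis
      proof (cases "S \<subseteq> I \<union> F")
        case True
        have "(\<Prod>e\<in>S. t e) = (\<Prod>e\<in>S \<inter> I. t e) * (\<Prod>e\<in>S - I. t e)"
          using S by (subst prod.union_disjoint[symmetric]) (auto intro: prod.cong)
        also have "\<dots> = inverse \<epsilon> ^ card (S \<inter> I)"
        proof -
          have "(\<Prod>e\<in>S \<inter> I. t e) = (\<Prod>e\<in>S \<inter> I. inverse \<epsilon>)"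
            by (intro prod.cong) (auto simp: t_def)
          moreover have "(\<Prod>e\<in>S - I. t e) = 1"
            using True by (intro prod.neutral) (auto simp: t_def)
          ultimately show ?thesis by simp
        qed
        also have "card I = card (S \<inter> I) + card (I - S)"
          using assms(2) by (subst card_Un_disjoint[symmetric]) (auto intro: arg_cong[where f = card])
        then have "inverse \<epsilon> ^ card (S \<inter> I) = \<epsilon> ^ card (I - S) * inverse \<epsilon> ^ card I"
          using \<open>0 < \<epsilon>\<close> by (simp add: power_add power_inverse)
        finally show ?thesis using True by simp
      next
        case False
        then show ?thesis using S by (auto simp: t_def intro!: prod_zero)
      qed
    qed
    have "c {a, b} * c {} \<le> c {a} * c {b}"
      unfolding c_def using assms(1,5) True \<open>0 < \<epsilon>\<close> by (intro det_weight_rayleigh) (auto simp: t_def)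
    moreover have "c J = P J \<epsilon> * inverse \<epsilon> ^ card I" for J
      unfolding c_def P_def sum_distrib_right by (intro sum.cong refl) (simp add: prod mult_ac)
    ultimately have "(P {a, b} \<epsilon> * P {} \<epsilon>) * (inverse \<epsilon> ^ card I)\<^sup>2 \<le> (P {a} \<epsilon> * P {b} \<epsilon>) * (inverse \<epsilon> ^ card I)\<^sup>2"
      by (simp add: power2_eq_square mult_ac)
    then show ?thesis using that by (simp add: mult_le_cancel_right)
  qed
  have lim: "(P J \<longlongrightarrow> P J 0) (at_right 0)" for J
    unfolding P_def by (intro tendsto_intros)
  have "P {a, b} 0 * P {} 0 \<le> P {a} 0 * P {b} 0"
    by (rule tendsto_le[OF _ tendsto_mult[OF lim lim] tendsto_mult[OF lim lim]])
      (auto simp: eventually_at_right_less le intro!: eventually_mono[OF eventually_at_right_less])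
  moreover have "P J 0 = Z (J \<union> I)" for J
  proof -
    have I0: "(0::real) ^ card (I - S) = of_bool (I \<subseteq> S)" for S
      using assms(2) by (auto simp: of_bool_def power_0_left)
    have "P J 0 = (\<Sum>S\<in>{S \<in> Pow ?G. S \<subseteq> I \<union> F \<and> I \<subseteq> S}. ?w (J \<union> S))"
      unfolding P_def I0 using finG
      by (intro sum.mono_neutral_cong_right) (auto simp: of_bool_def)
    also have "\<dots> = (\<Sum>T\<in>Pow (F \<inter> ?G). ?w (J \<union> I \<union> T))"
      by (rule sum.reindex_bij_witness[where i = "\<lambda>T. I \<union> T" and j = "\<lambda>S. S - I"])
        (use assms True in \<open>auto simp: Un_Diff_cancel intro!: arg_cong[where f = ?w]\<close>)
    also have "\<dots> = (\<Sum>T\<in>Pow F. ?w (J \<union> I \<union> T))"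
    proof (rule sum.mono_neutral_left)
      show "\<forall>T\<in>Pow F - Pow (F \<inter> ?G). ?w (J \<union> I \<union> T) = 0"
      proof
        fix T assume "T \<in> Pow F - Pow (F \<inter> ?G)"
        then have "\<not> J \<union> I \<union> T \<subseteq> E" using assms(6,7) by blast
        then show "?w (J \<union> I \<union> T) = 0" by (rule det_weight_outside)
      qed
    qed (use assms in auto)
    finally show ?thesis by (simp add: Z_def minor_sum_def)
  qed
  ultimately show ?thesis by simp
qed

text \<open>Put the variable of \<open>e\<close> equal to 1 + s and all others equal to 1. The frame
  condition turns the determinant into det(I + s B) with \<open>B\<close> the rank one matrix of
  \<open>v e\<close>. Its linear coefficient in s is the trace of \<open>B\<close>, while on the
  side of the weights it is the probability of \<open>e\<close>.\<close>

lemma det_weight_mean: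
  fixes v :: "'e \<Rightarrow> nat \<Rightarrow> complex"
  assumes "finite E" "e \<in> E"
    and frame: "\<And>i j. i < d \<Longrightarrow> j < d \<Longrightarrow> (\<Sum>e\<in>E. v e i * cnj (v e j)) = (if i = j then 1 else 0)"
  shows "(\<Sum>S | S \<subseteq> E \<and> e \<in> S. det_weight d E v S) = (\<Sum>i<d. (cmod (v e i))\<^sup>2)"
proof -
  define B where "B i j = v e i * cnj (v e j)" for i j
  define p where "p = (\<Sum>S | S \<subseteq> E \<and> e \<in> S. det_weight d E v S)"
  define r where "r = (\<Sum>S | S \<subseteq> E \<and> e \<notin> S. det_weight d E v S)"
  have "(\<Sum>S\<in>Pow {..<d}. s ^ card S * ldet S B) = of_real r + (1 + s) * of_real p" for s :: complex
  proof -
    let ?z = "(\<lambda>_. 1)(e := 1 + s)"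
    have "(\<Sum>f\<in>E. ?z f * v f i * cnj (v f j)) = (if i = j then 1 else 0) + s * B i j" if "i < d" "j < d" for i j
    proof -
      have "(\<Sum>f\<in>E. ?z f * v f i * cnj (v f j)) = (\<Sum>f\<in>E. v f i * cnj (v f j) + (if f = e then s * B i j else 0))"
        by (intro sum.cong) (auto simp: B_def algebra_simps)
      then show ?thesis using assms(1,2) frame[OF that] by (simp add: sum.distrib)
    qed
    then have "ldet {..<d} (\<lambda>i j. \<Sum>f\<in>E. ?z f * v f i * cnj (v f j))
        = ldet {..<d} (\<lambda>i j. (if i = j then 1 else 0) + s * B i j)"
      by (intro ldet_cong) auto
    also have "\<dots> = (\<Sum>S\<in>Pow {..<d}. ldet S (\<lambda>i j. s * B i j))"
      by (rule ldet_add_identity) simp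
    also have "\<dots> = (\<Sum>S\<in>Pow {..<d}. s ^ card S * ldet S B)"
      by (intro sum.cong refl) (simp add: ldet_def prod.distrib sum_distrib_left mult_ac)
    finally have L: "(\<Sum>S\<in>Pow {..<d}. s ^ card S * ldet S B)
        = (\<Sum>S\<in>Pow E. complex_of_real (det_weight d E v S) * (\<Prod>f\<in>S. ?z f))"
      by (simp add: ldet_weighted_gram[OF assms(1)])
    have prod: "(\<Prod>f\<in>S. ?z f) = (if e \<in> S then 1 + s else 1)" if "S \<in> Pow E" for S
    proof -
      have "finite S" using that assms(1) by (auto intro: finite_subset)
      then show ?thesis using prod.delta[of S e "\<lambda>_. 1 + s"] by (simp add: fun_upd_def)
    qed
    have Pow: "Pow E = {S. S \<subseteq> E \<and> e \<notin> S} \<union> {S. S \<subseteq> E \<and> e \<in> S}" by auto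
    have "(\<Sum>S\<in>Pow E. complex_of_real (det_weight d E v S) * (\<Prod>f\<in>S. ?z f))
        = (\<Sum>S\<in>Pow E. complex_of_real (det_weight d E v S) * (if e \<in> S then 1 + s else 1))"
      by (intro sum.cong refl) (simp only: prod)
    also have "\<dots> = of_real r + (1 + s) * of_real p"
      unfolding Pow using assms(1)
      by (subst sum.union_disjoint) (auto simp: r_def p_def sum_distrib_left mult_ac)
    finally show ?thesis using L by simp
  qed note poly = this
  have Pow: "Pow {..<d} = insert {} (Pow {..<d} - {{}})" by auto
  have split: "(\<Sum>S\<in>Pow {..<d}. s ^ card S * ldet S B)
      = 1 + s * (\<Sum>S\<in>Pow {..<d} - {{}}. s ^ (card S - 1) * ldet S B)" for s
  proof -
    have "s ^ card S = s * s ^ (card S - 1)" if "S \<in> Pow {..<d} - {{}}" for S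
    proof -
      have "finite S" using that by (auto intro: finite_subset)
      then have "card S \<noteq> 0" using that by auto
      then show ?thesis by (cases "card S") auto
    qed
    then have "(\<Sum>S\<in>Pow {..<d} - {{}}. s ^ card S * ldet S B)
        = s * (\<Sum>S\<in>Pow {..<d} - {{}}. s ^ (card S - 1) * ldet S B)"
      unfolding sum_distrib_left by (intro sum.cong) (auto simp: mult_ac)
    then show ?thesis by (subst Pow, subst sum.insert) (auto simp: ldet_def)
  qed
  have "of_real r = 1 - complex_of_real p" using poly[of 0] split[of 0] by (simp add: algebra_simps)
  then have "1 + s * (\<Sum>S\<in>Pow {..<d} - {{}}. s ^ (card S - 1) * ldet S B) = 1 + s * of_real p" for s
    using poly[of s] unfolding split[of s] by (simp add: algebra_simps)
  then have eq': "s * (\<Sum>S\<in>Pow {..<d} - {{}}. s ^ (card S - 1) * ldet S B) = s * of_real p" for s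
    using add_left_cancel by blast
  then have eq: "(\<Sum>S\<in>Pow {..<d} - {{}}. s ^ (card S - 1) * ldet S B) = of_real p" if "s \<noteq> 0" for s
    using eq'[of s] mult_left_cancel[OF that] by blast
  \<comment> \<open>The quotient by s is known only for s \<noteq> 0. Continuity gives its value at
    0, where the exponent \<open>card S - 1\<close> leaves the singletons alone.\<close>
  have "((\<lambda>s. \<Sum>S\<in>Pow {..<d} - {{}}. s ^ (card S - 1) * ldet S B) \<longlongrightarrow>
      (\<Sum>S\<in>Pow {..<d} - {{}}. 0 ^ (card S - 1) * ldet S B)) (at 0)"
    by (intro tendsto_intros)
  moreover have "((\<lambda>s. \<Sum>S\<in>Pow {..<d} - {{}}. s ^ (card S - 1) * ldet S B) \<longlongrightarrow> of_real p) (at 0)"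
    by (rule tendsto_eventually, unfold eventually_at_filter) (intro always_eventually allI impI eq)
  ultimately have "complex_of_real p = (\<Sum>S\<in>Pow {..<d} - {{}}. 0 ^ (card S - 1) * ldet S B)"
    by (rule tendsto_unique[OF at_neq_bot, rotated 1])
  also have "\<dots> = (\<Sum>S\<in>(\<lambda>i. {i}) ` {..<d}. ldet S B)"
  proof (rule sum.mono_neutral_cong_right)
    show "\<forall>S\<in>Pow {..<d} - {{}} - (\<lambda>i. {i}) ` {..<d}. 0 ^ (card S - 1) * ldet S B = 0"
    proof
      fix S assume S: "S \<in> Pow {..<d} - {{}} - (\<lambda>i. {i}) ` {..<d}"
      then have "finite S" by (auto intro: finite_subset)
      then have "card S \<noteq> 0" "card S \<noteq> 1" using S by (auto simp: card_1_singleton_iff)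
      then show "0 ^ (card S - 1) * ldet S B = 0" by simp
    qed
  qed auto
  also have "\<dots> = (\<Sum>i<d. B i i)"
    by (subst sum.reindex) (auto simp: ldet_def)
  also have "\<dots> = of_real (\<Sum>i<d. (cmod (v e i))\<^sup>2)"
    by (simp only: B_def of_real_sum complex_norm_square)
  finally show ?thesis unfolding p_def of_real_eq_iff .
qed

section \<open>Comparison with Poisson variables\<close>

definition poisson0_pmf :: "real \<Rightarrow> nat pmf" where
  "poisson0_pmf p = (if p = 0 then return_pmf 0 else poisson_pmf p)"

lemma pmf_poisson0: "0 \<le> p \<Longrightarrow> pmf (poisson0_pmf p) k = p ^ k / fact k * exp (- p)"
  by (auto simp: poisson0_pmf_def indicator_def power_0_left)

lemma poisson0_pmf_add:
  assumes "0 \<le> p" "0 \<le> q"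
  shows "poisson0_pmf (p + q) = poisson0_pmf p \<bind> (\<lambda>a. map_pmf (\<lambda>b. b + a) (poisson0_pmf q))"
proof (rule pmf_eqI)
  fix k
  have shift: "pmf (map_pmf (\<lambda>b. b + a) (poisson0_pmf q)) k = (if a \<le> k then pmf (poisson0_pmf q) (k - a) else 0)" for a
  proof (cases "a \<le> k")
    case True
    then have "pmf (map_pmf (\<lambda>b. b + a) (poisson0_pmf q)) (k - a + a) = pmf (poisson0_pmf q) (k - a)"
      by (intro pmf_map_inj') (auto simp: inj_def)
    then show ?thesis using True by simp
  next
    case False
    then have "k \<notin> set_pmf (map_pmf (\<lambda>b. b + a) (poisson0_pmf q))" by auto
    then show ?thesis using False by (simp add: pmf_eq_0_set_pmf)
  qed
  have "pmf (poisson0_pmf p \<bind> (\<lambda>a. map_pmf (\<lambda>b. b + a) (poisson0_pmf q))) k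
      = (\<Sum>a\<le>k. pmf (map_pmf (\<lambda>b. b + a) (poisson0_pmf q)) k * pmf (poisson0_pmf p) a)"
    unfolding pmf_bind by (rule integral_measure_pmf_real) (auto simp: shift split: if_splits)
  also have "\<dots> = (\<Sum>a\<le>k. real (k choose a) * p ^ a * q ^ (k - a)) / fact k * exp (- (p + q))"
    unfolding sum_divide_distrib sum_distrib_right
  proof (rule sum.cong[OF refl])
    fix a assume "a \<in> {..k}"
    then show "pmf (map_pmf (\<lambda>b. b + a) (poisson0_pmf q)) k * pmf (poisson0_pmf p) a
        = real (k choose a) * p ^ a * q ^ (k - a) / fact k * exp (- (p + q))"
      using assms by (simp add: shift pmf_poisson0 binomial_fact exp_diff exp_minus field_simps exp_add)
  qed
  also have "\<dots> = pmf (poisson0_pmf (p + q)) k"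
    using assms by (simp add: pmf_poisson0 binomial_ring)
  finally show "pmf (poisson0_pmf (p + q)) k = pmf (poisson0_pmf p \<bind> (\<lambda>a. map_pmf (\<lambda>b. b + a) (poisson0_pmf q))) k" ..
qed

lemma nn_integral_poisson0_mean:
  assumes "0 \<le> p"
  shows "(\<integral>\<^sup>+k. ennreal (real k) \<partial>measure_pmf (poisson0_pmf p)) = ennreal p"
proof -
  have "(\<lambda>k. p * exp (- p) * (p ^ k /\<^sub>R fact k)) sums (p * exp (- p) * exp p)"
    by (intro sums_mult exp_converges)
  then have "(\<lambda>k. real (Suc k) * pmf (poisson0_pmf p) (Suc k)) sums p"
    using assms by (simp add: pmf_poisson0 exp_minus field_simps del: of_nat_Suc)
  then have "(\<lambda>k. real k * pmf (poisson0_pmf p) k) sums p"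
    by (subst (asm) sums_Suc_iff) simp
  then have "(\<Sum>k. ennreal (real k * pmf (poisson0_pmf p) k)) = ennreal p"
    by (intro suminf_ennreal_eq) auto
  then show ?thesis
    by (simp add: nn_integral_measure_pmf nn_integral_count_space_nat ennreal_mult'' mult.commute)
qed

text \<open>Integration of an affine minorant, whose value at the Poisson mean is the left-hand
  side. The extended integral is used because the mean of \<open>G\<close> may be infinite.\<close>

lemma nn_integral_poisson0_tangent:
  assumes "0 \<le> p" "0 \<le> a" "0 \<le> b" and "\<And>k. a + real k * b \<le> G k"
  shows "ennreal (a + p * b) \<le> (\<integral>\<^sup>+k. ennreal (G k) \<partial>measure_pmf (poisson0_pmf p))"
proof -
  have "ennreal (a + p * b) = ennreal a + ennreal p * ennreal b"
    using assms by (simp add: ennreal_plus ennreal_mult)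
  also have "\<dots> = (\<integral>\<^sup>+k. ennreal a + ennreal (real k) * ennreal b \<partial>measure_pmf (poisson0_pmf p))"
    by (subst nn_integral_add) (auto simp: nn_integral_multc nn_integral_poisson0_mean assms measure_pmf.emeasure_space_1)
  also have "\<dots> \<le> (\<integral>\<^sup>+k. ennreal (G k) \<partial>measure_pmf (poisson0_pmf p))"
    using assms by (intro nn_integral_mono) (simp flip: ennreal_plus ennreal_mult add: ennreal_leI)
  finally show ?thesis .
qed

section \<open>Unit steps and increasing directionally convex functions on the lattice\<close>

definition incr :: "'i \<Rightarrow> nat \<Rightarrow> ('i \<Rightarrow> nat) \<Rightarrow> 'i \<Rightarrow> nat" where
  "incr i k x = x(i := x i + k)"

lemma incr_commute: "incr i k (incr j l x) = incr j l (incr i k x)"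
  by (auto simp: incr_def fun_eq_iff)

lemma incr_incr [simp]: "incr i k (incr i l x) = incr i (k + l) x"
  by (auto simp: incr_def fun_eq_iff)

lemma incr_0 [simp]: "incr i 0 x = x"
  by (simp add: incr_def)

lemma incr_mono_le:
  fixes g :: "('i \<Rightarrow> nat) \<Rightarrow> 'c::order"
  assumes step: "\<And>i x. g x \<le> g (incr i 1 x)"
    and "finite A" and "\<And>i. x i \<le> y i" and "\<And>i. i \<notin> A \<Longrightarrow> x i = y i"
  shows "g x \<le> g y"
  using assms(3,4)
proof (induction "\<Sum>i\<in>A. y i - x i" arbitrary: x)
  case 0
  then have "x = y" using \<open>finite A\<close> by (metis antisym diff_is_0_eq ext sum_eq_0_iff)
  then show ?case by simp
next
  case (Suc n)
  then have "(\<Sum>i\<in>A. y i - x i) \<noteq> 0" by simp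
  then obtain i where i: "i \<in> A" "x i < y i" by (meson diff_is_0_eq' not_le_imp_less sum.neutral)
  have "(\<Sum>i\<in>A. y i - x i) = (y i - x i) + (\<Sum>i\<in>A - {i}. y i - x i)"
    using \<open>finite A\<close> i by (simp add: sum.remove)
  moreover have "(\<Sum>j\<in>A. y j - incr i 1 x j) = (y i - incr i 1 x i) + (\<Sum>j\<in>A - {i}. y j - incr i 1 x j)"
    using \<open>finite A\<close> i by (simp add: sum.remove)
  moreover have "(\<Sum>j\<in>A - {i}. y j - incr i 1 x j) = (\<Sum>i\<in>A - {i}. y i - x i)"
    by (intro sum.cong) (auto simp: incr_def)
  ultimately have "n = (\<Sum>j\<in>A. y j - incr i 1 x j)"
    using i Suc(2) by (simp add: incr_def)
  then have "g (incr i 1 x) \<le> g y"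
    using Suc(3,4) i by (intro Suc(1)) (auto simp: incr_def Suc_le_eq)
  then show ?case using step[of x i] by simp
qed

text \<open>The last clause is convexity in a coordinate for \<open>i = j\<close> and
  supermodularity for \<open>i \<noteq> j\<close>: directional convexity with unit steps.
  Nonnegativity is included so that expectations can be taken in the extended sense.\<close>

definition incr_dcx :: "(('i \<Rightarrow> nat) \<Rightarrow> real) \<Rightarrow> bool" where
  "incr_dcx F \<longleftrightarrow> (\<forall>x. 0 \<le> F x) \<and> (\<forall>i x. F x \<le> F (incr i 1 x))
     \<and> (\<forall>i j x. F (incr i 1 x) + F (incr j 1 x) \<le> F (incr i 1 (incr j 1 x)) + F x)"

lemma incr_dcx_shift: "incr_dcx F \<Longrightarrow> incr_dcx (\<lambda>x. F (incr i k x))"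
  unfolding incr_dcx_def by (simp add: incr_commute[of i])

lemma incr_dcx_tangent:
  assumes "incr_dcx F"
  shows "F x + real k * (F (incr i 1 x) - F x) \<le> F (incr i k x)"
proof (induction k)
  case (Suc k)
  have D: "F (incr i 1 (incr i k x)) - F (incr i k x) \<ge> F (incr i 1 x) - F x"
  proof (induction k)
    case (Suc k)
    have "F (incr i 1 (incr i k x)) + F (incr i 1 (incr i k x)) \<le> F (incr i 1 (incr i 1 (incr i k x))) + F (incr i k x)"
      using assms unfolding incr_dcx_def by blast
    then show ?case using Suc by simp
  qed simp
  then show ?case using Suc by (simp add: algebra_simps)
qed simp

definition class_count :: "('e \<Rightarrow> 'i) \<Rightarrow> 'e set \<Rightarrow> 'i \<Rightarrow> nat" where
  "class_count g S i = card {e \<in> S. g e = i}"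

lemma class_count_insert:
  assumes "finite S" "e \<notin> S"
  shows "class_count g (insert e S) = incr (g e) 1 (class_count g S)"
proof
  fix i
  have "{f \<in> insert e S. g f = i} = (if g e = i then insert e {f \<in> S. g f = i} else {f \<in> S. g f = i})" by auto
  then show "class_count g (insert e S) i = incr (g e) 1 (class_count g S) i"
    using assms by (auto simp: class_count_def incr_def)
qed

lemma class_count_mono_le:
  fixes h :: "('i \<Rightarrow> nat) \<Rightarrow> 'c::order"
  assumes "\<And>i x. h x \<le> h (incr i 1 x)" "S \<subseteq> T" "finite T"
  shows "h (class_count g S) \<le> h (class_count g T)"
proof (rule incr_mono_le[where g = h and A = "g ` T"])
  show "class_count g S i \<le> class_count g T i" for i
    unfolding class_count_def using assms by (intro card_mono) auto
  show "class_count g S i = class_count g T i" if "i \<notin> g ` T" for i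
    unfolding class_count_def using assms that by (intro arg_cong[where f = card]) auto
qed (use assms in auto)

text \<open>Superposition in one coordinate: raising the rate at \<open>i\<close> by
  \<open>p\<close> amounts to adding an independent Poisson increment there.\<close>

lemma Pi_pmf_poisson0_add:
  fixes \<mu> :: "'i \<Rightarrow> real"
  assumes "finite A" "i \<in> A" "\<And>j. 0 \<le> \<mu> j" "0 \<le> p"
  shows "Pi_pmf A 0 (\<lambda>j. poisson0_pmf ((\<mu>(i := \<mu> i + p)) j))
    = poisson0_pmf p \<bind> (\<lambda>k. map_pmf (incr i k) (Pi_pmf A 0 (\<lambda>j. poisson0_pmf (\<mu> j))))"
proof -
  define B where "B = A - {i}"
  have A: "A = insert i B" "finite B" "i \<notin> B" using assms by (auto simp: B_def)
  have "Pi_pmf B 0 (\<lambda>j. poisson0_pmf ((\<mu>(i := \<mu> i + p)) j)) = Pi_pmf B 0 (\<lambda>j. poisson0_pmf (\<mu> j))"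
    using A by (intro Pi_pmf_cong) auto
  moreover have "poisson0_pmf (\<mu> i + p) = poisson0_pmf p \<bind> (\<lambda>a. map_pmf (\<lambda>b. b + a) (poisson0_pmf (\<mu> i)))"
    using poisson0_pmf_add[of p "\<mu> i"] assms by (simp add: add.commute)
  ultimately show ?thesis
    unfolding A(1) using A(2,3)
    by (simp add: Pi_pmf_insert' map_bind_pmf bind_assoc_pmf bind_map_pmf map_pmf_def[symmetric] incr_def
        bind_return_pmf)
       (simp add: map_pmf_def bind_assoc_pmf bind_return_pmf incr_def)
qed

text \<open>A coupling: the rates are raised one coordinate at a time by adding an independent
  Poisson increment, which can only increase \<open>F\<close>.\<close>

lemma nn_integral_Pi_pmf_poisson0_mono:
  fixes F :: "('i \<Rightarrow> nat) \<Rightarrow> ennreal" and \<mu> \<mu>' :: "'i \<Rightarrow> real"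
  assumes "finite A" and F: "\<And>i x. F x \<le> F (incr i 1 x)" and \<mu>: "\<And>i. 0 \<le> \<mu> i" "\<And>i. \<mu> i \<le> \<mu>' i"
  shows "(\<integral>\<^sup>+x. F x \<partial>Pi_pmf A 0 (\<lambda>i. poisson0_pmf (\<mu> i))) \<le> (\<integral>\<^sup>+x. F x \<partial>Pi_pmf A 0 (\<lambda>i. poisson0_pmf (\<mu>' i)))"
proof -
  have F': "F x \<le> F (incr i k x)" for i k x
  proof (induction k)
    case (Suc k)
    then show ?case using F[of "incr i k x" i] by simp
  qed simp
  have "(\<integral>\<^sup>+x. F x \<partial>Pi_pmf A 0 (\<lambda>i. poisson0_pmf (\<mu> i)))
      \<le> (\<integral>\<^sup>+x. F x \<partial>Pi_pmf A 0 (\<lambda>i. poisson0_pmf (if i \<in> B then \<mu>' i else \<mu> i)))" if "finite B" "B \<subseteq> A" for B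
    using that
  proof (induction B rule: finite_induct)
    case (insert b B)
    let ?\<nu> = "\<lambda>i. if i \<in> B then \<mu>' i else \<mu> i"
    have \<nu>: "(\<lambda>i. if i \<in> insert b B then \<mu>' i else \<mu> i) = ?\<nu>(b := ?\<nu> b + (\<mu>' b - \<mu> b))"
      using insert by auto
    have "0 \<le> ?\<nu> i" for i using \<mu>[of i] by auto
    then have eq: "Pi_pmf A 0 (\<lambda>i. poisson0_pmf (if i \<in> insert b B then \<mu>' i else \<mu> i))
        = poisson0_pmf (\<mu>' b - \<mu> b) \<bind> (\<lambda>k. map_pmf (incr b k) (Pi_pmf A 0 (\<lambda>i. poisson0_pmf (?\<nu> i))))"
      using Pi_pmf_poisson0_add[OF assms(1), of b ?\<nu> "\<mu>' b - \<mu> b"] insert \<mu>[of b]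
      unfolding \<nu>[symmetric] by auto
    have "(\<integral>\<^sup>+x. F x \<partial>Pi_pmf A 0 (\<lambda>i. poisson0_pmf (\<mu> i))) \<le> (\<integral>\<^sup>+x. F x \<partial>Pi_pmf A 0 (\<lambda>i. poisson0_pmf (?\<nu> i)))"
      using insert by auto
    also have "\<dots> = (\<integral>\<^sup>+k. \<integral>\<^sup>+x. F x \<partial>Pi_pmf A 0 (\<lambda>i. poisson0_pmf (?\<nu> i)) \<partial>poisson0_pmf (\<mu>' b - \<mu> b))"
      by (simp add: measure_pmf.emeasure_space_1)
    also have "\<dots> \<le> (\<integral>\<^sup>+x. F x \<partial>Pi_pmf A 0 (\<lambda>i. poisson0_pmf (if i \<in> insert b B then \<mu>' i else \<mu> i)))"
      unfolding eq nn_integral_bind_pmf nn_integral_map_pmf by (intro nn_integral_mono F')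
    finally show ?case .
  qed simp
  from this[OF assms(1) order.refl]
  show ?thesis
    using assms(1) by (simp add: Pi_pmf_cong[of A A 0 0 "\<lambda>i. poisson0_pmf (if i \<in> A then \<mu>' i else \<mu> i)" "\<lambda>i. poisson0_pmf (\<mu>' i)"])
qed

text \<open>Replace the Bernoulli variables \<open>1\<^bsub>e\<in>S\<^esub>\<close> one at a time by independent Poisson variables
  of the same mean: negative association handles the dependence, and a convex function on the naturals
  lies above its chord through \<open>0\<close> and \<open>1\<close>.\<close>

lemma bernoulli_to_poisson_step:
  fixes w :: "'e set \<Rightarrow> real" and g :: "'e \<Rightarrow> 'i"
  assumes "finite E" "e \<in> E" "e \<notin> T" "incr_dcx H" "0 \<le> p" and w: "\<And>S. 0 \<le> w S"
    and na: "\<And>h. (\<And>S T. S \<subseteq> T \<Longrightarrow> T \<subseteq> E \<Longrightarrow> h S \<le> h T) \<Longrightarrow>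
        (\<Sum>S\<in>Pow E. of_bool (e \<in> S) * (w S * h (S - {e}))) \<le> p * (\<Sum>S\<in>Pow E. w S * h (S - {e}))"
  shows "ennreal (\<Sum>S\<in>Pow E. w S * H (class_count g (S - T)))
    \<le> (\<integral>\<^sup>+k. ennreal (\<Sum>S\<in>Pow E. w S * H (incr (g e) k (class_count g (S - insert e T)))) \<partial>measure_pmf (poisson0_pmf p))"
proof -
  define D where "D x = H (incr (g e) 1 x) - H x" for x
  define R where "R S = class_count g (S - insert e T)" for S
  have D_nonneg: "0 \<le> D x" for x using assms(4) by (simp add: D_def incr_dcx_def)
  \<comment> \<open>Directional convexity makes the gain from one more point in the class of
    \<open>e\<close> an increasing function of the other counts; this is the function to which
    negative association is applied.\<close>
  have D_mono: "D x \<le> D (incr i 1 x)" for i x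
  proof -
    have "H (incr (g e) 1 x) + H (incr i 1 x) \<le> H (incr (g e) 1 (incr i 1 x)) + H x"
      using assms(4) unfolding incr_dcx_def by blast
    then show ?thesis by (simp add: D_def)
  qed
  have eq: "H (class_count g (S - T)) = H (R S) + of_bool (e \<in> S) * D (R S)" if "S \<in> Pow E" for S
  proof (cases "e \<in> S")
    case True
    then have "S - T = insert e (S - insert e T)" using assms(3) by auto
    moreover have "class_count g (insert e (S - insert e T)) = incr (g e) 1 (R S)"
      unfolding R_def using that assms(1) by (intro class_count_insert) (auto intro: finite_subset)
    ultimately show ?thesis using True by (simp add: D_def)
  next
    case False
    then have "S - T = S - insert e T" by auto
    then show ?thesis using False by (simp add: R_def)
  qed
  have "(\<Sum>S\<in>Pow E. of_bool (e \<in> S) * (w S * D (class_count g (S - {e} - T))))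
      \<le> p * (\<Sum>S\<in>Pow E. w S * D (class_count g (S - {e} - T)))"
    by (rule na, rule class_count_mono_le[OF D_mono]) (use assms(1) in \<open>auto intro: finite_subset\<close>)
  moreover have "S - {e} - T = S - insert e T" for S by auto
  ultimately have na': "(\<Sum>S\<in>Pow E. of_bool (e \<in> S) * (w S * D (R S))) \<le> p * (\<Sum>S\<in>Pow E. w S * D (R S))"
    by (simp add: R_def)
  have "(\<Sum>S\<in>Pow E. w S * H (class_count g (S - T)))
      = (\<Sum>S\<in>Pow E. w S * H (R S)) + (\<Sum>S\<in>Pow E. of_bool (e \<in> S) * (w S * D (R S)))"
    unfolding sum.distrib[symmetric] by (intro sum.cong refl) (simp add: eq algebra_simps)
  also have "\<dots> \<le> (\<Sum>S\<in>Pow E. w S * H (R S)) + p * (\<Sum>S\<in>Pow E. w S * D (R S))"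
    using na' by simp
  finally have "ennreal (\<Sum>S\<in>Pow E. w S * H (class_count g (S - T)))
      \<le> ennreal ((\<Sum>S\<in>Pow E. w S * H (R S)) + p * (\<Sum>S\<in>Pow E. w S * D (R S)))"
    by (rule ennreal_leI)
  also have "\<dots> \<le> (\<integral>\<^sup>+k. ennreal (\<Sum>S\<in>Pow E. w S * H (incr (g e) k (R S))) \<partial>measure_pmf (poisson0_pmf p))"
  proof (rule nn_integral_poisson0_tangent)
    show "0 \<le> (\<Sum>S\<in>Pow E. w S * H (R S))"
      using assms(4) w by (intro sum_nonneg mult_nonneg_nonneg) (auto simp: incr_dcx_def)
    show "0 \<le> (\<Sum>S\<in>Pow E. w S * D (R S))"
      using w D_nonneg by (intro sum_nonneg mult_nonneg_nonneg) auto
    fix k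
    have "w S * H (R S) + real k * (w S * D (R S)) \<le> w S * H (incr (g e) k (R S))" for S
      using mult_left_mono[OF incr_dcx_tangent[OF assms(4), of "R S" k "g e"] w[of S]]
      by (simp add: D_def algebra_simps)
    then show "(\<Sum>S\<in>Pow E. w S * H (R S)) + real k * (\<Sum>S\<in>Pow E. w S * D (R S))
        \<le> (\<Sum>S\<in>Pow E. w S * H (incr (g e) k (R S)))"
      unfolding sum_distrib_left sum.distrib[symmetric] by (intro sum_mono)
  qed (fact assms)
  finally show ?thesis by (simp add: R_def)
qed

lemma negatively_associated_dcx_poisson:
  fixes w :: "'e set \<Rightarrow> real" and g :: "'e \<Rightarrow> 'i" and p :: "'e \<Rightarrow> real"
  assumes "finite E" "finite A" "g ` E \<subseteq> A" "incr_dcx H"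
    and p: "\<And>e. 0 \<le> p e" and w: "\<And>S. 0 \<le> w S" "(\<Sum>S\<in>Pow E. w S) = 1"
    and na: "\<And>e h. e \<in> E \<Longrightarrow> (\<And>S T. S \<subseteq> T \<Longrightarrow> T \<subseteq> E \<Longrightarrow> h S \<le> h T) \<Longrightarrow>
        (\<Sum>S\<in>Pow E. of_bool (e \<in> S) * (w S * h (S - {e}))) \<le> p e * (\<Sum>S\<in>Pow E. w S * h (S - {e}))"
  shows "ennreal (\<Sum>S\<in>Pow E. w S * H (class_count g S))
    \<le> (\<integral>\<^sup>+x. ennreal (H x) \<partial>Pi_pmf A 0 (\<lambda>i. poisson0_pmf (\<Sum>e | e \<in> E \<and> g e = i. p e)))"
proof -
  \<comment> \<open>\<open>T\<close> holds the elements already removed and \<open>B\<close> those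
    still to be replaced. \<open>T\<close> and \<open>H\<close> vary in the induction, because after
    one replacement the element moves to \<open>T\<close> and the drawn Poisson value is absorbed
    into \<open>H\<close> as a shift.\<close>
  have step: "ennreal (\<Sum>S\<in>Pow E. w S * H (class_count g (S - T)))
    \<le> (\<integral>\<^sup>+x. ennreal (\<Sum>S\<in>Pow E. w S * H (\<lambda>i. class_count g (S - (T \<union> B)) i + x i))
          \<partial>Pi_pmf A 0 (\<lambda>i. poisson0_pmf (\<Sum>e | e \<in> B \<and> g e = i. p e)))"
    if "finite B" "B \<subseteq> E" "T \<inter> B = {}" "incr_dcx H" for B T H
    using that
  proof (induction B arbitrary: T H rule: finite_induct)
    case empty
    have "Pi_pmf A 0 (\<lambda>_. return_pmf (0::nat)) = return_pmf (\<lambda>_. 0)"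
      using assms(2) by (simp add: Pi_pmf_return_pmf)
    then show ?case by (simp add: poisson0_pmf_def)
  next
    case (insert e B)
    define \<mu> where "\<mu> i = (\<Sum>f | f \<in> B \<and> g f = i. p f)" for i
    have \<mu>: "(\<lambda>i. \<Sum>f | f \<in> insert e B \<and> g f = i. p f) = \<mu>(g e := \<mu> (g e) + p e)"
    proof
      fix i
      have "{f. f \<in> insert e B \<and> g f = i} = (if g e = i then insert e {f. f \<in> B \<and> g f = i} else {f. f \<in> B \<and> g f = i})"
        by auto
      then show "(\<Sum>f | f \<in> insert e B \<and> g f = i. p f) = (\<mu>(g e := \<mu> (g e) + p e)) i"
        using insert by (auto simp: \<mu>_def)
    qed
    have "0 \<le> \<mu> i" for i unfolding \<mu>_def using p by (intro sum_nonneg) auto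
    then have Pi: "Pi_pmf A 0 (\<lambda>i. poisson0_pmf (\<Sum>f | f \<in> insert e B \<and> g f = i. p f))
        = poisson0_pmf (p e) \<bind> (\<lambda>k. map_pmf (incr (g e) k) (Pi_pmf A 0 (\<lambda>i. poisson0_pmf (\<mu> i))))"
      using Pi_pmf_poisson0_add[OF assms(2), of "g e" \<mu> "p e"] insert.prems(1) assms(3) p
        arg_cong[OF \<mu>, of "\<lambda>\<nu>. Pi_pmf A 0 (\<lambda>i. poisson0_pmf (\<nu> i))"] by fastforce
    have shift: "incr (g e) k (\<lambda>i. c i + x i) = (\<lambda>i. c i + incr (g e) k x i)" for k c x
      by (auto simp: incr_def fun_eq_iff)
    have "ennreal (\<Sum>S\<in>Pow E. w S * H (class_count g (S - T)))
        \<le> (\<integral>\<^sup>+k. ennreal (\<Sum>S\<in>Pow E. w S * H (incr (g e) k (class_count g (S - insert e T)))) \<partial>measure_pmf (poisson0_pmf (p e)))"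
      using insert assms p w by (intro bernoulli_to_poisson_step) auto
    also have "\<dots> \<le> (\<integral>\<^sup>+k. \<integral>\<^sup>+x. ennreal (\<Sum>S\<in>Pow E. w S * H (incr (g e) k (\<lambda>i. class_count g (S - (insert e T \<union> B)) i + x i)))
          \<partial>Pi_pmf A 0 (\<lambda>i. poisson0_pmf (\<mu> i)) \<partial>measure_pmf (poisson0_pmf (p e)))"
      unfolding \<mu>_def using insert incr_dcx_shift
      by (intro nn_integral_mono insert.IH) auto
    also have "\<dots> = (\<integral>\<^sup>+x. ennreal (\<Sum>S\<in>Pow E. w S * H (\<lambda>i. class_count g (S - (T \<union> insert e B)) i + x i))
          \<partial>Pi_pmf A 0 (\<lambda>i. poisson0_pmf (\<Sum>f | f \<in> insert e B \<and> g f = i. p f)))"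
      unfolding Pi nn_integral_bind_pmf nn_integral_map_pmf by (simp add: shift)
    finally show ?case .
  qed
  have "(\<Sum>S\<in>Pow E. w S * H (\<lambda>i. class_count g (S - ({} \<union> E)) i + x i)) = H x" for x
  proof -
    have "(\<Sum>S\<in>Pow E. w S * H (\<lambda>i. class_count g (S - ({} \<union> E)) i + x i)) = (\<Sum>S\<in>Pow E. w S * H x)"
    proof (rule sum.cong[OF refl])
      fix S assume "S \<in> Pow E"
      then have "{e \<in> S - ({} \<union> E). g e = i} = {}" for i by auto
      then have "class_count g (S - ({} \<union> E)) i = 0" for i by (simp only: class_count_def card.empty)
      then show "w S * H (\<lambda>i. class_count g (S - ({} \<union> E)) i + x i) = w S * H x" by simp
    qed
    then show ?thesis using w by (simp add: sum_distrib_right[symmetric])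
  qed
  with step[OF assms(1), of "{}" H] assms(4) show ?thesis by simp
qed

section \<open>Positive semidefinite partitions of unity\<close>

text \<open>Only the leading \<open>d\<close> by \<open>d\<close> block of an infinite array is
  concerned, so that all truncations of a Gram matrix are handled without changing the
  array.\<close>

definition psd :: "nat \<Rightarrow> (nat \<Rightarrow> nat \<Rightarrow> complex) \<Rightarrow> bool" where
  "psd d A \<longleftrightarrow> (\<forall>i<d. \<forall>j<d. A j i = cnj (A i j))
     \<and> (\<forall>c. 0 \<le> Re (\<Sum>i<d. \<Sum>j<d. c i * A i j * cnj (c j)))"

text \<open>Elimination of the last row and column by the Schur complement \<open>A'\<close>.
  Minimizing the form over the last coordinate shows that \<open>A'\<close> is again positive
  semidefinite; the eliminated column supplies the last vector. If the pivot is 0, the whole column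
  is 0 and, division by 0 being 0, \<open>A'\<close> agrees with \<open>A\<close>.\<close>

lemma psd_factorization:
  assumes "psd d A"
  shows "\<exists>v. \<forall>i<d. \<forall>j<d. A i j = (\<Sum>a<d. v a i * cnj (v a j))"
  using assms
proof (induction d arbitrary: A)
  case (Suc d)
  have herm: "A j i = cnj (A i j)" if "i \<le> d" "j \<le> d" for i j
    using Suc.prems that unfolding psd_def less_Suc_eq_le by blast
  define Q where "Q c = (\<Sum>i<d. \<Sum>j<d. c i * A i j * cnj (c j))" for c
  define \<sigma> where "\<sigma> c = (\<Sum>i<d. c i * A i d)" for c
  have Q: "0 \<le> Re (Q c + \<sigma> c * cnj x + x * cnj (\<sigma> c) + x * A d d * cnj x)" for c x
  proof -
    let ?c = "c(d := x)"
    have "(\<Sum>i<Suc d. \<Sum>j<Suc d. ?c i * A i j * cnj (?c j))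
        = (\<Sum>i<d. (\<Sum>j<d. c i * A i j * cnj (c j)) + c i * A i d * cnj x)
          + ((\<Sum>j<d. x * A d j * cnj (c j)) + x * A d d * cnj x)"
      by simp
    also have "(\<Sum>j<d. x * A d j * cnj (c j)) = x * cnj (\<sigma> c)"
      unfolding \<sigma>_def cnj_sum sum_distrib_left
      by (intro sum.cong refl) (simp add: herm[of _ d] mult_ac)
    finally have "(\<Sum>i<Suc d. \<Sum>j<Suc d. ?c i * A i j * cnj (?c j))
        = Q c + \<sigma> c * cnj x + x * cnj (\<sigma> c) + x * A d d * cnj x"
      by (simp add: Q_def \<sigma>_def sum.distrib sum_distrib_right add.assoc)
    moreover have "0 \<le> Re (\<Sum>i<Suc d. \<Sum>j<Suc d. ?c i * A i j * cnj (?c j))"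
      using Suc.prems unfolding psd_def by blast
    ultimately show ?thesis by (simp only:)
  qed
  define \<alpha> where "\<alpha> = Re (A d d)"
  have \<alpha>: "A d d = complex_of_real \<alpha>"
    using arg_cong[OF herm[of d d], of Im] by (intro complex_eqI) (simp_all add: \<alpha>_def)
  have "0 \<le> \<alpha>" using Q[of "\<lambda>_. 0" 1] by (simp add: Q_def \<sigma>_def \<alpha>)
  define A' where "A' i j = A i j - A i d * cnj (A j d) / \<alpha>" for i j
  \<comment> \<open>The test vector has \<open>- \<epsilon> cnj (A i d)\<close> at \<open>i\<close>
    and 1 at \<open>d\<close>. Its form is quadratic in \<epsilon> without constant term and has
    slope \<open>- 2 \<gamma>\<close> at 0, so it becomes negative: at 1 if
    \<open>\<beta> \<le> 0\<close>, and at \<open>1 / \<beta>\<close> otherwise.\<close>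
  have col0: "A i d = 0" if "\<alpha> = 0" "i < d" for i
  proof (rule ccontr)
    assume nz: "A i d \<noteq> 0"
    define \<beta> where "\<beta> = Re (A i i)"
    have \<beta>: "A i i = complex_of_real \<beta>"
      using arg_cong[OF herm[of i i], of Im] that by (intro complex_eqI) (simp_all add: \<beta>_def)
    define \<gamma> where "\<gamma> = (cmod (A i d))\<^sup>2"
    have \<gamma>: "A i d * cnj (A i d) = complex_of_real \<gamma>" unfolding \<gamma>_def by (rule complex_norm_square[symmetric])
    have "0 < \<gamma>" using nz by (simp add: \<gamma>_def)
    have form: "0 \<le> \<epsilon>\<^sup>2 * \<gamma> * \<beta> - 2 * \<epsilon> * \<gamma>" for \<epsilon> :: real
    proof -
      let ?c = "(\<lambda>_. 0)(i := - complex_of_real \<epsilon> * cnj (A i d))"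
      have if_c: "?c k = (if k = i then - complex_of_real \<epsilon> * cnj (A i d) else 0)" for k by simp
      have "\<sigma> ?c = - (complex_of_real \<epsilon> * (A i d * cnj (A i d)))"
        using that unfolding \<sigma>_def if_c by (simp add: if_distrib[of "\<lambda>x. x * _"] cong: if_cong)
      moreover have "Q ?c = (complex_of_real \<epsilon>)\<^sup>2 * (A i d * cnj (A i d)) * A i i"
        using that unfolding Q_def if_c
        by (simp add: if_distrib[of "\<lambda>x. x * _"] if_distrib[of "\<lambda>x. _ * x"] if_distrib[of cnj] power2_eq_square sum_negf cong: if_cong)
      ultimately have "\<sigma> ?c = complex_of_real (- (\<epsilon> * \<gamma>))" "Q ?c = complex_of_real (\<epsilon>\<^sup>2 * \<gamma> * \<beta>)"
        unfolding \<gamma> \<beta> by simp_all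
      then show ?thesis using Q[of ?c 1] \<open>\<alpha> = 0\<close> by (simp only: \<alpha>) simp
    qed
    show False
    proof (cases "\<beta> \<le> 0")
      case True
      then have "\<gamma> * \<beta> \<le> 0" using \<open>0 < \<gamma>\<close> by (simp add: mult_le_0_iff)
      moreover have "0 \<le> \<gamma> * \<beta> - 2 * \<gamma>"
        using form[of 1] by (simp only: power_one mult_1_left mult_1_right)
      ultimately show False using \<open>0 < \<gamma>\<close> by linarith
    next
      case False
      then have "(1 / \<beta>)\<^sup>2 * \<gamma> * \<beta> = \<gamma> / \<beta>" by (simp add: power2_eq_square)
      then show False using form[of "1 / \<beta>"] \<open>0 < \<gamma>\<close> False by (simp add: field_simps)
    qed
  qed
  have "psd d A'"
  proof -
    have "0 \<le> Re (\<Sum>i<d. \<Sum>j<d. c i * A' i j * cnj (c j))" for c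
    proof -
      have "(\<Sum>i<d. \<Sum>j<d. c i * A' i j * cnj (c j)) = Q c - \<sigma> c * cnj (\<sigma> c) / \<alpha>"
        unfolding A'_def Q_def \<sigma>_def cnj_sum sum_product sum_divide_distrib sum_subtractf[symmetric]
        by (intro sum.cong refl) (simp add: algebra_simps)
      \<comment> \<open>Completing the square. For \<alpha> = 0 the chosen \<open>x\<close> is 0 and
        the subtracted quotient is 0 as well.\<close>
      moreover have "Q c + \<sigma> c * cnj x + x * cnj (\<sigma> c) + x * A d d * cnj x = Q c - \<sigma> c * cnj (\<sigma> c) / \<alpha>"
        if "x = - \<sigma> c / \<alpha>" for x
        unfolding that by (cases "\<alpha> = 0") (simp_all add: \<alpha> field_simps)
      ultimately show ?thesis using Q by metis
    qed
    moreover have "A' j i = cnj (A' i j)" if "i < d" "j < d" for i j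
      using that herm[of i j] by (simp add: A'_def mult.commute)
    ultimately show ?thesis unfolding psd_def by blast
  qed
  then obtain v where v: "\<And>i j. i < d \<Longrightarrow> j < d \<Longrightarrow> A' i j = (\<Sum>a<d. v a i * cnj (v a j))"
    using Suc.IH by blast
  \<comment> \<open>The old vectors are extended by 0 in coordinate \<open>d\<close>; the new one is
    the last column divided by the root of the pivot.\<close>
  define u where "u a i = (if a < d then (if i < d then v a i else 0) else A i d / complex_of_real (sqrt \<alpha>))" for a i
  have sq: "complex_of_real (sqrt \<alpha>) * complex_of_real (sqrt \<alpha>) = \<alpha>"
    using \<open>0 \<le> \<alpha>\<close> by (simp flip: of_real_mult)
  have "A i j = (\<Sum>a<Suc d. u a i * cnj (u a j))" if "i < Suc d" "j < Suc d" for i j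
  proof -
    have last: "u d i * cnj (u d j) = A i d * cnj (A j d) / \<alpha>"
      by (simp add: u_def sq)
    show ?thesis
    proof (cases "i < d \<and> j < d")
      case True
      then have "A' i j = (\<Sum>a<d. u a i * cnj (u a j))" using v by (simp add: u_def)
      then show ?thesis using last by (simp add: A'_def algebra_simps)
    next
      case False
      then have "(\<Sum>a<d. u a i * cnj (u a j)) = 0" by (intro sum.neutral) (auto simp: u_def)
      moreover have "A i j = A i d * cnj (A j d) / \<alpha>"
      proof (cases "\<alpha> = 0")
        case True
        have *: "A k d = 0" if "k < Suc d" for k
          using that col0[OF True, of k] True \<alpha> by (cases "k = d") auto
        have "A d j = 0" using herm[of j d] *[of j] that by simp
        moreover have "i = d \<or> j = d" using False that by auto
        ultimately show ?thesis using *[of i] *[of j] that by auto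
      next
        case False': False
        have "A d j = cnj (A j d)" using herm[of j d] that by simp
        moreover have "i = d \<or> j = d" using False that by auto
        ultimately show ?thesis using False' by (auto simp: \<alpha>)
      qed
      ultimately show ?thesis using last by simp
    qed
  qed
  then show ?case by blast
qed simp

text \<open>The Feder--Mihail inequality compares \<open>e\<close> present with \<open>e\<close>
  absent. Adding \<open>H1 Z1\<close> to both sides, with total mass \<open>Z0 + Z1 = 1\<close>,
  compares \<open>e\<close> present with no condition at all.\<close>

lemma det_weight_negative_association:
  fixes v :: "'e \<Rightarrow> nat \<Rightarrow> complex"
  assumes "finite E" "e \<in> E" and total: "(\<Sum>S\<in>Pow E. det_weight d E v S) = 1"
    and mono: "\<And>S T. S \<subseteq> T \<Longrightarrow> T \<subseteq> E \<Longrightarrow> h S \<le> h T"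
  shows "(\<Sum>S\<in>Pow E. of_bool (e \<in> S) * (det_weight d E v S * h (S - {e})))
    \<le> (\<Sum>S | S \<subseteq> E \<and> e \<in> S. det_weight d E v S) * (\<Sum>S\<in>Pow E. det_weight d E v S * h (S - {e}))"
proof -
  let ?w = "det_weight d E v" and ?F = "E - {e}"
  define Z0 Z1 H0 H1 where "Z0 = minor_sum ?w {} ?F (\<lambda>_. 1)" "Z1 = minor_sum ?w {e} ?F (\<lambda>_. 1)"
    "H0 = minor_sum ?w {} ?F h" "H1 = minor_sum ?w {e} ?F h"
  note defs = this
  have Z: "Z0 + Z1 = 1"
    using total unfolding defs minor_sum_def by (simp add: sum_Pow_remove[OF assms(1,2)])
  have H1: "(\<Sum>S\<in>Pow E. of_bool (e \<in> S) * (?w S * h (S - {e}))) = H1"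
    unfolding sum_Pow_remove[OF assms(1,2)] defs minor_sum_def
  proof (subst sum.neutral)
    have "insert e S - {e} = S" if "S \<in> Pow ?F" for S using that by auto
    then show "0 + (\<Sum>S\<in>Pow ?F. of_bool (e \<in> insert e S) * (?w (insert e S) * h (insert e S - {e})))
        = (\<Sum>S\<in>Pow ?F. ?w ({e} \<union> S) * h S)"
      by (auto intro!: sum.cong)
  qed auto
  have H: "(\<Sum>S\<in>Pow E. ?w S * h (S - {e})) = H0 + H1"
    unfolding sum_Pow_remove[OF assms(1,2)] defs minor_sum_def
  proof (intro arg_cong2[where f = "(+)"] sum.cong refl)
    fix S assume "S \<in> Pow ?F"
    then have "S - {e} = S" "insert e S - {e} = S" by auto
    then show "?w S * h (S - {e}) = ?w ({} \<union> S) * h S"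
      "?w (insert e S) * h (insert e S - {e}) = ?w ({e} \<union> S) * h S" by simp_all
  qed
  have "(\<Sum>S | S \<subseteq> E \<and> e \<in> S. ?w S) = (\<Sum>S\<in>Pow E. of_bool (e \<in> S) * ?w S)"
    using assms(1) by (intro sum.mono_neutral_cong_left) auto
  also have "\<dots> = Z1"
    unfolding sum_Pow_remove[OF assms(1,2)] defs minor_sum_def
    by (subst sum.neutral) auto
  finally have Z1: "(\<Sum>S | S \<subseteq> E \<and> e \<in> S. ?w S) = Z1" .
  have "H1 * Z0 \<le> H0 * Z1"
    unfolding defs
    by (rule negative_association_singleton[where d = d])
      (use assms in \<open>auto intro!: det_weight_nonneg det_weight_homogeneous det_weight_minor_rayleigh mono
        dest: det_weight_homogeneous\<close>)
  then have "H1 * (Z0 + Z1) \<le> Z1 * (H0 + H1)" by (simp add: algebra_simps)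
  then show ?thesis by (simp add: Z H1 H Z1)
qed

text \<open>Each matrix is split into \<open>d\<close> rank one terms, and \<open>E\<close> consists
  of the pairs of a class and a term, so \<open>fst\<close> is the class of an element. The
  partition of unity makes all the vectors together a tight frame: the weights have total det(I) =
  1, and the probability of an element is the squared length of its vector. Added over a class,
  these probabilities give the trace of its matrix.\<close>

theorem psd_partition_of_unity_dcx:
  fixes A :: "nat \<Rightarrow> nat \<Rightarrow> nat \<Rightarrow> complex"
  assumes psd: "\<And>b. b \<le> m \<Longrightarrow> psd d (A b)"
    and unity: "\<And>i j. i < d \<Longrightarrow> j < d \<Longrightarrow> (\<Sum>b\<le>m. A b i j) = (if i = j then 1 else 0)"
  obtains E :: "(nat \<times> nat) set" and w where "finite E" "\<And>S. 0 \<le> w S" "(\<Sum>S\<in>Pow E. w S) = 1"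
    "\<And>z. ldet {..<d} (\<lambda>i j. \<Sum>b\<le>m. z b * A b i j)
        = (\<Sum>S\<in>Pow E. complex_of_real (w S) * (\<Prod>b\<le>m. z b ^ class_count fst S b))"
    "\<And>H. incr_dcx H \<Longrightarrow> ennreal (\<Sum>S\<in>Pow E. w S * H (class_count fst S))
        \<le> (\<integral>\<^sup>+x. ennreal (H x) \<partial>Pi_pmf {..m} 0 (\<lambda>b. poisson0_pmf (\<Sum>i<d. Re (A b i i))))"
proof -
  have "\<forall>b\<in>{..m}. \<exists>v. \<forall>i<d. \<forall>j<d. A b i j = (\<Sum>a<d. v a i * cnj (v a j))"
    using psd_factorization psd by auto
  then obtain V where V: "\<And>b i j. b \<le> m \<Longrightarrow> i < d \<Longrightarrow> j < d \<Longrightarrow> A b i j = (\<Sum>a<d. V b a i * cnj (V b a j))"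
    unfolding bchoice_iff by auto
  define E where "E = {..m} \<times> {..<d}"
  define v where "v = (\<lambda>(b, a). V b a)"
  define w where "w = det_weight d E v"
  have fin: "finite E" by (simp add: E_def)
  have gram: "(\<Sum>e\<in>E. z (fst e) * v e i * cnj (v e j)) = (\<Sum>b\<le>m. z b * A b i j)" if "i < d" "j < d" for z i j
    unfolding E_def sum.cartesian_product[symmetric, of "\<lambda>b a. z (fst (b, a)) * v (b, a) i * cnj (v (b, a) j)", simplified split_def prod.collapse]
    using that by (simp add: V v_def sum_distrib_left mult.assoc)
  have poly: "ldet {..<d} (\<lambda>i j. \<Sum>b\<le>m. z b * A b i j)
        = (\<Sum>S\<in>Pow E. complex_of_real (w S) * (\<Prod>b\<le>m. z b ^ class_count fst S b))" for z
  proof -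
    have "ldet {..<d} (\<lambda>i j. \<Sum>b\<le>m. z b * A b i j) = ldet {..<d} (\<lambda>i j. \<Sum>e\<in>E. z (fst e) * v e i * cnj (v e j))"
      by (intro ldet_cong) (simp add: gram)
    also have "\<dots> = (\<Sum>S\<in>Pow E. complex_of_real (w S) * (\<Prod>e\<in>S. z (fst e)))"
      unfolding w_def by (rule ldet_weighted_gram[OF fin])
    also have "\<dots> = (\<Sum>S\<in>Pow E. complex_of_real (w S) * (\<Prod>b\<le>m. z b ^ class_count fst S b))"
    proof (intro sum.cong refl arg_cong2[where f = times])
      fix S assume S: "S \<in> Pow E"
      then have "(\<Prod>e\<in>S. z (fst e)) = (\<Prod>b\<le>m. \<Prod>e\<in>{e \<in> S. fst e = b}. z (fst e))"
        using fin by (intro prod.group[symmetric]) (auto simp: E_def intro: finite_subset)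
      then show "(\<Prod>e\<in>S. z (fst e)) = (\<Prod>b\<le>m. z b ^ class_count fst S b)"
        by (simp add: class_count_def)
    qed
    finally show ?thesis .
  qed
  have frame: "(\<Sum>e\<in>E. v e i * cnj (v e j)) = (if i = j then 1 else 0)" if "i < d" "j < d" for i j
    using gram[OF that, of "\<lambda>_. 1"] unity[OF that] by simp
  have "complex_of_real (\<Sum>S\<in>Pow E. w S) = ldet {..<d} (\<lambda>i j. \<Sum>b\<le>m. A b i j)"
    using poly[of "\<lambda>_. 1"] by simp
  also have "\<dots> = ldet {..<d} (\<lambda>i j. if i = j then 1 else 0)"
    by (intro ldet_cong) (simp add: unity)
  also have "\<dots> = (\<Sum>S\<in>Pow {..<d}. ldet S (\<lambda>i j. 0))"
    using ldet_add_identity[of "{..<d}" "\<lambda>i j. 0"] by simp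
  also have "\<dots> = (\<Sum>S\<in>{{}::nat set}. 1)"
  proof (rule sum.mono_neutral_cong_right)
    show "\<forall>S\<in>Pow {..<d} - {{}}. ldet S (\<lambda>i j. 0) = (0::complex)"
      by (auto simp: ldet_def power_0_left dest: finite_subset)
  qed (auto simp: ldet_def)
  finally have "complex_of_real (\<Sum>S\<in>Pow E. w S) = complex_of_real 1" by simp
  then have total: "(\<Sum>S\<in>Pow E. w S) = 1" unfolding of_real_eq_iff .
  have dcx: "ennreal (\<Sum>S\<in>Pow E. w S * H (class_count fst S))
        \<le> (\<integral>\<^sup>+x. ennreal (H x) \<partial>Pi_pmf {..m} 0 (\<lambda>b. poisson0_pmf (\<Sum>i<d. Re (A b i i))))"
    if H: "incr_dcx H" for H
  proof -
    define p where "p e = (\<Sum>i<d. (cmod (v e i))\<^sup>2)" for e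
    have mean: "(\<Sum>e | e \<in> E \<and> fst e = b. p e) = (\<Sum>i<d. Re (A b i i))" if "b \<le> m" for b
    proof -
      have "{e. e \<in> E \<and> fst e = b} = Pair b ` {..<d}" using that by (auto simp: E_def)
      then have "(\<Sum>e | e \<in> E \<and> fst e = b. p e) = (\<Sum>a<d. \<Sum>i<d. (cmod (V b a i))\<^sup>2)"
        by (simp add: sum.reindex inj_on_def p_def v_def)
      also have "\<dots> = (\<Sum>i<d. \<Sum>a<d. Re (V b a i * cnj (V b a i)))"
        unfolding cmod_power2 by (subst sum.swap) (simp add: power2_eq_square)
      also have "\<dots> = (\<Sum>i<d. Re (A b i i))"
        using that by (simp add: V)
      finally show ?thesis .
    qed
    have "ennreal (\<Sum>S\<in>Pow E. w S * H (class_count fst S))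
      \<le> (\<integral>\<^sup>+x. ennreal (H x) \<partial>Pi_pmf {..m} 0 (\<lambda>b. poisson0_pmf (\<Sum>e | e \<in> E \<and> fst e = b. p e)))"
    proof (rule negatively_associated_dcx_poisson[OF fin])
      fix e :: "nat \<times> nat" and h :: "(nat \<times> nat) set \<Rightarrow> real"
      assume e: "e \<in> E" and h: "\<And>S T. S \<subseteq> T \<Longrightarrow> T \<subseteq> E \<Longrightarrow> h S \<le> h T"
      have "p e = (\<Sum>S | S \<subseteq> E \<and> e \<in> S. w S)"
        unfolding p_def w_def using det_weight_mean[OF fin e, of d v] frame by simp
      then show "(\<Sum>S\<in>Pow E. of_bool (e \<in> S) * (w S * h (S - {e}))) \<le> p e * (\<Sum>S\<in>Pow E. w S * h (S - {e}))"
        using det_weight_negative_association[OF fin e, of d v h] total h by (simp add: w_def)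
    qed (use H total in \<open>auto simp: E_def p_def w_def intro!: det_weight_nonneg sum_nonneg\<close>)
    also have "Pi_pmf {..m} 0 (\<lambda>b. poisson0_pmf (\<Sum>e | e \<in> E \<and> fst e = b. p e))
        = Pi_pmf {..m} 0 (\<lambda>b. poisson0_pmf (\<Sum>i<d. Re (A b i i)))"
      by (intro Pi_pmf_cong) (auto simp: mean)
    finally show ?thesis .
  qed
  show thesis
    by (rule that[OF fin _ total poly dcx]) (auto simp: w_def det_weight_nonneg)
qed

section \<open>Factorial moments and generating functions\<close>

text \<open>Every subset with \<open>n\<close> elements is the image of exactly n! injective maps
  from \<open>{..<n}\<close>.\<close>

lemma sum_inj_PiE_image:
  fixes G :: "'e set \<Rightarrow> 'c::semiring_char_0"
  assumes "finite A"
  shows "(\<Sum>x\<in>{x \<in> {..<n} \<rightarrow>\<^sub>E A. inj_on x {..<n}}. G (x ` {..<n})) = fact n * (\<Sum>R | R \<subseteq> A \<and> card R = n. G R)"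
proof -
  let ?I = "{x \<in> {..<n} \<rightarrow>\<^sub>E A. inj_on x {..<n}}" and ?R = "{R. R \<subseteq> A \<and> card R = n}"
  have fin: "finite ?I" using finite_PiE[of "{..<n}" "\<lambda>_. A"] assms by auto
  have finR: "finite ?R" by (rule finite_subset[of _ "Pow A"]) (use assms in auto)
  have card: "card {x \<in> ?I. x ` {..<n} = R} = fact n" if "R \<in> ?R" for R
  proof -
    have R: "finite R" "card R = n" "R \<subseteq> A" using that assms by (auto intro: finite_subset)
    have "{x \<in> ?I. x ` {..<n} = R} = {x \<in> {..<n} \<rightarrow>\<^sub>E R. inj_on x {..<n}}"
    proof (intro equalityI subsetI)
      fix x assume "x \<in> {x \<in> {..<n} \<rightarrow>\<^sub>E R. inj_on x {..<n}}"
      then have x: "x \<in> {..<n} \<rightarrow>\<^sub>E R" "inj_on x {..<n}" by auto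
      then have "x ` {..<n} = R"
        using R card_image[of x "{..<n}"] PiE_mem[OF x(1)] by (intro card_subset_eq) auto
      moreover have "x \<in> {..<n} \<rightarrow>\<^sub>E A" using x(1) R(3) PiE_mono[of "{..<n}" "\<lambda>_. R" "\<lambda>_. A"] by auto
      ultimately show "x \<in> {x \<in> ?I. x ` {..<n} = R}" using x by auto
    next
      fix x assume x: "x \<in> {x \<in> ?I. x ` {..<n} = R}"
      then have "x \<in> {..<n} \<rightarrow>\<^sub>E R" by (intro PiE_I) (auto dest: PiE_arb)
      then show "x \<in> {x \<in> {..<n} \<rightarrow>\<^sub>E R. inj_on x {..<n}}" using x by auto
    qed
    then have "card {x \<in> ?I. x ` {..<n} = R} = prod ((-) n) {0..<n}"
      using R card_inj_on_subset_funcset[of "{..<n}" R "{..<n}"] by simp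
    also have "\<dots> = fact n"
      by (simp add: fact_prod_rev)
    finally show ?thesis .
  qed
  have "(\<Sum>x\<in>?I. G (x ` {..<n})) = (\<Sum>R\<in>?R. \<Sum>x\<in>{x \<in> ?I. x ` {..<n} = R}. G (x ` {..<n}))"
  proof (rule sum.group[symmetric, OF fin finR], rule image_subsetI)
    fix x assume x: "x \<in> ?I"
    then have "x ` {..<n} \<subseteq> A" using PiE_mem[of x "{..<n}" "\<lambda>_. A"] by auto
    then show "x ` {..<n} \<in> ?R" using x by (simp add: card_image)
  qed
  also have "\<dots> = (\<Sum>R\<in>?R. fact n * G R)"
  proof (rule sum.cong[OF refl])
    fix R assume "R \<in> ?R"
    then show "(\<Sum>x\<in>{x \<in> ?I. x ` {..<n} = R}. G (x ` {..<n})) = fact n * G R"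
      using card[of R] by simp
  qed
  finally show ?thesis by (simp add: sum_distrib_left)
qed

lemma sum_Pow_card:
  fixes G :: "'e set \<Rightarrow> 'c::comm_monoid_add"
  assumes "finite A"
  shows "(\<Sum>R\<in>Pow A. G R) = (\<Sum>n\<le>card A. \<Sum>R | R \<subseteq> A \<and> card R = n. G R)"
proof -
  have "(\<Sum>R\<in>Pow A. G R) = (\<Sum>n\<le>card A. \<Sum>R\<in>{R \<in> Pow A. card R = n}. G R)"
    using assms by (intro sum.group[symmetric]) (auto intro: card_mono)
  moreover have "{R \<in> Pow A. card R = n} = {R. R \<subseteq> A \<and> card R = n}" for n by auto
  ultimately show ?thesis by (simp only:)
qed

text \<open>The Fredholm series of a finite matrix. The terms beyond \<open>N\<close> vanish, but
  the infinite form has the same shape for every \<open>N\<close>, as is needed for a limit taken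
  term by term. The sum may run over all maps \<open>k\<close>, since a repeated index gives equal
  rows.\<close>

lemma ldet_add_identity_series:
  fixes T :: "nat \<Rightarrow> nat \<Rightarrow> complex"
  shows "(\<lambda>n. (\<Sum>k\<in>{..<n} \<rightarrow>\<^sub>E {..<N}. ldet {..<n} (\<lambda>i j. T (k i) (k j))) / fact n)
    sums ldet {..<N} (\<lambda>i j. (if i = j then 1 else 0) + T i j)"
proof -
  have coeff: "(\<Sum>k\<in>{..<n} \<rightarrow>\<^sub>E {..<N}. ldet {..<n} (\<lambda>i j. T (k i) (k j))) / fact n
      = (\<Sum>R | R \<subseteq> {..<N} \<and> card R = n. ldet R T)" for n
  proof -
    have "(\<Sum>k\<in>{..<n} \<rightarrow>\<^sub>E {..<N}. ldet {..<n} (\<lambda>i j. T (k i) (k j)))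
        = (\<Sum>k\<in>{k \<in> {..<n} \<rightarrow>\<^sub>E {..<N}. inj_on k {..<n}}. ldet (k ` {..<n}) T)"
    proof (rule sum.mono_neutral_cong_right)
      show "\<forall>k\<in>({..<n} \<rightarrow>\<^sub>E {..<N}) - {k \<in> {..<n} \<rightarrow>\<^sub>E {..<N}. inj_on k {..<n}}.
          ldet {..<n} (\<lambda>i j. T (k i) (k j)) = 0"
      proof
        fix k assume "k \<in> ({..<n} \<rightarrow>\<^sub>E {..<N}) - {k \<in> {..<n} \<rightarrow>\<^sub>E {..<N}. inj_on k {..<n}}"
        then obtain i j where "i < n" "j < n" "i \<noteq> j" "k i = k j" by (auto simp: inj_on_def)
        then show "ldet {..<n} (\<lambda>i j. T (k i) (k j)) = 0"
          by (intro ldet_identical_rows[of i n j]) auto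
      qed
    qed (auto simp: ldet_reindex intro: finite_PiE)
    also have "\<dots> = fact n * (\<Sum>R | R \<subseteq> {..<N} \<and> card R = n. ldet R T)"
      by (rule sum_inj_PiE_image) simp
    finally show ?thesis by simp
  qed
  have eq: "ldet {..<N} (\<lambda>i j. (if i = j then 1 else 0) + T i j)
      = (\<Sum>n\<le>N. \<Sum>R | R \<subseteq> {..<N} \<and> card R = n. ldet R T)"
    by (simp add: ldet_add_identity sum_Pow_card)
  have zero: "(\<Sum>R | R \<subseteq> {..<N} \<and> card R = n. ldet R T) = 0" if "n \<notin> {..N}" for n
  proof -
    have "{R. R \<subseteq> {..<N} \<and> card R = n} = {}"
      using that card_mono[of "{..<N}"] by fastforce
    then show ?thesis by (simp only: sum.empty)
  qed
  show ?thesis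
    unfolding coeff eq by (rule sums_finite[OF _ zero]) simp
qed

text \<open>The number of \<open>n\<close>-tuples of distinct points whose \<open>j\<close>-th point has class \<open>c j\<close>,
  when there are \<open>k i\<close> points of class \<open>i\<close>.\<close>

definition tuple_count :: "nat \<Rightarrow> (nat \<Rightarrow> nat) \<Rightarrow> (nat \<Rightarrow> nat) \<Rightarrow> nat" where
  "tuple_count n c k = card {x \<in> \<Pi>\<^sub>E j\<in>{..<n}. {c j} \<times> {..<k (c j)}. inj_on x {..<n}}"

text \<open>The points of each class are numbered from 0. The class is kept as a tag, so points of
  different classes stay distinct after numbering; conversely, disjointness lets a point determine
  its class.\<close>

lemma card_inj_PiE_eq_tuple_count:
  fixes S :: "nat \<Rightarrow> 'a set"
  assumes disj: "disjoint_family_on S {..<m}" and fin: "\<And>i. i < m \<Longrightarrow> finite (S i)"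
    and c: "c \<in> {..<n} \<rightarrow> {..<m}"
  shows "card {x \<in> \<Pi>\<^sub>E j\<in>{..<n}. S (c j). inj_on x {..<n}} = tuple_count n c (\<lambda>i. card (S i))"
proof -
  have "\<forall>i\<in>{..<m}. \<exists>f. bij_betw f (S i) {..<card (S i)}"
    using ex_bij_betw_finite_nat[OF fin] by (simp add: lessThan_atLeast0)
  then obtain f where f: "\<And>i. i < m \<Longrightarrow> bij_betw (f i) (S i) {..<card (S i)}"
    unfolding bchoice_iff by auto
  have cm: "c j < m" if "j < n" for j using c that by auto
  have distinct: "x \<noteq> y" if "x \<in> S i" "y \<in> S i'" "i < m" "i' < m" "i \<noteq> i'" for x y i i'
    using disj that by (auto simp: disjoint_family_on_def)
  define \<phi> where "\<phi> x = (\<lambda>j\<in>{..<n}. (c j, f (c j) (x j)))" for x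
  define \<psi> where "\<psi> y = (\<lambda>j\<in>{..<n}. inv_into (S (c j)) (f (c j)) (snd (y j)))" for y :: "nat \<Rightarrow> nat \<times> nat"
  have inj: "inj_on (f (c j)) (S (c j))" and im: "f (c j) ` S (c j) = {..<card (S (c j))}" if "j < n" for j
    using f[OF cm[OF that]] by (auto simp: bij_betw_def)
  have "bij_betw \<phi> {x \<in> \<Pi>\<^sub>E j\<in>{..<n}. S (c j). inj_on x {..<n}}
      {x \<in> \<Pi>\<^sub>E j\<in>{..<n}. {c j} \<times> {..<card (S (c j))}. inj_on x {..<n}}"
  proof (rule bij_betw_byWitness[where f' = \<psi>])
    show "\<forall>x\<in>{x \<in> \<Pi>\<^sub>E j\<in>{..<n}. S (c j). inj_on x {..<n}}. \<psi> (\<phi> x) = x"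
    proof
      fix x assume x: "x \<in> {x \<in> \<Pi>\<^sub>E j\<in>{..<n}. S (c j). inj_on x {..<n}}"
      show "\<psi> (\<phi> x) = x"
      proof
        fix j
        show "\<psi> (\<phi> x) j = x j"
        proof (cases "j < n")
          case True
          then have "x j \<in> S (c j)" using x PiE_mem[of x "{..<n}" "\<lambda>j. S (c j)" j] by simp
          then show ?thesis using True inj[OF True] by (simp add: \<phi>_def \<psi>_def)
        next
          case False
          then show ?thesis using x PiE_arb[of x "{..<n}" "\<lambda>j. S (c j)" j] by (simp add: \<psi>_def)
        qed
      qed
    qed
    show "\<forall>y\<in>{x \<in> \<Pi>\<^sub>E j\<in>{..<n}. {c j} \<times> {..<card (S (c j))}. inj_on x {..<n}}. \<phi> (\<psi> y) = y"
    proof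
      fix y assume y: "y \<in> {x \<in> \<Pi>\<^sub>E j\<in>{..<n}. {c j} \<times> {..<card (S (c j))}. inj_on x {..<n}}"
      show "\<phi> (\<psi> y) = y"
      proof
        fix j
        show "\<phi> (\<psi> y) j = y j"
        proof (cases "j < n")
          case True
          then have "y j \<in> {c j} \<times> f (c j) ` S (c j)"
            using y im[OF True] PiE_mem[of y "{..<n}" "\<lambda>j. {c j} \<times> {..<card (S (c j))}" j] by simp
          then show ?thesis using True by (cases "y j") (auto simp: \<phi>_def \<psi>_def f_inv_into_f)
        next
          case False
          then show ?thesis using y PiE_arb[of y "{..<n}" "\<lambda>j. {c j} \<times> {..<card (S (c j))}" j] by (simp add: \<phi>_def)
        qed
      qed
    qed
    show "\<phi> ` {x \<in> \<Pi>\<^sub>E j\<in>{..<n}. S (c j). inj_on x {..<n}} \<subseteq> {x \<in> \<Pi>\<^sub>E j\<in>{..<n}. {c j} \<times> {..<card (S (c j))}. inj_on x {..<n}}"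
    proof (rule image_subsetI, rule CollectI, rule conjI)
      fix x assume "x \<in> {x \<in> \<Pi>\<^sub>E j\<in>{..<n}. S (c j). inj_on x {..<n}}"
      then have x: "x \<in> (\<Pi>\<^sub>E j\<in>{..<n}. S (c j))" "inj_on x {..<n}" by simp_all
      show "\<phi> x \<in> (\<Pi>\<^sub>E j\<in>{..<n}. {c j} \<times> {..<card (S (c j))})"
      proof (rule PiE_I)
        fix j assume j: "j \<in> {..<n}"
        then have "f (c j) (x j) \<in> f (c j) ` S (c j)" using PiE_mem[OF x(1) j] by blast
        then show "\<phi> x j \<in> {c j} \<times> {..<card (S (c j))}" using im[of j] j by (simp add: \<phi>_def)
      qed (simp add: \<phi>_def)
      show "inj_on (\<phi> x) {..<n}"
      proof (rule inj_onI)
        fix i j assume ij: "i \<in> {..<n}" "j \<in> {..<n}" "\<phi> x i = \<phi> x j"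
        then have "c i = c j" "f (c i) (x i) = f (c i) (x j)" by (auto simp: \<phi>_def)
        moreover have "x i \<in> S (c i)" "x j \<in> S (c i)" using PiE_mem[OF x(1), of i] PiE_mem[OF x(1), of j] ij \<open>c i = c j\<close> by simp_all
        ultimately have "x i = x j" using inj[of i] ij by (auto dest: inj_onD)
        then show "i = j" using x(2) ij by (auto dest: inj_onD)
      qed
    qed
    show "\<psi> ` {x \<in> \<Pi>\<^sub>E j\<in>{..<n}. {c j} \<times> {..<card (S (c j))}. inj_on x {..<n}} \<subseteq> {x \<in> \<Pi>\<^sub>E j\<in>{..<n}. S (c j). inj_on x {..<n}}"
    proof (rule image_subsetI, rule CollectI, rule conjI)
      fix y assume "y \<in> {x \<in> \<Pi>\<^sub>E j\<in>{..<n}. {c j} \<times> {..<card (S (c j))}. inj_on x {..<n}}"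
      then have y: "y \<in> (\<Pi>\<^sub>E j\<in>{..<n}. {c j} \<times> {..<card (S (c j))})" "inj_on y {..<n}" by simp_all
      have yj: "fst (y j) = c j" "snd (y j) \<in> f (c j) ` S (c j)" if "j < n" for j
        using PiE_mem[OF y(1), of j] im[OF that] that by auto
      have \<psi>S: "\<psi> y j \<in> S (c j)" if "j < n" for j
        using yj(2)[OF that] that by (auto simp: \<psi>_def intro: inv_into_into)
      then show "\<psi> y \<in> (\<Pi>\<^sub>E j\<in>{..<n}. S (c j))" by (auto simp: \<psi>_def)
      show "inj_on (\<psi> y) {..<n}"
      proof (rule inj_onI)
        fix i j assume ij: "i \<in> {..<n}" "j \<in> {..<n}" "\<psi> y i = \<psi> y j"
        then have "c i = c j" using \<psi>S[of i] \<psi>S[of j] distinct cm by fastforce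
        moreover have "snd (y i) = snd (y j)"
          using ij yj(2)[of i] yj(2)[of j] \<open>c i = c j\<close> by (auto simp: \<psi>_def dest: inv_into_injective)
        ultimately have "y i = y j" using yj(1)[of i] yj(1)[of j] ij by (auto simp: prod_eq_iff)
        then show "i = j" using y(2) ij by (auto dest: inj_onD)
      qed
    qed
  qed
  then show ?thesis unfolding tuple_count_def by (rule bij_betw_same_card)
qed

text \<open>With \<open>A\<close> as a model of all the points, the product expands over the subsets
  of \<open>A\<close>. A subset with \<open>n\<close> elements corresponds to n! injective tuples,
  which are sorted by the sequence of their classes. Thus the tuple counts are mixed factorial
  powers of the counts.\<close>

lemma tuple_count_generating_function:
  fixes t :: "nat \<Rightarrow> real"
  shows "(\<lambda>n. (\<Sum>c\<in>{..<n} \<rightarrow>\<^sub>E {..<m}. (\<Prod>j<n. t (c j)) * real (tuple_count n c k)) / fact n)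
    sums (\<Prod>i<m. (1 + t i) ^ k i)"
proof -
  define A where "A = Sigma {..<m} (\<lambda>i. {..<k i})"
  have finA: "finite A" by (simp add: A_def)
  have coeff: "(\<Sum>c\<in>{..<n} \<rightarrow>\<^sub>E {..<m}. (\<Prod>j<n. t (c j)) * real (tuple_count n c k)) / fact n
      = (\<Sum>R | R \<subseteq> A \<and> card R = n. \<Prod>x\<in>R. t (fst x))" for n
  proof -
    let ?I = "{x \<in> {..<n} \<rightarrow>\<^sub>E A. inj_on x {..<n}}"
    define cls where "cls x = (\<lambda>j\<in>{..<n}. fst (x j))" for x :: "nat \<Rightarrow> nat \<times> nat"
    have finI: "finite ?I" using finite_PiE[of "{..<n}" "\<lambda>_. A"] finA by auto
    have "fact n * (\<Sum>R | R \<subseteq> A \<and> card R = n. \<Prod>x\<in>R. t (fst x)) = (\<Sum>x\<in>?I. \<Prod>y\<in>x ` {..<n}. t (fst y))"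
      by (rule sum_inj_PiE_image[OF finA, symmetric])
    also have "\<dots> = (\<Sum>x\<in>?I. \<Prod>j<n. t (cls x j))"
      by (intro sum.cong refl) (auto simp: prod.reindex cls_def)
    also have "\<dots> = (\<Sum>c\<in>{..<n} \<rightarrow>\<^sub>E {..<m}. \<Sum>x\<in>{x \<in> ?I. cls x = c}. \<Prod>j<n. t (cls x j))"
    proof (rule sum.group[symmetric, OF finI])
      show "finite ({..<n} \<rightarrow>\<^sub>E {..<m})" by (intro finite_PiE) simp_all
      have "cls x j < m" if "x \<in> ?I" "j < n" for x j
      proof -
        have "x j \<in> A" using that by (intro PiE_mem[of x "{..<n}" "\<lambda>_. A" j]) simp_all
        then show ?thesis using that by (simp add: cls_def A_def mem_Sigma_iff[of "fst (x j)" "snd (x j)", simplified prod.collapse])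
      qed
      then show "cls ` ?I \<subseteq> {..<n} \<rightarrow>\<^sub>E {..<m}" by (intro image_subsetI PiE_I) (simp_all add: cls_def)
    qed
    also have "\<dots> = (\<Sum>c\<in>{..<n} \<rightarrow>\<^sub>E {..<m}. (\<Prod>j<n. t (c j)) * real (tuple_count n c k))"
    proof (rule sum.cong[OF refl])
      fix c assume c: "c \<in> {..<n} \<rightarrow>\<^sub>E {..<m}"
      have "{x \<in> ?I. cls x = c} = {x \<in> \<Pi>\<^sub>E j\<in>{..<n}. {c j} \<times> {..<k (c j)}. inj_on x {..<n}}"
      proof (intro equalityI subsetI)
        fix x assume "x \<in> {x \<in> ?I. cls x = c}"
        then have x: "x \<in> {..<n} \<rightarrow>\<^sub>E A" "inj_on x {..<n}" "cls x = c" by auto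
        have "x j \<in> {c j} \<times> {..<k (c j)}" if "j < n" for j
        proof -
          have "x j \<in> A" using PiE_mem[OF x(1)] that by simp
          moreover have "c j = fst (x j)" using fun_cong[OF x(3), of j] that by (simp add: cls_def)
          ultimately show ?thesis unfolding A_def by (cases "x j") simp
        qed
        then show "x \<in> {x \<in> \<Pi>\<^sub>E j\<in>{..<n}. {c j} \<times> {..<k (c j)}. inj_on x {..<n}}"
          using x by (auto simp: PiE_def)
      next
        fix x assume "x \<in> {x \<in> \<Pi>\<^sub>E j\<in>{..<n}. {c j} \<times> {..<k (c j)}. inj_on x {..<n}}"
        then have x: "x \<in> (\<Pi>\<^sub>E j\<in>{..<n}. {c j} \<times> {..<k (c j)})" "inj_on x {..<n}" by auto
        have xj: "x j \<in> {c j} \<times> {..<k (c j)}" "c j < m" if "j < n" for j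
          using PiE_mem[OF x(1), of j] PiE_mem[OF c, of j] that by auto
        have "x j \<in> A" if "j < n" for j
          using xj[OF that] by (auto simp: A_def)
        then have "x \<in> {..<n} \<rightarrow>\<^sub>E A" using x(1) by (auto simp: PiE_def)
        moreover have "cls x j = c j" for j
          using xj(1)[of j] PiE_arb[OF c, of j] by (auto simp: cls_def)
        ultimately show "x \<in> {x \<in> ?I. cls x = c}" using x(2) by auto
      qed
      then have "card {x \<in> ?I. cls x = c} = tuple_count n c k" by (simp add: tuple_count_def)
      then show "(\<Sum>x\<in>{x \<in> ?I. cls x = c}. \<Prod>j<n. t (cls x j)) = (\<Prod>j<n. t (c j)) * real (tuple_count n c k)"
        by simp
    qed
    finally show ?thesis by (simp add: field_simps)
  qed
  have "(\<Prod>i<m. (1 + t i) ^ k i) = (\<Prod>i<m. \<Prod>j<k i. t (fst (i, j)) + 1)"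
    by (simp add: add.commute)
  also have "\<dots> = (\<Prod>x\<in>A. t (fst x) + 1)"
    unfolding A_def by (subst prod.Sigma) (simp_all add: split_def)
  also have "\<dots> = (\<Sum>R\<in>Pow A. \<Prod>x\<in>R. t (fst x))"
    using prod_add[OF finA, of "\<lambda>x. t (fst x)" "\<lambda>_. 1"] by simp
  also have "\<dots> = (\<Sum>n\<le>card A. \<Sum>R | R \<subseteq> A \<and> card R = n. \<Prod>x\<in>R. t (fst x))"
    by (rule sum_Pow_card[OF finA])
  finally have eq: "(\<Prod>i<m. (1 + t i) ^ k i) = (\<Sum>n\<le>card A. \<Sum>R | R \<subseteq> A \<and> card R = n. \<Prod>x\<in>R. t (fst x))" .
  have zero: "(\<Sum>R | R \<subseteq> A \<and> card R = n. \<Prod>x\<in>R. t (fst x)) = 0" if "n \<notin> {..card A}" for n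
  proof -
    have "{R. R \<subseteq> A \<and> card R = n} = {}" using that by (auto dest: card_mono[OF finA])
    then show ?thesis by (simp only: sum.empty)
  qed
  show ?thesis
    unfolding coeff eq by (rule sums_finite[OF _ zero]) simp
qed

section \<open>Termwise integration of the generating function\<close>

text \<open>\<open>G\<close> is arbitrary because the coordinates take countably many values: the
  induction splits along the values of the last random coordinate and freezes that coordinate in
  \<open>a\<close>.\<close>

lemma measurable_nat_vector:
  fixes X :: "nat \<Rightarrow> 'w \<Rightarrow> nat"
  assumes "\<And>i. i < m \<Longrightarrow> X i \<in> measurable P (count_space UNIV)"
  shows "(\<lambda>\<omega>. G (\<lambda>i. if i < m then X i \<omega> else a i)) \<in> measurable P (count_space UNIV)"
  using assms
proof (induction m arbitrary: a)
  case (Suc m)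
  have "(\<lambda>\<omega>. (\<lambda>k \<omega>. G (\<lambda>i. if i < m then X i \<omega> else (a(m := k)) i)) (X m \<omega>) \<omega>) \<in> measurable P (count_space UNIV)"
  proof (rule measurable_compose_countable[where g = "X m"])
    show "(\<lambda>\<omega>. G (\<lambda>i. if i < m then X i \<omega> else (a(m := k)) i)) \<in> measurable P (count_space UNIV)" for k
      by (rule Suc.IH) (rule Suc.prems, simp)
    show "X m \<in> measurable P (count_space UNIV)" by (rule Suc.prems) simp
  qed
  moreover have "(\<lambda>i. if i < m then X i \<omega> else (a(m := X m \<omega>)) i) = (\<lambda>i. if i < Suc m then X i \<omega> else a i)" for \<omega>
    by (auto simp: fun_eq_iff less_Suc_eq)
  ultimately show ?case by simp
qed simp

lemma borel_measurable_nat_vector: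
  fixes X :: "nat \<Rightarrow> 'w \<Rightarrow> nat" and G :: "(nat \<Rightarrow> nat) \<Rightarrow> 'b::topological_space"
  assumes "\<And>i. i < m \<Longrightarrow> X i \<in> measurable P (count_space UNIV)"
  shows "(\<lambda>\<omega>. G (\<lambda>i. if i < m then X i \<omega> else a i)) \<in> borel_measurable P"
  using measurable_compose[OF measurable_nat_vector[OF assms, where G = G and a = a], where g = "\<lambda>x. x" and L = borel] by simp

lemma tuple_count_cong:
  assumes "c \<in> {..<n} \<rightarrow>\<^sub>E {..<m}" "\<And>i. i < m \<Longrightarrow> k i = k' i"
  shows "tuple_count n c k = tuple_count n c k'"
proof -
  have "(\<Pi>\<^sub>E j\<in>{..<n}. {c j} \<times> {..<k (c j)}) = (\<Pi>\<^sub>E j\<in>{..<n}. {c j} \<times> {..<k' (c j)})"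
  proof (rule PiE_cong)
    fix j assume "j \<in> {..<n}"
    then have "c j < m" using PiE_mem[OF assms(1)] by blast
    then show "{c j} \<times> {..<k (c j)} = {c j} \<times> {..<k' (c j)}" using assms(2) by simp
  qed
  then show ?thesis by (simp add: tuple_count_def)
qed

text \<open>Total factorial moments of order \<open>n\<close> are at most \<open>C ^ n\<close>, so
  after division by n! the series of absolute expectations is dominated by the exponential series,
  and expectation and sum may be exchanged.\<close>

lemma expectation_generating_function:
  fixes X :: "nat \<Rightarrow> 'w \<Rightarrow> nat" and t :: "nat \<Rightarrow> real"
  assumes X: "\<And>i. i < m \<Longrightarrow> X i \<in> measurable P (count_space UNIV)"
    and mom: "\<And>n c. c \<in> {..<n} \<rightarrow>\<^sub>E {..<m} \<Longrightarrow>
        (\<integral>\<^sup>+\<omega>. of_nat (tuple_count n c (\<lambda>i. X i \<omega>)) \<partial>P) = ennreal (Mom n c)"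
    and nonneg: "\<And>n c. c \<in> {..<n} \<rightarrow>\<^sub>E {..<m} \<Longrightarrow> 0 \<le> Mom n c"
    and bound: "\<And>n. (\<Sum>c\<in>{..<n} \<rightarrow>\<^sub>E {..<m}. Mom n c) \<le> C ^ n"
    and t: "\<And>i. i < m \<Longrightarrow> \<bar>t i\<bar> \<le> 1"
  shows "(\<lambda>n. (\<Sum>c\<in>{..<n} \<rightarrow>\<^sub>E {..<m}. (\<Prod>j<n. t (c j)) * Mom n c) / fact n)
    sums (\<integral>\<omega>. (\<Prod>i<m. (1 + t i) ^ X i \<omega>) \<partial>P)"
proof -
  define K where "K n c \<omega> = real (tuple_count n c (\<lambda>i. X i \<omega>))" for n c \<omega>
  have meas: "K n c \<in> borel_measurable P" if "c \<in> {..<n} \<rightarrow>\<^sub>E {..<m}" for n c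
  proof -
    have "K n c = (\<lambda>\<omega>. real (tuple_count n c (\<lambda>i. if i < m then X i \<omega> else 0)))"
      unfolding K_def by (rule ext, rule arg_cong[where f = real], rule tuple_count_cong[OF that]) simp
    moreover have "(\<lambda>\<omega>. (\<lambda>k. real (tuple_count n c k)) (\<lambda>i. if i < m then X i \<omega> else 0)) \<in> borel_measurable P"
      by (rule borel_measurable_nat_vector[OF X])
    ultimately show ?thesis by simp
  qed
  have hbi: "has_bochner_integral P (K n c) (Mom n c)" if c: "c \<in> {..<n} \<rightarrow>\<^sub>E {..<m}" for n c
    using mom[OF c] nonneg[OF c] meas[OF c]
    by (intro has_bochner_integral_nn_integral) (auto simp: K_def ennreal_of_nat_eq_real_of_nat)
  define f where "f n \<omega> = (\<Sum>c\<in>{..<n} \<rightarrow>\<^sub>E {..<m}. (\<Prod>j<n. t (c j)) * K n c \<omega>) / fact n" for n \<omega>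
  \<comment> \<open>The terms of the same series at \<open>t = 1\<close>; they dominate those for
    every admissible \<open>t\<close>.\<close>
  define h where "h n \<omega> = (\<Sum>c\<in>{..<n} \<rightarrow>\<^sub>E {..<m}. K n c \<omega>) / fact n" for n \<omega>
  have f_hbi: "has_bochner_integral P (f n) ((\<Sum>c\<in>{..<n} \<rightarrow>\<^sub>E {..<m}. (\<Prod>j<n. t (c j)) * Mom n c) / fact n)" for n
    unfolding f_def by (intro has_bochner_integral_divide_zero has_bochner_integral_sum has_bochner_integral_mult_right hbi)
  have h_hbi: "has_bochner_integral P (h n) ((\<Sum>c\<in>{..<n} \<rightarrow>\<^sub>E {..<m}. Mom n c) / fact n)" for n
    unfolding h_def by (intro has_bochner_integral_divide_zero has_bochner_integral_sum hbi)
  have fh: "norm (f n \<omega>) \<le> h n \<omega>" for n \<omega>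
  proof -
    have le: "\<bar>(\<Prod>j<n. t (c j)) * K n c \<omega>\<bar> \<le> K n c \<omega>" if "c \<in> {..<n} \<rightarrow>\<^sub>E {..<m}" for c
    proof -
      have "\<bar>\<Prod>j<n. t (c j)\<bar> \<le> 1"
        unfolding abs_prod using t PiE_mem[OF that] by (intro prod_le_1) auto
      then have "\<bar>\<Prod>j<n. t (c j)\<bar> * K n c \<omega> \<le> 1 * K n c \<omega>"
        by (intro mult_right_mono) (simp_all add: K_def)
      then show ?thesis by (simp add: abs_mult K_def)
    qed
    have "\<bar>\<Sum>c\<in>{..<n} \<rightarrow>\<^sub>E {..<m}. (\<Prod>j<n. t (c j)) * K n c \<omega>\<bar> \<le> (\<Sum>c\<in>{..<n} \<rightarrow>\<^sub>E {..<m}. K n c \<omega>)"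
      by (intro order.trans[OF sum_abs] sum_mono le)
    then show ?thesis by (simp add: f_def h_def divide_right_mono)
  qed
  have h_summable: "summable (\<lambda>n. h n \<omega>)" for \<omega>
    using tuple_count_generating_function[where t = "\<lambda>_. 1" and m = m and k = "\<lambda>i. X i \<omega>"] by (simp add: h_def K_def summable_def) blast
  have "(\<lambda>n. integral\<^sup>L P (f n)) sums (\<integral>\<omega>. (\<Sum>n. f n \<omega>) \<partial>P)"
  proof (rule sums_integral)
    show "integrable P (f n)" for n using f_hbi by (rule integrable.intros)
    show "AE \<omega> in P. summable (\<lambda>n. norm (f n \<omega>))"
    proof (rule AE_I2)
      fix \<omega>
      show "summable (\<lambda>n. norm (f n \<omega>))"
        by (rule summable_comparison_test'[OF h_summable[of \<omega>], of 0]) (use fh in simp)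
    qed
    show "summable (\<lambda>n. \<integral>\<omega>. norm (f n \<omega>) \<partial>P)"
    proof (rule summable_comparison_test'[OF summable_exp[of C], of 0])
      fix n
      have "norm (\<integral>\<omega>. norm (f n \<omega>) \<partial>P) = (\<integral>\<omega>. norm (f n \<omega>) \<partial>P)" by simp
      also have "\<dots> \<le> (\<integral>\<omega>. h n \<omega> \<partial>P)"
        using f_hbi[of n] h_hbi[of n] fh by (intro integral_mono integrable_norm) (auto simp: has_bochner_integral_iff)
      also have "\<dots> \<le> inverse (fact n) * C ^ n"
        using h_hbi[of n] bound[of n] by (simp add: has_bochner_integral_iff field_simps)
      finally show "norm (\<integral>\<omega>. norm (f n \<omega>) \<partial>P) \<le> inverse (fact n) * C ^ n" .
    qed
  qed
  moreover have "(\<Sum>n. f n \<omega>) = (\<Prod>i<m. (1 + t i) ^ X i \<omega>)" for \<omega>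
    unfolding f_def K_def by (rule sums_unique[symmetric, OF tuple_count_generating_function])
  moreover have "integral\<^sup>L P (f n) = (\<Sum>c\<in>{..<n} \<rightarrow>\<^sub>E {..<m}. (\<Prod>j<n. t (c j)) * Mom n c) / fact n" for n
    using f_hbi[of n] by (rule has_bochner_integral_integral_eq)
  ultimately show ?thesis by simp
qed

section \<open>From generating functions to point probabilities\<close>

text \<open>Common abstraction of \<open>u \<mapsto> E[u(Y) V]\<close> with
  \<open>\<bar>V\<bar> \<le> 1\<close> under the finite weights and under the limit law. Linearity
  is stated on bounded functions, where the expectations are meaningful; the second clause is
  contractivity in the supremum norm.\<close>

definition unit_functional :: "((nat \<Rightarrow> real) \<Rightarrow> real) \<Rightarrow> bool" where
  "unit_functional L \<longleftrightarrow>
     (\<forall>u v a b. bounded (range u) \<longrightarrow> bounded (range v) \<longrightarrow> L (\<lambda>x. a * u x + b * v x) = a * L u + b * L v)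
     \<and> (\<forall>u e. (\<forall>x. \<bar>u x\<bar> \<le> e) \<longrightarrow> \<bar>L u\<bar> \<le> e)"

lemma unit_functional_sum:
  assumes L: "unit_functional L" and u: "\<And>r. bounded (range (u r))"
  shows "L (\<lambda>x. \<Sum>r\<le>(d::nat). c r * u r x) = (\<Sum>r\<le>d. c r * L (u r)) \<and> bounded (range (\<lambda>x. \<Sum>r\<le>d. c r * u r x))"
proof (induction d)
  case 0
  have "L (\<lambda>x. c 0 * u 0 x + 0 * u 0 x) = c 0 * L (u 0) + 0 * L (u 0)"
    using L u unfolding unit_functional_def by blast
  then show ?case using bounded_scaling[OF u[of 0], of "c 0"] by (simp add: image_image)
next
  case (Suc d)
  have bd: "bounded (range (\<lambda>x. \<Sum>r\<le>d. c r * u r x))" using Suc by simp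
  have "L (\<lambda>x. 1 * (\<Sum>r\<le>d. c r * u r x) + c (Suc d) * u (Suc d) x)
      = 1 * L (\<lambda>x. \<Sum>r\<le>d. c r * u r x) + c (Suc d) * L (u (Suc d))"
    using L bd u unfolding unit_functional_def by blast
  moreover have "bounded (range (\<lambda>x. (\<Sum>r\<le>d. c r * u r x) + c (Suc d) * u (Suc d) x))"
    using bounded_scaling[OF u[of "Suc d"], of "c (Suc d)"] bd by (intro bounded_plus_comp) (auto simp: image_image)
  ultimately show ?case using Suc by simp
qed

lemma unit_functional_diff:
  assumes L: "unit_functional L" and "bounded (range u)" "bounded (range v)" "\<And>x. \<bar>u x - v x\<bar> \<le> e"
  shows "\<bar>L u - L v\<bar> \<le> e"
proof -
  have "L (\<lambda>x. 1 * u x + (- 1) * v x) = 1 * L u + (- 1) * L v"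
    using assms unfolding unit_functional_def by blast
  moreover have "\<bar>L (\<lambda>x. 1 * u x + (- 1) * v x)\<bar> \<le> e"
    using assms unfolding unit_functional_def by auto
  ultimately show ?thesis by simp
qed

text \<open>On the points \<open>2\<^sup>-\<^sup>x\<close> the indicator of \<open>x = k\<close> is the restriction of a continuous function, hence
  a uniform limit of polynomials, that is, of linear combinations of the functions \<open>(2\<^sup>-\<^sup>r)\<^sup>x\<close>.\<close>

lemma point_indicator_approximation:
  assumes "0 < e"
  obtains c d where "\<And>x::nat. \<bar>of_bool (x = k) - (\<Sum>r\<le>(d::nat). c r * ((1 / 2) ^ r) ^ x)\<bar> < (e::real)"
proof -
  \<comment> \<open>A tent of height 1 over \<open>(1 / 2) ^ k\<close> whose half-width
    \<open>(1 / 2) ^ Suc k\<close> is the distance to the nearest other point of the sequence, so it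
    vanishes at all the others.\<close>
  define f :: "real \<Rightarrow> real" where "f y = max 0 (1 - \<bar>y - (1 / 2) ^ k\<bar> * 2 ^ Suc k)" for y
  have "continuous_on {0..1} f" unfolding f_def by (intro continuous_intros)
  then obtain g where g: "real_polynomial_function g" "\<And>y. y \<in> {0..1} \<Longrightarrow> \<bar>f y - g y\<bar> < e"
    using Stone_Weierstrass_real_polynomial_function[of "{0..1}" f e] assms by auto
  obtain c d where cd: "g = (\<lambda>y. \<Sum>r\<le>(d::nat). c r * y ^ r)"
    using g(1) unfolding real_polynomial_function_iff_sum by auto
  have fx: "f ((1 / 2) ^ x) = of_bool (x = k)" for x
  proof (cases "x = k")
    case True
    then show ?thesis by (simp add: f_def)
  next
    case False
    have "(1 / 2) ^ Suc k \<le> \<bar>(1 / 2) ^ x - (1 / 2 :: real) ^ k\<bar>"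
    proof (cases "x < k")
      case True
      then have "(1 / 2 :: real) ^ (k - 1) \<le> (1 / 2) ^ x" by (intro power_decreasing) auto
      moreover have "(1 / 2 :: real) ^ (k - 1) = 2 * (1 / 2) ^ k" using True by (cases k) auto
      moreover have "(1 / 2 :: real) ^ Suc k = (1 / 2) ^ k / 2" "0 < (1 / 2 :: real) ^ k" by simp_all
      ultimately show ?thesis by linarith
    next
      case F: False
      then have "(1 / 2 :: real) ^ x \<le> (1 / 2) ^ Suc k" using False by (intro power_decreasing) auto
      moreover have "(1 / 2 :: real) ^ Suc k = (1 / 2) ^ k / 2" by simp
      ultimately show ?thesis by linarith
    qed
    then have "(1 / 2) ^ Suc k * 2 ^ Suc k \<le> \<bar>(1 / 2) ^ x - (1 / 2 :: real) ^ k\<bar> * 2 ^ Suc k"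
      by (intro mult_right_mono) auto
    then have "1 \<le> \<bar>(1 / 2) ^ x - (1 / 2 :: real) ^ k\<bar> * 2 ^ Suc k"
      by (simp add: power_divide)
    then show ?thesis using False by (simp add: f_def)
  qed
  show thesis
  proof (rule that)
    fix x
    have "(1 / 2 :: real) ^ x \<in> {0..1}" by (simp add: power_le_one)
    then have "\<bar>f ((1 / 2) ^ x) - g ((1 / 2) ^ x)\<bar> < e" by (rule g(2))
    moreover have "g ((1 / 2) ^ x) = (\<Sum>r\<le>d. c r * ((1 / 2) ^ r) ^ x)"
      unfolding cd by (intro sum.cong refl) (simp flip: power_mult add: mult.commute)
    ultimately show "\<bar>of_bool (x = k) - (\<Sum>r\<le>d. c r * ((1 / 2) ^ r) ^ x)\<bar> < e"
      unfolding fx by simp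
  qed
qed

text \<open>Uniform approximation costs at most e/3 under every functional, independently of
  \<open>N\<close>; on the approximant the functionals converge by linearity.\<close>

lemma unit_functional_tendsto_point:
  assumes \<Lambda>: "\<And>N. unit_functional (\<Lambda> N)" and L: "unit_functional L"
    and conv: "\<And>z. 0 \<le> z \<Longrightarrow> z \<le> 1 \<Longrightarrow> (\<lambda>N. \<Lambda> N (\<lambda>x. z ^ x)) \<longlonglongrightarrow> L (\<lambda>x. z ^ x)"
  shows "(\<lambda>N. \<Lambda> N (\<lambda>x. of_bool (x = k))) \<longlonglongrightarrow> L (\<lambda>x. of_bool (x = k))"
proof (rule LIMSEQ_I)
  fix e :: real assume "0 < e"
  then obtain c d where q: "\<And>x. \<bar>of_bool (x = k) - (\<Sum>r\<le>(d::nat). c r * ((1 / 2) ^ r) ^ x)\<bar> < e / 3"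
    using point_indicator_approximation[of "e / 3" k] by auto
  define p where "p x = (\<Sum>r\<le>d. c r * ((1 / 2) ^ r) ^ x)" for x
  have bz: "bounded (range (\<lambda>x. ((1 / 2 :: real) ^ r) ^ x))" for r :: nat
    by (intro boundedI[of _ 1]) (auto simp: power_le_one)
  have bp: "bounded (range p)" and Lp: "L p = (\<Sum>r\<le>d. c r * L (\<lambda>x. ((1 / 2) ^ r) ^ x))"
    and \<Lambda>p: "\<Lambda> N p = (\<Sum>r\<le>d. c r * \<Lambda> N (\<lambda>x. ((1 / 2) ^ r) ^ x))" for N
    using unit_functional_sum[OF L bz, where c = c and d = d] unit_functional_sum[OF \<Lambda>[of N] bz, where c = c and d = d] by (auto simp: p_def[abs_def])
  have bi: "bounded (range (\<lambda>x. of_bool (x = k) :: real))"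
    by (intro boundedI[of _ 1]) auto
  have close: "\<bar>of_bool (x = k) - p x\<bar> \<le> e / 3" for x using q[of x] by (simp add: p_def)
  have "(\<lambda>N. \<Lambda> N p) \<longlonglongrightarrow> L p"
    unfolding Lp \<Lambda>p by (intro tendsto_intros conv) (auto simp: power_le_one)
  then obtain n0 where n0: "\<And>N. n0 \<le> N \<Longrightarrow> \<bar>\<Lambda> N p - L p\<bar> < e / 3"
    using LIMSEQ_D[of _ _ "e / 3"] \<open>0 < e\<close> by (metis divide_pos_pos real_norm_def zero_less_numeral)
  show "\<exists>n0. \<forall>N\<ge>n0. norm (\<Lambda> N (\<lambda>x. of_bool (x = k)) - L (\<lambda>x. of_bool (x = k))) < e"
  proof (intro exI allI impI)
    fix N assume "n0 \<le> N"
    then show "norm (\<Lambda> N (\<lambda>x. of_bool (x = k)) - L (\<lambda>x. of_bool (x = k))) < e"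
      using n0[of N] unit_functional_diff[OF \<Lambda>[of N] bi bp close] unit_functional_diff[OF L bi bp close]
      unfolding real_norm_def by linarith
  qed
qed

lemma unit_functional_weighted_sum:
  fixes w :: "'s \<Rightarrow> real"
  assumes "\<And>S. S \<in> A \<Longrightarrow> 0 \<le> w S" "(\<Sum>S\<in>A. w S) = 1" "\<And>S. S \<in> A \<Longrightarrow> \<bar>V S\<bar> \<le> 1"
  shows "unit_functional (\<lambda>u. \<Sum>S\<in>A. w S * (u (y S) * V S))"
  unfolding unit_functional_def
proof (intro conjI allI impI)
  fix u :: "nat \<Rightarrow> real" and e assume u: "\<forall>x. \<bar>u x\<bar> \<le> e"
  have "\<bar>\<Sum>S\<in>A. w S * (u (y S) * V S)\<bar> \<le> (\<Sum>S\<in>A. w S * e)"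
  proof (intro order.trans[OF sum_abs] sum_mono)
    fix S assume S: "S \<in> A"
    have "\<bar>u (y S)\<bar> * \<bar>V S\<bar> \<le> e * 1"
      using u assms(3)[OF S] abs_ge_zero[of "u (y S)"] by (intro mult_mono) (auto intro: order.trans)
    then show "\<bar>w S * (u (y S) * V S)\<bar> \<le> w S * e"
      using assms(1)[OF S] by (simp add: abs_mult mult_left_mono)
  qed
  also have "\<dots> = e" using assms(2) by (simp add: sum_distrib_right[symmetric])
  finally show "\<bar>\<Sum>S\<in>A. w S * (u (y S) * V S)\<bar> \<le> e" .
qed (simp add: sum.distrib sum_distrib_left algebra_simps)

lemma (in prob_space) unit_functional_expectation:
  assumes Y: "Y \<in> measurable M (count_space UNIV)" and V: "V \<in> borel_measurable M" "\<And>\<omega>. \<omega> \<in> space M \<Longrightarrow> \<bar>V \<omega>\<bar> \<le> 1"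
  shows "unit_functional (\<lambda>u. \<integral>\<omega>. u (Y \<omega>) * V \<omega> \<partial>M)"
proof -
  have meas: "(\<lambda>\<omega>. u (Y \<omega>) * V \<omega>) \<in> borel_measurable M" for u :: "nat \<Rightarrow> real"
    using measurable_compose[OF Y, of u borel] V by simp
  have le: "\<bar>u (Y \<omega>) * V \<omega>\<bar> \<le> e" if "\<And>x. \<bar>u x\<bar> \<le> e" "\<omega> \<in> space M" for u e \<omega>
  proof -
    have "\<bar>u (Y \<omega>)\<bar> * \<bar>V \<omega>\<bar> \<le> e * 1"
      using that V(2)[of \<omega>] order.trans[OF abs_ge_zero that(1)[of 0]] by (intro mult_mono) auto
    then show ?thesis by (simp add: abs_mult)
  qed
  have int: "integrable M (\<lambda>\<omega>. u (Y \<omega>) * V \<omega>)" if u: "bounded (range u)" for u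
  proof -
    obtain e where "\<forall>x\<in>range u. norm x \<le> e" using u unfolding bounded_iff by blast
    then have "\<And>x. \<bar>u x\<bar> \<le> e" by auto
    then show ?thesis using le meas by (intro integrable_const_bound[where B = e]) auto
  qed
  show ?thesis
    unfolding unit_functional_def
  proof (intro conjI allI impI)
    fix u v :: "nat \<Rightarrow> real" and a b assume "bounded (range u)" "bounded (range v)"
    then have "(\<integral>\<omega>. a * (u (Y \<omega>) * V \<omega>) + b * (v (Y \<omega>) * V \<omega>) \<partial>M)
        = a * (\<integral>\<omega>. u (Y \<omega>) * V \<omega> \<partial>M) + b * (\<integral>\<omega>. v (Y \<omega>) * V \<omega> \<partial>M)"
      by (subst Bochner_Integration.integral_add) (auto intro!: int integrable_mult_right)
    then show "(\<integral>\<omega>. (a * u (Y \<omega>) + b * v (Y \<omega>)) * V \<omega> \<partial>M)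
        = a * (\<integral>\<omega>. u (Y \<omega>) * V \<omega> \<partial>M) + b * (\<integral>\<omega>. v (Y \<omega>) * V \<omega> \<partial>M)"
      by (simp add: algebra_simps)
  next
    fix u :: "nat \<Rightarrow> real" and e assume u: "\<forall>x. \<bar>u x\<bar> \<le> e"
    then have "bounded (range u)" by (auto simp: bounded_iff)
    then have "\<bar>\<integral>\<omega>. u (Y \<omega>) * V \<omega> \<partial>M\<bar> \<le> (\<integral>\<omega>. \<bar>u (Y \<omega>) * V \<omega>\<bar> \<partial>M)"
      by (intro integral_abs_bound)
    also have "\<dots> \<le> (\<integral>\<omega>. e \<partial>M)"
      using u le int[OF \<open>bounded (range u)\<close>] by (intro integral_mono integrable_abs) auto
    finally show "\<bar>\<integral>\<omega>. u (Y \<omega>) * V \<omega> \<partial>M\<bar> \<le> e" by (simp add: prob_space)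
  qed
qed

text \<open>Powers are exchanged for point indicators one coordinate at a time. \<open>W j\<close>
  has indicators in the first \<open>j\<close> coordinates and powers in the rest; when coordinate
  \<open>j\<close> is treated, the product \<open>V\<close> of all other factors is bounded by 1 and
  is absorbed into the functional.\<close>

lemma (in prob_space) generating_functions_determine_point_limits:
  fixes X :: "nat \<Rightarrow> 'a \<Rightarrow> nat" and w :: "nat \<Rightarrow> 's \<Rightarrow> real" and y :: "nat \<Rightarrow> 's \<Rightarrow> nat \<Rightarrow> nat"
  assumes X: "\<And>i. i < m \<Longrightarrow> X i \<in> measurable M (count_space UNIV)"
    and w: "\<And>N S. S \<in> A N \<Longrightarrow> 0 \<le> w N S" "\<And>N. (\<Sum>S\<in>A N. w N S) = 1"
    and conv: "\<And>z. (\<And>i. 0 \<le> z i \<and> z i \<le> (1::real)) \<Longrightarrow>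
      (\<lambda>N. \<Sum>S\<in>A N. w N S * (\<Prod>i<m. z i ^ y N S i)) \<longlonglongrightarrow> (\<integral>\<omega>. (\<Prod>i<m. z i ^ X i \<omega>) \<partial>M)"
  shows "(\<lambda>N. \<Sum>S\<in>A N. w N S * (\<Prod>i<m. of_bool (y N S i = k i))) \<longlonglongrightarrow> (\<integral>\<omega>. (\<Prod>i<m. of_bool (X i \<omega> = k i)) \<partial>M)"
proof -
  define W where "W j z u = (\<Prod>i<j. of_bool (u i = k i)) * (\<Prod>i\<in>{j..<m}. z i ^ u i)" for j and z :: "nat \<Rightarrow> real" and u :: "nat \<Rightarrow> nat"
  have "(\<lambda>N. \<Sum>S\<in>A N. w N S * W j z (y N S)) \<longlonglongrightarrow> (\<integral>\<omega>. W j z (\<lambda>i. X i \<omega>) \<partial>M)"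
    if "j \<le> m" "\<And>i. 0 \<le> z i \<and> z i \<le> 1" for j z
    using that
  proof (induction j arbitrary: z)
    case 0
    then show ?case using conv[of z] by (simp add: W_def lessThan_atLeast0)
  next
    case (Suc j)
    define V where "V u = (\<Prod>i<j. of_bool (u i = k i)) * (\<Prod>i\<in>{Suc j..<m}. z i ^ u i)" for u :: "nat \<Rightarrow> nat"
    have V_le: "\<bar>V u\<bar> \<le> 1" for u
      unfolding V_def abs_mult abs_prod using Suc.prems(2)
      by (intro mult_le_one prod_le_1 prod_nonneg) (auto simp: power_le_one)
    have split: "{j..<m} = insert j {Suc j..<m}" using Suc.prems(1) by auto
    have W_j: "W j (z(j := x)) u = x ^ u j * V u" for x u
    proof -
      have "(\<Prod>i\<in>{Suc j..<m}. (z(j := x)) i ^ u i) = (\<Prod>i\<in>{Suc j..<m}. z i ^ u i)"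
        by (intro prod.cong) auto
      then show ?thesis by (simp add: W_def V_def split mult_ac)
    qed
    have W_Suc: "W (Suc j) z u = of_bool (u j = k j) * V u" for u
      by (simp add: W_def V_def mult_ac)
    have "(\<lambda>\<omega>. V (\<lambda>i. X i \<omega>)) \<in> borel_measurable M"
    proof -
      have "V (\<lambda>i. X i \<omega>) = V (\<lambda>i. if i < m then X i \<omega> else 0)" for \<omega>
        unfolding V_def using Suc.prems(1) by (intro arg_cong2[where f = times] prod.cong) auto
      then show ?thesis using borel_measurable_nat_vector[OF X, where G = V and a = "\<lambda>_. 0"] by simp
    qed
    then have L: "unit_functional (\<lambda>u. \<integral>\<omega>. u (X j \<omega>) * V (\<lambda>i. X i \<omega>) \<partial>M)"
      using X Suc.prems(1) V_le by (intro unit_functional_expectation) auto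
    have \<Lambda>: "unit_functional (\<lambda>u. \<Sum>S\<in>A N. w N S * (u (y N S j) * V (y N S)))" for N
      using w V_le by (intro unit_functional_weighted_sum) auto
    have "(\<lambda>N. \<Sum>S\<in>A N. w N S * (x ^ y N S j * V (y N S))) \<longlonglongrightarrow> (\<integral>\<omega>. x ^ X j \<omega> * V (\<lambda>i. X i \<omega>) \<partial>M)"
      if "0 \<le> x" "x \<le> 1" for x
      using Suc.IH[of "z(j := x)"] Suc.prems that unfolding W_j by auto
    from unit_functional_tendsto_point[OF \<Lambda> L this, of "k j"]
    show ?case unfolding W_Suc .
  qed
  from this[of m "\<lambda>_. 0"] show ?thesis by (simp add: W_def)
qed

section \<open>Exhaustion by boxes\<close>

text \<open>The cut-off of \<open>F\<close> to a box, written as a finite combination of point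
  indicators so that convergence of point probabilities passes to it term by term.\<close>

definition box_part :: "nat \<Rightarrow> nat \<Rightarrow> ((nat \<Rightarrow> nat) \<Rightarrow> real) \<Rightarrow> (nat \<Rightarrow> nat) \<Rightarrow> real" where
  "box_part m R F u = (\<Sum>k\<in>{..<m} \<rightarrow>\<^sub>E {..R}. F (\<lambda>i. if i < m then k i else 0) * (\<Prod>i<m. of_bool (u i = k i)))"

lemma box_part_eq:
  "box_part m R F u = (if \<forall>i<m. u i \<le> R then F (\<lambda>i. if i < m then u i else 0) else 0)"
proof -
  have *: "(\<Prod>i<m. of_bool (u i = k i) :: real) = (if k = restrict u {..<m} then 1 else 0)" if "k \<in> {..<m} \<rightarrow>\<^sub>E {..R}" for k
  proof (cases "k = restrict u {..<m}")
    case False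
    then have "\<exists>i<m. u i \<noteq> k i"
      using that by (metis PiE_restrict restrict_ext lessThan_iff)
    then show ?thesis using False by (auto intro!: prod_zero)
  qed simp
  have "box_part m R F u
      = (\<Sum>k\<in>{..<m} \<rightarrow>\<^sub>E {..R}. if k = restrict u {..<m} then F (\<lambda>i. if i < m then k i else 0) else 0)"
    unfolding box_part_def
  proof (rule sum.cong[OF refl])
    fix k assume k: "k \<in> {..<m} \<rightarrow>\<^sub>E {..R}"
    show "F (\<lambda>i. if i < m then k i else 0) * (\<Prod>i<m. of_bool (u i = k i))
        = (if k = restrict u {..<m} then F (\<lambda>i. if i < m then k i else 0) else 0)"
      unfolding *[OF k] by (cases "k = restrict u {..<m}") (simp_all only: if_True if_False mult_1_right mult_zero_right simp_thms)
  qed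
  also have "\<dots> = (if restrict u {..<m} \<in> {..<m} \<rightarrow>\<^sub>E {..R} then F (\<lambda>i. if i < m then restrict u {..<m} i else 0) else 0)"
    by (subst sum.delta) (auto intro: finite_PiE)
  also have "\<dots> = (if \<forall>i<m. u i \<le> R then F (\<lambda>i. if i < m then u i else 0) else 0)"
    by (auto simp: restrict_PiE_iff cong: if_cong)
  finally show ?thesis .
qed

text \<open>Fatou's lemma: at every outcome the box parts are eventually equal to the full value, as
  soon as \<open>R\<close> exceeds the sum of the counts.\<close>

lemma nn_integral_le_box_part:
  fixes X :: "nat \<Rightarrow> 'w \<Rightarrow> nat"
  assumes X: "\<And>i. i < m \<Longrightarrow> X i \<in> measurable P (count_space UNIV)"
    and box: "\<And>R. (\<integral>\<^sup>+\<omega>. ennreal (box_part m R F (\<lambda>i. X i \<omega>)) \<partial>P) \<le> B"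
  shows "(\<integral>\<^sup>+\<omega>. ennreal (F (\<lambda>i. if i < m then X i \<omega> else 0)) \<partial>P) \<le> B"
proof -
  have lim: "(\<lambda>R. ennreal (box_part m R F (\<lambda>i. X i \<omega>))) \<longlonglongrightarrow> ennreal (F (\<lambda>i. if i < m then X i \<omega> else 0))" for \<omega>
  proof (rule tendsto_eventually, rule eventually_sequentiallyI)
    fix R assume R: "(\<Sum>i<m. X i \<omega>) \<le> R"
    have "X i \<omega> \<le> R" if "i < m" for i
      using R member_le_sum[of i "{..<m}" "\<lambda>i. X i \<omega>"] that by simp
    then show "ennreal (box_part m R F (\<lambda>i. X i \<omega>)) = ennreal (F (\<lambda>i. if i < m then X i \<omega> else 0))"
      by (simp add: box_part_eq)
  qed
  have meas: "(\<lambda>\<omega>. ennreal (box_part m R F (\<lambda>i. X i \<omega>))) \<in> borel_measurable P" for R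
  proof -
    have "box_part m R F (\<lambda>i. X i \<omega>) = box_part m R F (\<lambda>i. if i < m then X i \<omega> else 0)" for \<omega>
      unfolding box_part_def by simp
    then show ?thesis using borel_measurable_nat_vector[OF X, where G = "box_part m R F" and a = "\<lambda>_. 0"] by simp
  qed
  have "(\<integral>\<^sup>+\<omega>. ennreal (F (\<lambda>i. if i < m then X i \<omega> else 0)) \<partial>P)
      = (\<integral>\<^sup>+\<omega>. liminf (\<lambda>R. ennreal (box_part m R F (\<lambda>i. X i \<omega>))) \<partial>P)"
    by (intro nn_integral_cong lim_imp_Liminf[symmetric] lim) simp
  also have "\<dots> \<le> liminf (\<lambda>R. \<integral>\<^sup>+\<omega>. ennreal (box_part m R F (\<lambda>i. X i \<omega>)) \<partial>P)"
    by (intro nn_integral_liminf meas)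
  also have "\<dots> \<le> liminf (\<lambda>R::nat. B)"
    by (intro Liminf_mono always_eventually allI box)
  finally show ?thesis by (simp add: Liminf_const)
qed

section \<open>Finite rank kernels\<close>

text \<open>Here \<open>\<psi> k\<close> is meant to be an eigenfunction times the root of its
  eigenvalue \<open>l k\<close>, cut off to the union of the sets. This scaling absorbs the
  eigenvalues into the kernel, and the Gram matrix over all the sets becomes diag(l). The sets are
  meant to avoid the exceptional null set, so that the kernel expansion holds at every
  point.\<close>

locale finite_rank_kernels =
  fixes M :: "'a measure" and \<psi> :: "nat \<Rightarrow> 'a \<Rightarrow> complex" and B :: "nat \<Rightarrow> 'a set" and m :: nat
    and l :: "nat \<Rightarrow> real" and \<kappa> :: "'a \<Rightarrow> 'a \<Rightarrow> complex"
  assumes sigma_finite: "sigma_finite_measure M"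
    and B_sets: "\<And>b. b < m \<Longrightarrow> B b \<in> sets M"
    and \<psi>_meas: "\<And>k. \<psi> k \<in> borel_measurable M"
    and \<psi>_int: "\<And>k. integrable M (\<lambda>x. (cmod (\<psi> k x))\<^sup>2)"
    and l_nonneg: "\<And>k. 0 \<le> l k"
    and gram: "\<And>j k. (\<Sum>b<m. \<integral>x. indicator (B b) x * (\<psi> j x * cnj (\<psi> k x)) \<partial>M) = (if j = k then of_real (l j) else 0)"
    and kernel: "\<And>x y b b'. b < m \<Longrightarrow> b' < m \<Longrightarrow> x \<in> B b \<Longrightarrow> y \<in> B b' \<Longrightarrow> (\<lambda>k. \<psi> k x * cnj (\<psi> k y)) sums \<kappa> x y"
    and diag_int: "\<And>b. b < m \<Longrightarrow> integrable M (\<lambda>x. indicator (B b) x * Re (\<kappa> x x))"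
begin

definition A :: "nat \<Rightarrow> nat \<Rightarrow> nat \<Rightarrow> complex" where
  "A b j k = (\<integral>x. indicator (B b) x * (\<psi> j x * cnj (\<psi> k x)) \<partial>M)"

lemma integrable_product: "integrable M (\<lambda>x. \<psi> j x * cnj (\<psi> k x))"
proof (rule Bochner_Integration.integrable_bound[OF Bochner_Integration.integrable_add[OF \<psi>_int[of j] \<psi>_int[of k]]])
  show "(\<lambda>x. \<psi> j x * cnj (\<psi> k x)) \<in> borel_measurable M"
    using \<psi>_meas measurable_compose[OF \<psi>_meas[of k] borel_measurable_continuous_onI[of cnj]]
    by (intro borel_measurable_times) (auto intro: continuous_intros)
  have "cmod (\<psi> j x) * cmod (\<psi> k x) \<le> (cmod (\<psi> j x))\<^sup>2 + (cmod (\<psi> k x))\<^sup>2" for x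
    using sum_squares_bound[of "cmod (\<psi> j x)" "cmod (\<psi> k x)"]
      mult_nonneg_nonneg[OF norm_ge_zero[of "\<psi> j x"] norm_ge_zero[of "\<psi> k x"]] by linarith
  then show "AE x in M. norm (\<psi> j x * cnj (\<psi> k x)) \<le> norm ((cmod (\<psi> j x))\<^sup>2 + (cmod (\<psi> k x))\<^sup>2)"
    by (simp add: norm_mult)
qed

lemma integrable_indicator_product:
  assumes "b < m"
  shows "integrable M (\<lambda>x. indicator (B b) x * (\<psi> j x * cnj (\<psi> k x)))"
proof -
  have "integrable M (\<lambda>x. indicator (B b) x *\<^sub>R (\<psi> j x * cnj (\<psi> k x)))"
    using integrable_mult_indicator[OF B_sets[OF assms] integrable_product] .
  moreover have "indicator (B b) x *\<^sub>R (\<psi> j x * cnj (\<psi> k x)) = indicator (B b) x * (\<psi> j x * cnj (\<psi> k x))" for x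
    by (simp add: indicator_def)
  ultimately show ?thesis by simp
qed

text \<open>The quadratic form is the integral over \<open>B b\<close> of the squared modulus of a
  linear combination of the \<open>\<psi> i\<close>.\<close>

lemma psd_A:
  assumes "b < m"
  shows "psd d (A b)"
  unfolding psd_def
proof (intro conjI allI impI)
  fix i j
  have "cnj (A b i j) = (\<integral>x. cnj (indicator (B b) x * (\<psi> i x * cnj (\<psi> j x))) \<partial>M)"
    unfolding A_def
    by (rule integral_bounded_linear[OF bounded_linear_cnj integrable_indicator_product[OF assms], symmetric])
  moreover have "cnj (indicator (B b) x * (\<psi> i x * cnj (\<psi> j x))) = indicator (B b) x * (\<psi> j x * cnj (\<psi> i x))" for x
    by (cases "x \<in> B b") simp_all
  ultimately show "A b j i = cnj (A b i j)" by (simp only: A_def)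
next
  fix c
  have "(\<Sum>i<d. \<Sum>j<d. c i * A b i j * cnj (c j))
      = (\<integral>x. (\<Sum>i<d. \<Sum>j<d. c i * cnj (c j) * (indicator (B b) x * (\<psi> i x * cnj (\<psi> j x)))) \<partial>M)"
    unfolding A_def using integrable_indicator_product[OF assms]
    by (subst Bochner_Integration.integral_sum, simp, subst Bochner_Integration.integral_sum) (simp_all add: mult_ac)
  also have "\<dots> = (\<integral>x. complex_of_real (indicator (B b) x * (cmod (\<Sum>i<d. c i * \<psi> i x))\<^sup>2) \<partial>M)"
  proof (rule Bochner_Integration.integral_cong[OF refl])
    fix x
    have "(\<Sum>i<d. \<Sum>j<d. c i * cnj (c j) * (indicator (B b) x * (\<psi> i x * cnj (\<psi> j x))))
        = indicator (B b) x * ((\<Sum>i<d. c i * \<psi> i x) * cnj (\<Sum>i<d. c i * \<psi> i x))"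
    proof -
      have "(\<Sum>i<d. c i * \<psi> i x) * cnj (\<Sum>i<d. c i * \<psi> i x) = (\<Sum>i<d. \<Sum>j<d. (c i * \<psi> i x) * cnj (c j * \<psi> j x))"
        unfolding cnj_sum sum_product ..
      then show ?thesis
        by (simp only: sum_distrib_left) (intro sum.cong refl, simp add: mult_ac)
    qed
    then show "(\<Sum>i<d. \<Sum>j<d. c i * cnj (c j) * (indicator (B b) x * (\<psi> i x * cnj (\<psi> j x))))
        = complex_of_real (indicator (B b) x * (cmod (\<Sum>i<d. c i * \<psi> i x))\<^sup>2)"
      unfolding complex_norm_square[symmetric] by (simp add: indicator_def)
  qed
  finally show "0 \<le> Re (\<Sum>i<d. \<Sum>j<d. c i * A b i j * cnj (c j))"
    by (simp del: of_real_mult of_real_power add: integral_nonneg_AE)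
qed

definition truncated_kernel :: "nat \<Rightarrow> 'a \<Rightarrow> 'a \<Rightarrow> complex" where
  "truncated_kernel N x y = (\<Sum>k<N. \<psi> k x * cnj (\<psi> k y))"

text \<open>The factorial moment that the truncated kernel assigns to classes \<open>c\<close>,
  already integrated: row \<open>i\<close> of the matrix uses the Gram matrix of the set in which
  the \<open>i\<close>-th point lies.\<close>

definition moment :: "nat \<Rightarrow> nat \<Rightarrow> (nat \<Rightarrow> nat) \<Rightarrow> complex" where
  "moment N n c = (\<Sum>k\<in>{..<n} \<rightarrow>\<^sub>E {..<N}. ldet {..<n} (\<lambda>i j. A (c i) (k i) (k j)))"

text \<open>Transposing the second determinant puts both factors at position \<open>i\<close> at the
  same point \<open>x i\<close>, so each summand is a product of functions of single points and
  integrates as a product.\<close>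

lemma ldet_truncated_kernel:
  fixes n :: nat
  shows
  "ldet {..<n} (\<lambda>i j. truncated_kernel N (x i) (x j))
    = (\<Sum>k\<in>{..<n} \<rightarrow>\<^sub>E {..<N}. \<Sum>p | p permutes {..<n}. of_int (sign p) * (\<Prod>i<n. \<psi> (k i) (x i) * cnj (\<psi> (k (p i)) (x i))))"
proof -
  have "ldet {..<n} (\<lambda>i j. truncated_kernel N (x i) (x j))
      = (\<Sum>k\<in>{..<n} \<rightarrow>\<^sub>E {..<N}. (\<Prod>i<n. \<psi> (k i) (x i)) * ldet {..<n} (\<lambda>i j. cnj (\<psi> (k i) (x j))))"
    unfolding truncated_kernel_def by (rule ldet_sum_product) simp
  also have "\<dots> = (\<Sum>k\<in>{..<n} \<rightarrow>\<^sub>E {..<N}. (\<Prod>i<n. \<psi> (k i) (x i)) * ldet {..<n} (\<lambda>i j. cnj (\<psi> (k j) (x i))))"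
  proof (rule sum.cong[OF refl])
    fix k
    show "(\<Prod>i<n. \<psi> (k i) (x i)) * ldet {..<n} (\<lambda>i j. cnj (\<psi> (k i) (x j)))
        = (\<Prod>i<n. \<psi> (k i) (x i)) * ldet {..<n} (\<lambda>i j. cnj (\<psi> (k j) (x i)))"
      using ldet_transpose[of "{..<n}" "\<lambda>i j. cnj (\<psi> (k i) (x j))"] by simp
  qed
  also have "\<dots> = (\<Sum>k\<in>{..<n} \<rightarrow>\<^sub>E {..<N}. \<Sum>p | p permutes {..<n}. of_int (sign p) * (\<Prod>i<n. \<psi> (k i) (x i) * cnj (\<psi> (k (p i)) (x i))))"
    unfolding ldet_def sum_distrib_left prod.distrib by (intro sum.cong refl) (simp only: mult_ac)
  finally show ?thesis .
qed

text \<open>Cauchy--Binet with weights 1, the values of the \<open>\<psi> k\<close> at the points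
  forming the vectors.\<close>

lemma ldet_truncated_kernel_nonneg:
  fixes n :: nat
  shows
  "\<exists>q\<ge>0. ldet {..<n} (\<lambda>i j. truncated_kernel N (x i) (x j)) = complex_of_real q"
proof -
  define q where "q = (\<Sum>\<alpha>\<in>{..<n} \<rightarrow>\<^sub>E {..<N}. (cmod (ldet {..<n} (\<lambda>i j. \<psi> (\<alpha> i) (x j))))\<^sup>2)"
  have "fact n * ldet {..<n} (\<lambda>i j. truncated_kernel N (x i) (x j)) = complex_of_real q"
    using fact_smult_ldet_gram[of "{..<N}" n "\<lambda>_. 1" "\<lambda>e i. \<psi> e (x i)"]
    by (simp add: truncated_kernel_def q_def)
  then have "ldet {..<n} (\<lambda>i j. truncated_kernel N (x i) (x j)) = complex_of_real (q / fact n)"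
    by (simp add: field_simps)
  moreover have "0 \<le> q / fact n" by (simp add: q_def sum_nonneg)
  ultimately show ?thesis by blast
qed

lemma integral_truncated_kernel:
  fixes N :: nat
  assumes c: "\<And>i. i < n \<Longrightarrow> c i < m"
  defines "f \<equiv> \<lambda>x. (\<Prod>i<n. indicator (B (c i)) (x i)) * ldet {..<n} (\<lambda>i j. truncated_kernel N (x i) (x j))"
  shows "integrable (Pi\<^sub>M {..<n} (\<lambda>_. M)) f" and "integral\<^sup>L (Pi\<^sub>M {..<n} (\<lambda>_. M)) f = moment N n c"
proof -
  interpret sigma_finite_measure M by (rule sigma_finite)
  interpret product_sigma_finite "\<lambda>_::nat. M" by unfold_locales
  define g where "g k p = (\<lambda>x. \<Prod>i<n. indicator (B (c i)) (x i) * (\<psi> (k i) (x i) * cnj (\<psi> (k (p i)) (x i))))"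
    for k p :: "nat \<Rightarrow> nat"
  have g: "integrable (Pi\<^sub>M {..<n} (\<lambda>_. M)) (g k p)"
    "integral\<^sup>L (Pi\<^sub>M {..<n} (\<lambda>_. M)) (g k p) = (\<Prod>i<n. A (c i) (k i) (k (p i)))" for k p
    unfolding g_def A_def
    by (rule product_integrable_prod product_integral_prod; use c integrable_indicator_product in auto)+
  have f: "f = (\<lambda>x. \<Sum>k\<in>{..<n} \<rightarrow>\<^sub>E {..<N}. \<Sum>p | p permutes {..<n}. of_int (sign p) * g k p x)"
    unfolding f_def g_def ldet_truncated_kernel sum_distrib_left
    by (intro ext sum.cong refl) (simp only: prod.distrib mult_ac)
  show "integrable (Pi\<^sub>M {..<n} (\<lambda>_. M)) f"
    unfolding f using g by auto
  show "integral\<^sup>L (Pi\<^sub>M {..<n} (\<lambda>_. M)) f = moment N n c"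
    unfolding f moment_def ldet_def using g by simp
qed

lemma moment_nonneg:
  assumes "\<And>i. i < n \<Longrightarrow> c i < m"
  shows "0 \<le> Re (moment N n c)"
proof -
  obtain q where q: "\<And>x. 0 \<le> q x" "\<And>x. ldet {..<n} (\<lambda>i j. truncated_kernel N (x i) (x j)) = complex_of_real (q x)"
    using ldet_truncated_kernel_nonneg by metis
  have "moment N n c = (\<integral>x. (\<Prod>i<n. indicator (B (c i)) (x i)) * ldet {..<n} (\<lambda>i j. truncated_kernel N (x i) (x j)) \<partial>Pi\<^sub>M {..<n} (\<lambda>_. M))"
    using integral_truncated_kernel(2)[of n c N] assms by simp
  also have "\<dots> = (\<integral>x. complex_of_real ((\<Prod>i<n. indicator (B (c i)) (x i)) * q x) \<partial>Pi\<^sub>M {..<n} (\<lambda>_. M))"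
  proof (rule Bochner_Integration.integral_cong[OF refl])
    fix x :: "nat \<Rightarrow> 'a"
    have "(\<Prod>i<n. indicator (B (c i)) (x i)) = complex_of_real (\<Prod>i<n. indicator (B (c i)) (x i))"
      unfolding of_real_prod by (intro prod.cong refl) (simp add: indicator_def)
    then show "(\<Prod>i<n. indicator (B (c i)) (x i)) * ldet {..<n} (\<lambda>i j. truncated_kernel N (x i) (x j))
        = complex_of_real ((\<Prod>i<n. indicator (B (c i)) (x i)) * q x)"
      by (simp add: q(2) del: of_real_prod)
  qed
  finally show ?thesis
    using q(1) by (simp del: of_real_mult add: integral_nonneg_AE prod_nonneg)
qed

lemma diag_sums:
  assumes "b < m" "x \<in> B b"
  shows "(\<lambda>k. (cmod (\<psi> k x))\<^sup>2) sums Re (\<kappa> x x)"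
proof -
  have "Re (z * cnj z) = (cmod z)\<^sup>2" for z
    by (metis Re_complex_of_real complex_norm_square)
  then show ?thesis using sums_Re[OF kernel[OF assms(1,1,2,2)]] by (simp only:)
qed

lemma sum_diag_le:
  assumes "b < m" "x \<in> B b"
  shows "(\<Sum>k<N. (cmod (\<psi> k x))\<^sup>2) \<le> Re (\<kappa> x x)"
  using diag_sums[OF assms] sum_le_suminf[of "\<lambda>k. (cmod (\<psi> k x))\<^sup>2" "{..<N}"]
  by (simp add: sums_iff)

lemma diag_nonneg:
  assumes "b < m" "x \<in> B b"
  shows "0 \<le> Re (\<kappa> x x)"
  using sum_diag_le[OF assms, of 0] by simp

lemma norm_truncated_kernel_le:
  assumes "b < m" "x \<in> B b" "b' < m" "y \<in> B b'"
  shows "cmod (truncated_kernel N x y) \<le> sqrt (Re (\<kappa> x x)) * sqrt (Re (\<kappa> y y))"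
proof -
  have "cmod (truncated_kernel N x y) \<le> (\<Sum>k<N. \<bar>cmod (\<psi> k x)\<bar> * \<bar>cmod (\<psi> k y)\<bar>)"
    unfolding truncated_kernel_def by (rule order.trans[OF norm_sum]) (simp add: norm_mult)
  also have "\<dots> \<le> L2_set (\<lambda>k. cmod (\<psi> k x)) {..<N} * L2_set (\<lambda>k. cmod (\<psi> k y)) {..<N}"
    by (rule L2_set_mult_ineq)
  also have "\<dots> \<le> sqrt (Re (\<kappa> x x)) * sqrt (Re (\<kappa> y y))"
    unfolding L2_set_def using assms
    by (intro mult_mono real_sqrt_le_mono sum_diag_le) (auto simp: sum_nonneg intro: diag_nonneg)
  finally show ?thesis .
qed

definition kernel_moment :: "nat \<Rightarrow> (nat \<Rightarrow> nat) \<Rightarrow> real" where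
  "kernel_moment n c = (\<integral>x. (\<Prod>i<n. indicator (B (c i)) (x i)) * Re (ldet {..<n} (\<lambda>i j. \<kappa> (x i) (x j))) \<partial>Pi\<^sub>M {..<n} (\<lambda>_. M))"

text \<open>Dominated convergence. By Cauchy--Schwarz the truncated kernel is at most the geometric
  mean of the diagonal values of \<open>\<kappa>\<close>. In a permutation product every index
  occurs once as row and once as column, so the product is bounded by that of the diagonal values,
  whence the integrable bound \<open>w\<close>.\<close>

lemma kernel_moment_limit:
  assumes c: "\<And>i. i < n \<Longrightarrow> c i < m"
  shows "integrable (Pi\<^sub>M {..<n} (\<lambda>_. M)) (\<lambda>x. (\<Prod>i<n. indicator (B (c i)) (x i)) * Re (ldet {..<n} (\<lambda>i j. \<kappa> (x i) (x j))))"
    and "(\<lambda>N. Re (moment N n c)) \<longlonglongrightarrow> kernel_moment n c"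
proof -
  interpret sigma_finite_measure M by (rule sigma_finite)
  interpret product_sigma_finite "\<lambda>_::nat. M" by unfold_locales
  let ?P = "Pi\<^sub>M {..<n} (\<lambda>_. M)"
  define s where "s N x = (\<Prod>i<n. indicator (B (c i)) (x i)) * Re (ldet {..<n} (\<lambda>i j. truncated_kernel N (x i) (x j)))" for N x
  define f where "f x = (\<Prod>i<n. indicator (B (c i)) (x i)) * Re (ldet {..<n} (\<lambda>i j. \<kappa> (x i) (x j)))" for x
  define w where "w x = fact n * (\<Prod>i<n. indicator (B (c i)) (x i) * Re (\<kappa> (x i) (x i)))" for x
  have zero: "(\<Prod>i<n. indicator (B (c i)) (x i) :: real) = 0" if x: "\<not> (\<forall>i<n. x i \<in> B (c i))" for x
  proof -
    obtain i where "i < n" "x i \<notin> B (c i)" using x by blast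
    then show ?thesis by (intro prod_zero bexI[of _ i]) auto
  qed
  have one: "(\<Prod>i<n. indicator (B (c i)) (x i) :: real) = 1" if "\<forall>i<n. x i \<in> B (c i)" for x
    using that by (intro prod.neutral) auto
  have s_Re: "s N = (\<lambda>x. Re ((\<Prod>i<n. indicator (B (c i)) (x i)) * ldet {..<n} (\<lambda>i j. truncated_kernel N (x i) (x j))))" for N
  proof
    fix x
    have "(\<Prod>i<n. indicator (B (c i)) (x i)) = complex_of_real (\<Prod>i<n. indicator (B (c i)) (x i))"
      unfolding of_real_prod by (intro prod.cong refl) (simp add: indicator_def)
    then show "s N x = Re ((\<Prod>i<n. indicator (B (c i)) (x i)) * ldet {..<n} (\<lambda>i j. truncated_kernel N (x i) (x j)))"
      by (simp add: s_def del: of_real_prod)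
  qed
  have s_int: "integrable ?P (s N)" and s_integral: "integral\<^sup>L ?P (s N) = Re (moment N n c)" for N
  proof -
    have trunc1: "integrable ?P (\<lambda>x. (\<Prod>i<n. indicator (B (c i)) (x i)) * ldet {..<n} (\<lambda>i j. truncated_kernel N (x i) (x j)))"
      using c by (rule integral_truncated_kernel(1))
    have trunc2: "(\<integral>x. (\<Prod>i<n. indicator (B (c i)) (x i)) * ldet {..<n} (\<lambda>i j. truncated_kernel N (x i) (x j)) \<partial>?P) = moment N n c"
      using c by (rule integral_truncated_kernel(2))
    show "integrable ?P (s N)"
      unfolding s_Re by (rule integrable_bounded_linear[OF bounded_linear_Re trunc1])
    show "integral\<^sup>L ?P (s N) = Re (moment N n c)"
      unfolding s_Re trunc2[symmetric] by (rule integral_bounded_linear[OF bounded_linear_Re trunc1])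
  qed
  have w_int: "integrable ?P w"
    unfolding w_def using c diag_int by (intro integrable_mult_right product_integrable_prod) auto
  have lim: "(\<lambda>N. s N x) \<longlonglongrightarrow> f x" for x
  proof (cases "\<forall>i<n. x i \<in> B (c i)")
    case True
    have tk: "(\<lambda>N. truncated_kernel N (x i) (x j)) \<longlonglongrightarrow> \<kappa> (x i) (x j)" if "i < n" "j < n" for i j
      using kernel[of "c i" "c j" "x i" "x j"] c True that by (simp add: truncated_kernel_def sums_def)
    have "(\<lambda>N. ldet {..<n} (\<lambda>i j. truncated_kernel N (x i) (x j))) \<longlonglongrightarrow> ldet {..<n} (\<lambda>i j. \<kappa> (x i) (x j))"
      unfolding ldet_def
    proof (intro tendsto_sum tendsto_mult tendsto_const tendsto_prod tk)
      fix p i assume "p \<in> {p. p permutes {..<n}}" "i \<in> {..<n}"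
      then show "i < n" "p i < n" using permutes_in_image[of p "{..<n}" i] by auto
    qed
    then show ?thesis unfolding s_def f_def by (intro tendsto_intros)
  next
    case False
    then show ?thesis by (simp only: s_def f_def zero[OF False] mult_zero_left tendsto_const)
  qed
  have bound: "norm (s N x) \<le> w x" for N x
  proof (cases "\<forall>i<n. x i \<in> B (c i)")
    case True
    have d: "0 \<le> Re (\<kappa> (x i) (x i))" if "i < n" for i
      using True c that by (intro diag_nonneg[of "c i"]) auto
    have "\<bar>Re (ldet {..<n} (\<lambda>i j. truncated_kernel N (x i) (x j)))\<bar> \<le> cmod (ldet {..<n} (\<lambda>i j. truncated_kernel N (x i) (x j)))"
      by (rule abs_Re_le_cmod)
    also have "\<dots> \<le> (\<Sum>p | p permutes {..<n}. \<Prod>i<n. cmod (truncated_kernel N (x i) (x (p i))))"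
      unfolding ldet_def
    proof (rule order.trans[OF norm_sum], rule sum_mono)
      fix p :: "nat \<Rightarrow> nat"
      have "cmod (of_int (sign p)) = 1" by (simp add: sign_def)
      then show "cmod (of_int (sign p) * (\<Prod>i<n. truncated_kernel N (x i) (x (p i))))
          \<le> (\<Prod>i<n. cmod (truncated_kernel N (x i) (x (p i))))"
        by (simp add: norm_mult prod_norm)
    qed
    also have "\<dots> \<le> (\<Sum>p | p permutes {..<n}. \<Prod>i<n. Re (\<kappa> (x i) (x i)))"
    proof (rule sum_mono)
      fix p assume "p \<in> {p. p permutes {..<n}}"
      then have p: "p permutes {..<n}" by simp
      then have pi: "p i < n" if "i < n" for i using permutes_in_image[OF p, of i] that by simp
      have "(\<Prod>i<n. cmod (truncated_kernel N (x i) (x (p i))))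
          \<le> (\<Prod>i<n. sqrt (Re (\<kappa> (x i) (x i))) * sqrt (Re (\<kappa> (x (p i)) (x (p i)))))"
      proof (rule prod_mono)
        fix i assume i: "i \<in> {..<n}"
        then show "0 \<le> cmod (truncated_kernel N (x i) (x (p i)))
            \<and> cmod (truncated_kernel N (x i) (x (p i))) \<le> sqrt (Re (\<kappa> (x i) (x i))) * sqrt (Re (\<kappa> (x (p i)) (x (p i))))"
          using True c pi[of i] by (intro conjI norm_ge_zero norm_truncated_kernel_le[of "c i" _ "c (p i)"]) auto
      qed
      also have "\<dots> = (\<Prod>i<n. sqrt (Re (\<kappa> (x i) (x i)))) * (\<Prod>i<n. sqrt (Re (\<kappa> (x i) (x i))))"
        unfolding prod.distrib prod.permute[OF p, of "\<lambda>i. sqrt (Re (\<kappa> (x i) (x i)))", unfolded o_def] ..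
      also have "\<dots> = (\<Prod>i<n. Re (\<kappa> (x i) (x i)))"
        unfolding prod.distrib[symmetric] using d by (intro prod.cong) auto
      finally show "(\<Prod>i<n. cmod (truncated_kernel N (x i) (x (p i)))) \<le> (\<Prod>i<n. Re (\<kappa> (x i) (x i)))" .
    qed
    also have "\<dots> = fact n * (\<Prod>i<n. Re (\<kappa> (x i) (x i)))"
      by (simp add: card_permutations)
    finally show ?thesis
      unfolding s_def w_def prod.distrib one[OF True] by simp
  next
    case False
    then show ?thesis unfolding s_def w_def prod.distrib zero[OF False] by simp
  qed
  have s_meas: "s N \<in> borel_measurable ?P" for N using s_int by (rule borel_measurable_integrable)
  have f_meas: "f \<in> borel_measurable ?P"
    by (rule borel_measurable_LIMSEQ_metric[OF s_meas lim])
  show "integrable ?P (\<lambda>x. (\<Prod>i<n. indicator (B (c i)) (x i)) * Re (ldet {..<n} (\<lambda>i j. \<kappa> (x i) (x j))))"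
    unfolding f_def[symmetric]
    by (rule integrable_dominated_convergence[where s = s, OF f_meas s_meas w_int]) (use lim bound in auto)
  have "(\<lambda>N. integral\<^sup>L ?P (s N)) \<longlonglongrightarrow> integral\<^sup>L ?P f"
    by (rule integral_dominated_convergence[where s = s, OF f_meas s_meas w_int]) (use lim bound in auto)
  then show "(\<lambda>N. Re (moment N n c)) \<longlonglongrightarrow> kernel_moment n c"
    unfolding s_integral kernel_moment_def f_def[abs_def] .
qed

lemma kernel_moment_nonneg:
  assumes "\<And>i. i < n \<Longrightarrow> c i < m"
  shows "0 \<le> kernel_moment n c"
  by (rule LIMSEQ_le_const[OF kernel_moment_limit(2)[OF assms]]) (use moment_nonneg[OF assms] in auto)

section \<open>The Fredholm series and its limit\<close>

text \<open>Multiplying out the sums over \<open>b\<close> row by row attaches a class to each row.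
  This identifies the moment sums with the terms of the Fredholm series.\<close>

lemma sum_moment:
  fixes t :: "nat \<Rightarrow> complex"
  shows "(\<Sum>c\<in>{..<n} \<rightarrow>\<^sub>E {..<m}. (\<Prod>j<n. t (c j)) * moment N n c)
    = (\<Sum>k\<in>{..<n} \<rightarrow>\<^sub>E {..<N}. ldet {..<n} (\<lambda>i j. \<Sum>b<m. t b * A b (k i) (k j)))"
proof -
  have "(\<Sum>k\<in>{..<n} \<rightarrow>\<^sub>E {..<N}. ldet {..<n} (\<lambda>i j. \<Sum>b<m. t b * A b (k i) (k j)))
      = (\<Sum>k\<in>{..<n} \<rightarrow>\<^sub>E {..<N}. \<Sum>p | p permutes {..<n}. \<Sum>c\<in>{..<n} \<rightarrow>\<^sub>E {..<m}.
          of_int (sign p) * (\<Prod>i<n. t (c i) * A (c i) (k i) (k (p i))))"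
    unfolding ldet_def by (subst prod_sum_PiE) (simp_all add: sum_distrib_left)
  also have "\<dots> = (\<Sum>k\<in>{..<n} \<rightarrow>\<^sub>E {..<N}. \<Sum>c\<in>{..<n} \<rightarrow>\<^sub>E {..<m}. (\<Prod>j<n. t (c j)) * ldet {..<n} (\<lambda>i j. A (c i) (k i) (k j)))"
  proof (rule sum.cong[OF refl])
    fix k
    show "(\<Sum>p | p permutes {..<n}. \<Sum>c\<in>{..<n} \<rightarrow>\<^sub>E {..<m}. of_int (sign p) * (\<Prod>i<n. t (c i) * A (c i) (k i) (k (p i))))
        = (\<Sum>c\<in>{..<n} \<rightarrow>\<^sub>E {..<m}. (\<Prod>j<n. t (c j)) * ldet {..<n} (\<lambda>i j. A (c i) (k i) (k j)))"
      unfolding ldet_def sum_distrib_left by (subst sum.swap) (simp only: prod.distrib mult_ac)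
  qed
  also have "\<dots> = (\<Sum>c\<in>{..<n} \<rightarrow>\<^sub>E {..<m}. (\<Prod>j<n. t (c j)) * moment N n c)"
    unfolding moment_def sum_distrib_left by (rule sum.swap)
  finally show ?thesis by simp
qed

text \<open>All sets together have the diagonal Gram matrix diag(l). The determinant for a tuple
  \<open>k\<close> is then the product of the \<open>l (k i)\<close> if \<open>k\<close> is
  injective and 0 otherwise; bounding both cases by the product yields a power of the sum.\<close>

lemma sum_moment_le:
  "(\<Sum>c\<in>{..<n} \<rightarrow>\<^sub>E {..<m}. Re (moment N n c)) \<le> (\<Sum>k<N. l k) ^ n"
proof -
  have diag: "(\<Sum>b<m. A b j k) = (if j = k then of_real (l j) else 0)" for j k
    using gram[of j k] by (simp add: A_def)
  have det_le: "Re (ldet {..<n} (\<lambda>i j. if k i = k j then of_real (l (k i)) else (0::complex))) \<le> (\<Prod>i<n. l (k i))" for k :: "nat \<Rightarrow> nat"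
  proof (cases "inj_on k {..<n}")
    case True
    have zero: "(\<Prod>i<n. if k i = k (p i) then of_real (l (k i)) else (0::complex)) = 0" if p: "p permutes {..<n}" "p \<noteq> id" for p
    proof -
      obtain i where "p i \<noteq> i" using p(2) by (auto simp: fun_eq_iff)
      then have i: "i < n" "p i < n"
        using permutes_not_in[OF p(1), of i] permutes_in_image[OF p(1), of i] by auto
      then have "k i \<noteq> k (p i)" using True \<open>p i \<noteq> i\<close> by (auto dest: inj_onD)
      then show ?thesis using i by (intro prod_zero bexI[of _ i]) auto
    qed
    have "ldet {..<n} (\<lambda>i j. if k i = k j then of_real (l (k i)) else (0::complex)) = (\<Sum>p\<in>{id :: nat \<Rightarrow> nat}. of_real (\<Prod>i<n. l (k i)))"
      unfolding ldet_def
      by (rule sum.mono_neutral_cong_right) (auto simp: zero permutes_id finite_permutations)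
    then show ?thesis by (simp del: of_real_prod)
  next
    case False
    then obtain i j where "i < n" "j < n" "i \<noteq> j" "k i = k j" by (auto simp: inj_on_def)
    then have "ldet {..<n} (\<lambda>i j. if k i = k j then of_real (l (k i)) else (0::complex)) = 0"
      by (intro ldet_identical_rows[of i n j]) auto
    then show ?thesis by (simp add: prod_nonneg l_nonneg)
  qed
  have "(\<Sum>c\<in>{..<n} \<rightarrow>\<^sub>E {..<m}. Re (moment N n c)) = (\<Sum>k\<in>{..<n} \<rightarrow>\<^sub>E {..<N}. Re (ldet {..<n} (\<lambda>i j. if k i = k j then of_real (l (k i)) else 0)))"
    using arg_cong[OF sum_moment[where t = "\<lambda>_. 1" and n = n and N = N], of Re] by (simp add: diag)
  also have "\<dots> \<le> (\<Sum>k\<in>{..<n} \<rightarrow>\<^sub>E {..<N}. \<Prod>i<n. l (k i))"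
    by (intro sum_mono det_le)
  also have "\<dots> = (\<Sum>k<N. l k) ^ n"
    using prod_sum_PiE[of "{..<n}" "\<lambda>_. {..<N}" "\<lambda>_. l"] by simp
  finally show ?thesis .
qed

lemma trace_le:
  assumes "b < m"
  shows "(\<Sum>k<N. Re (A b k k)) \<le> (\<integral>x. indicator (B b) x * Re (\<kappa> x x) \<partial>M)"
proof -
  have "(\<Sum>k<N. Re (A b k k)) = (\<integral>x. (\<Sum>k<N. indicator (B b) x * (cmod (\<psi> k x))\<^sup>2) \<partial>M)
      \<and> integrable M (\<lambda>x. \<Sum>k<N. indicator (B b) x * (cmod (\<psi> k x))\<^sup>2)"
  proof -
    have eq: "indicator (B b) x * (\<psi> k x * cnj (\<psi> k x)) = complex_of_real (indicator (B b) x * (cmod (\<psi> k x))\<^sup>2)" for k x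
      unfolding complex_norm_square[symmetric] by (simp add: indicator_def)
    have "integrable M (\<lambda>x. indicator (B b) x * (cmod (\<psi> k x))\<^sup>2)" for k
      using integrable_indicator_product[OF assms, of k k]
      unfolding eq by (simp only: complex_of_real_integrable_eq)
    then show ?thesis
      unfolding A_def eq
      by (intro conjI Bochner_Integration.integrable_sum, subst Bochner_Integration.integral_sum)
        (simp_all only: integral_complex_of_real Re_complex_of_real)
  qed
  moreover have "(\<integral>x. (\<Sum>k<N. indicator (B b) x * (cmod (\<psi> k x))\<^sup>2) \<partial>M) \<le> (\<integral>x. indicator (B b) x * Re (\<kappa> x x) \<partial>M)"
  proof (rule integral_mono)
    show "(\<Sum>k<N. indicator (B b) x * (cmod (\<psi> k x))\<^sup>2) \<le> indicator (B b) x * Re (\<kappa> x x)" for x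
      using sum_diag_le[OF assms, of x N] by (auto simp: indicator_def)
  qed (use calculation diag_int[OF assms] in auto)
  ultimately show ?thesis by simp
qed

text \<open>The trace of the full kernel over all the sets. It bounds the traces of all truncations
  and thus gives moment bounds that do not depend on \<open>N\<close>.\<close>

definition trace_bound :: real where
  "trace_bound = (\<Sum>b<m. \<integral>x. indicator (B b) x * Re (\<kappa> x x) \<partial>M)"

lemma sum_l_le: "(\<Sum>k<N. l k) \<le> trace_bound"
proof -
  have "(\<Sum>k<N. l k) = (\<Sum>k<N. Re (\<Sum>b<m. A b k k))"
    using gram by (simp add: A_def)
  also have "\<dots> = (\<Sum>b<m. \<Sum>k<N. Re (A b k k))"
    unfolding Re_sum by (rule sum.swap)
  also have "\<dots> \<le> trace_bound"
    unfolding trace_bound_def by (intro sum_mono trace_le) auto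
  finally show ?thesis .
qed

lemma sum_moment_le_trace_bound: "(\<Sum>c\<in>{..<n} \<rightarrow>\<^sub>E {..<m}. Re (moment N n c)) \<le> trace_bound ^ n"
  using sum_moment_le power_mono[OF sum_l_le] by (meson order.trans sum_nonneg l_nonneg)

lemma sum_kernel_moment_le: "(\<Sum>c\<in>{..<n} \<rightarrow>\<^sub>E {..<m}. kernel_moment n c) \<le> trace_bound ^ n"
proof (rule LIMSEQ_le_const2)
  show "(\<lambda>N. \<Sum>c\<in>{..<n} \<rightarrow>\<^sub>E {..<m}. Re (moment N n c)) \<longlonglongrightarrow> (\<Sum>c\<in>{..<n} \<rightarrow>\<^sub>E {..<m}. kernel_moment n c)"
  proof (intro tendsto_sum kernel_moment_limit(2))
    fix c :: "nat \<Rightarrow> nat" and i assume "c \<in> {..<n} \<rightarrow>\<^sub>E {..<m}" "i < n"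
    then show "c i < m" using PiE_mem[of c "{..<n}" "\<lambda>_. {..<m}" i] by simp
  qed
qed (use sum_moment_le_trace_bound in auto)

text \<open>Tannery's theorem: the terms of the Fredholm series converge as \<open>N\<close> grows
  and are dominated, uniformly in \<open>N\<close>, by those of the exponential series at
  \<open>trace_bound\<close>.\<close>

lemma ldet_limit:
  fixes t :: "nat \<Rightarrow> real"
  assumes t: "\<And>b. b < m \<Longrightarrow> \<bar>t b\<bar> \<le> 1"
  shows "(\<lambda>N. Re (ldet {..<N} (\<lambda>i j. (if i = j then 1 else 0) + (\<Sum>b<m. of_real (t b) * A b i j))))
    \<longlonglongrightarrow> (\<Sum>n. (\<Sum>c\<in>{..<n} \<rightarrow>\<^sub>E {..<m}. (\<Prod>j<n. t (c j)) * kernel_moment n c) / fact n)"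
proof -
  define a where "a n N = (\<Sum>c\<in>{..<n} \<rightarrow>\<^sub>E {..<m}. (\<Prod>j<n. t (c j)) * Re (moment N n c)) / fact n" for n N
  define a' where "a' n = (\<Sum>c\<in>{..<n} \<rightarrow>\<^sub>E {..<m}. (\<Prod>j<n. t (c j)) * kernel_moment n c) / fact n" for n
  have c_less: "c i < m" if "c \<in> {..<n} \<rightarrow>\<^sub>E {..<m}" "i < n" for c :: "nat \<Rightarrow> nat" and n i
    using PiE_mem[OF that(1), of i] that(2) by simp
  have lim: "(\<lambda>N. a n N) \<longlonglongrightarrow> a' n" for n
    unfolding a_def a'_def
  proof (intro tendsto_divide tendsto_sum tendsto_mult tendsto_const)
    fix c :: "nat \<Rightarrow> nat" assume "c \<in> {..<n} \<rightarrow>\<^sub>E {..<m}"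
    then show "(\<lambda>N. Re (moment N n c)) \<longlonglongrightarrow> kernel_moment n c"
      using c_less by (intro kernel_moment_limit(2))
  qed simp
  have bound: "norm (a n N) \<le> inverse (fact n) * trace_bound ^ n" for n N
  proof -
    have "\<bar>(\<Prod>j<n. t (c j)) * Re (moment N n c)\<bar> \<le> Re (moment N n c)" if c: "c \<in> {..<n} \<rightarrow>\<^sub>E {..<m}" for c
    proof -
      have "\<bar>\<Prod>j<n. t (c j)\<bar> \<le> 1"
        unfolding abs_prod using t c_less[OF c] by (intro prod_le_1) auto
      then have "\<bar>\<Prod>j<n. t (c j)\<bar> * Re (moment N n c) \<le> 1 * Re (moment N n c)"
        using moment_nonneg[of n c N] c_less[OF c] by (intro mult_right_mono) auto
      then show ?thesis using moment_nonneg[of n c N] c_less[OF c] by (simp add: abs_mult)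
    qed
    then have "\<bar>\<Sum>c\<in>{..<n} \<rightarrow>\<^sub>E {..<m}. (\<Prod>j<n. t (c j)) * Re (moment N n c)\<bar> \<le> (\<Sum>c\<in>{..<n} \<rightarrow>\<^sub>E {..<m}. Re (moment N n c))"
      by (intro order.trans[OF sum_abs] sum_mono) auto
    also have "\<dots> \<le> trace_bound ^ n" by (rule sum_moment_le_trace_bound)
    finally show ?thesis by (simp add: a_def field_simps)
  qed
  have series: "(\<lambda>n. a n N) sums Re (ldet {..<N} (\<lambda>i j. (if i = j then 1 else 0) + (\<Sum>b<m. of_real (t b) * A b i j)))" for N
  proof -
    have "a n N = Re ((\<Sum>k\<in>{..<n} \<rightarrow>\<^sub>E {..<N}. ldet {..<n} (\<lambda>i j. \<Sum>b<m. of_real (t b) * A b (k i) (k j))) / fact n)" for n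
    proof -
      have "Re ((\<Sum>c\<in>{..<n} \<rightarrow>\<^sub>E {..<m}. (\<Prod>j<n. of_real (t (c j))) * moment N n c) / of_real (fact n)) = a n N"
        unfolding a_def Re_divide_of_real of_real_prod[symmetric] by (simp del: of_real_prod)
      then show ?thesis using sum_moment[where t = "\<lambda>b. of_real (t b)" and n = n and N = N] by simp
    qed
    then show ?thesis using sums_Re[OF ldet_add_identity_series] by simp
  qed
  have "eventually (\<lambda>(n, N). norm (a n N) \<le> inverse (fact n) * trace_bound ^ n) (sequentially \<times>\<^sub>F sequentially)"
    using bound by (intro always_eventually) auto
  from tannerys_theorem[OF lim this summable_exp sequentially_bot]
  have "(\<lambda>N. \<Sum>n. a n N) \<longlonglongrightarrow> suminf a'" by blast
  then show ?thesis unfolding a'_def[symmetric] using series by (simp add: sums_iff)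
qed

end

section \<open>Radon measures and spectral decompositions\<close>

lemma relatively_compact_subset:
  "relatively_compact B \<Longrightarrow> A \<subseteq> B \<Longrightarrow> relatively_compact A" for A B :: "'a::t2_space set"
  unfolding relatively_compact_def
  by (metis closed_closure closure_mono compact_Int_closed inf.absorb_iff2)

lemma relatively_compact_UN:
  "finite I \<Longrightarrow> (\<And>i. i \<in> I \<Longrightarrow> relatively_compact (B i)) \<Longrightarrow> relatively_compact (\<Union>i\<in>I. B i)"
  by (induction I rule: finite_induct) (auto simp: relatively_compact_def)

text \<open>Open sets contained in compact sets have finite measure and cover the space; the
  Lindelof property selects countably many of them.\<close>

lemma radon_measure_sigma_finite:
  fixes M :: "'a::{second_countable_topology, t2_space} measure"
  assumes lc: "locally_compact_space (euclidean :: 'a topology)" and M: "radon_measure M"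
  shows "sigma_finite_measure M"
proof -
  have sets: "sets M = sets borel" using M by (simp add: radon_measure_def)
  define \<U> where "\<U> = {U :: 'a set. open U \<and> (\<exists>C. compact C \<and> U \<subseteq> C)}"
  obtain \<V> where \<V>: "\<V> \<subseteq> \<U>" "countable \<V>" "\<Union>\<V> = \<Union>\<U>"
    using Lindelof[of \<U>] by (auto simp: \<U>_def)
  have "\<Union>\<U> = UNIV"
    using lc unfolding locally_compact_space_def \<U>_def by (auto simp: compactin_euclidean_iff) blast
  moreover have "emeasure M U \<noteq> \<infinity>" if U: "U \<in> \<V>" for U
  proof -
    obtain C where C: "compact C" "U \<subseteq> C" using U \<V>(1) unfolding \<U>_def by blast
    then have "emeasure M U \<le> emeasure M C"
      by (intro emeasure_mono) (auto simp: sets compact_imp_closed)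
    also have "\<dots> < \<infinity>" using M C by (simp add: radon_measure_def)
    finally show ?thesis by simp
  qed
  moreover have "\<V> \<subseteq> sets M" using \<V> by (auto simp: sets \<U>_def)
  moreover have "space M = UNIV" using sets_eq_imp_space_eq[OF sets] by simp
  ultimately show ?thesis using \<V> by (intro sigma_finite_measure.intro exI[of _ \<V>]) auto
qed

text \<open>A measure with integer values on all Borel subsets of \<open>B\<close> has no diffuse
  part there. Around a point that is not an atom, small balls have mass below 1, hence 0; countably
  many of the resulting null neighbourhoods cover the complement of the atoms.\<close>

lemma emeasure_eq_card_atoms:
  fixes \<mu> :: "'a::{second_countable_topology, metric_space} measure"
  assumes sets: "sets \<mu> = sets borel" and B: "B \<in> sets borel"
    and int: "\<And>A. A \<in> sets borel \<Longrightarrow> A \<subseteq> B \<Longrightarrow> \<exists>n::nat. emeasure \<mu> A = of_nat n"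
    and simple: "\<And>x. emeasure \<mu> {x} \<le> 1"
  shows "finite {x \<in> B. emeasure \<mu> {x} \<noteq> 0}"
    and "emeasure \<mu> B = of_nat (card {x \<in> B. emeasure \<mu> {x} \<noteq> 0})"
proof -
  let ?S = "{x \<in> B. emeasure \<mu> {x} \<noteq> 0}"
  have one: "emeasure \<mu> {x} = 1" if x: "x \<in> ?S" for x
  proof -
    obtain n :: nat where n: "emeasure \<mu> {x} = of_nat n" using int[of "{x}"] x by auto
    then have "n \<noteq> 0" "n \<le> 1" using x simple[of x] by auto
    then show ?thesis using n by simp
  qed
  have card: "emeasure \<mu> T = of_nat (card T)" if "finite T" "T \<subseteq> ?S" for T
  proof -
    have "emeasure \<mu> T = (\<Sum>x\<in>T. emeasure \<mu> {x})"
      using that by (intro emeasure_eq_sum_singleton) (auto simp: sets)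
    also have "\<dots> = (\<Sum>x\<in>T. 1)" using one that by (intro sum.cong) auto
    finally show ?thesis by simp
  qed
  obtain n :: nat where n: "emeasure \<mu> B = of_nat n" using int[OF B] by auto
  have "card T \<le> n" if "finite T" "T \<subseteq> ?S" for T
  proof -
    have "of_nat (card T) \<le> emeasure \<mu> B"
      unfolding card[OF that, symmetric] using that B by (intro emeasure_mono) (auto simp: sets)
    then show ?thesis by (simp add: n)
  qed
  then show fin: "finite ?S"
    using finite_if_finite_subsets_card_bdd[of ?S n] by blast
  let ?N = "B - ?S"
  have N: "?N \<in> sets borel" using B fin by (auto intro: borel_closed finite_imp_closed)
  have null: "\<exists>U. open U \<and> x \<in> U \<and> emeasure \<mu> (U \<inter> ?N) = 0" if x: "x \<in> ?N" for x
  proof -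
    define D where "D i = ball x (1 / real (Suc i)) \<inter> ?N" for i
    have D: "D i \<in> sets borel" for i using N by (auto simp: D_def)
    have "(\<lambda>i. emeasure \<mu> (D i)) \<longlonglongrightarrow> emeasure \<mu> (\<Inter>i. D i)"
    proof (rule Lim_emeasure_decseq)
      show "range D \<subseteq> sets \<mu>" using D by (auto simp: sets)
      show "decseq D"
        unfolding D_def decseq_def by (intro allI impI Int_mono subset_ball) (auto simp: frac_le)
      show "emeasure \<mu> (D i) \<noteq> \<infinity>" for i
      proof -
        have "D i \<subseteq> B" by (auto simp: D_def)
        then show ?thesis using int[OF D[of i]] by auto
      qed
    qed
    moreover have "(\<Inter>i. D i) \<subseteq> {x}"
    proof
      fix y assume "y \<in> (\<Inter>i. D i)"
      then have "dist x y < 1 / real (Suc i)" for i by (auto simp: D_def)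
      then have "\<not> 0 < dist x y" by (metis nat_approx_posE not_less_iff_gr_or_eq)
      then show "y \<in> {x}" by simp
    qed
    then have "emeasure \<mu> (\<Inter>i. D i) \<le> emeasure \<mu> {x}"
      by (intro emeasure_mono) (auto simp: sets)
    then have "emeasure \<mu> (\<Inter>i. D i) = 0" using x by auto
    ultimately have "\<forall>\<^sub>F i in sequentially. emeasure \<mu> (D i) < 1"
      by (intro order_tendstoD(2)) auto
    then obtain i where i: "emeasure \<mu> (D i) < 1" by (auto simp: eventually_sequentially)
    have "D i \<subseteq> B" by (auto simp: D_def)
    then obtain k :: nat where "emeasure \<mu> (D i) = of_nat k" using int[OF D[of i]] by auto
    then have "emeasure \<mu> (D i) = 0" using i by simp
    then show ?thesis
      by (intro exI[of _ "ball x (1 / real (Suc i))"]) (auto simp: D_def)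
  qed
  define \<U> where "\<U> = {U. open U \<and> emeasure \<mu> (U \<inter> ?N) = 0}"
  obtain \<V> where \<V>: "\<V> \<subseteq> \<U>" "countable \<V>" "\<Union>\<V> = \<Union>\<U>"
    using Lindelof[of \<U>] by (auto simp: \<U>_def)
  have "(\<Union>U\<in>\<V>. U \<inter> ?N) \<in> null_sets \<mu>"
    using \<V> N by (intro null_sets_UN') (auto simp: \<U>_def null_sets_def sets)
  moreover have "(\<Union>U\<in>\<V>. U \<inter> ?N) = ?N"
  proof -
    have "?N \<subseteq> \<Union>\<U>" using null by (fastforce simp: \<U>_def)
    then show ?thesis using \<V>(3) by auto
  qed
  ultimately have N0: "emeasure \<mu> ?N = 0" by (simp only: null_setsD1)
  have "emeasure \<mu> B = emeasure \<mu> (?S \<union> ?N)" by (rule arg_cong[where f = "emeasure \<mu>"]) auto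
  also have "\<dots> = emeasure \<mu> ?S + emeasure \<mu> ?N"
    using N fin by (intro plus_emeasure[symmetric]) (auto simp: sets intro: borel_closed finite_imp_closed)
  finally show "emeasure \<mu> B = of_nat (card ?S)" using card[OF fin] N0 by simp
qed

section \<open>Square-integrable functions and the spectrum of a compression\<close>

lemma L2_space_mult_indicator:
  assumes "f \<in> L2_space M" "U \<in> sets M"
  shows "(\<lambda>x. indicator U x * f x) \<in> L2_space M"
proof -
  have "integrable M (\<lambda>x. indicator U x *\<^sub>R (cmod (f x))\<^sup>2)"
    using assms by (intro integrable_mult_indicator) (auto simp: L2_space_def)
  moreover have "indicator U x *\<^sub>R (cmod (f x))\<^sup>2 = (cmod (indicator U x * f x))\<^sup>2" for x
    by (simp add: indicator_def)
  ultimately show ?thesis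
    using assms by (auto simp: L2_space_def)
qed

lemma L2_inner_integrable:
  assumes "f \<in> L2_space M" "g \<in> L2_space M"
  shows "integrable M (\<lambda>x. f x * cnj (g x))"
proof (rule Bochner_Integration.integrable_bound)
  show "integrable M (\<lambda>x. (cmod (f x))\<^sup>2 + (cmod (g x))\<^sup>2)"
    using assms by (auto simp: L2_space_def)
  have "(\<lambda>x. cnj (g x)) \<in> borel_measurable M"
    using measurable_compose[OF _ borel_measurable_continuous_onI[of cnj], of g M] assms
    by (auto simp: L2_space_def intro: continuous_intros)
  then show "(\<lambda>x. f x * cnj (g x)) \<in> borel_measurable M"
    using assms by (auto simp: L2_space_def)
  have "cmod (f x) * cmod (g x) \<le> (cmod (f x))\<^sup>2 + (cmod (g x))\<^sup>2" for x
    using sum_squares_bound[of "cmod (f x)" "cmod (g x)"]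
      mult_nonneg_nonneg[OF norm_ge_zero[of "f x"] norm_ge_zero[of "g x"]] by linarith
  then show "AE x in M. norm (f x * cnj (g x)) \<le> norm ((cmod (f x))\<^sup>2 + (cmod (g x))\<^sup>2)"
    by (simp add: norm_mult)
qed

lemma spectral_decomposition_eigenvector:
  assumes sd: "spectral_decomposition M T I l \<phi>" and k: "k \<in> I" and g: "g \<in> L2_space M"
  shows "L2_inner M (T (\<phi> k)) g = of_real (l k) * L2_inner M (\<phi> k) g"
proof -
  have "((\<lambda>j. complex_of_real (l j) * L2_inner M (\<phi> k) (\<phi> j) * L2_inner M (\<phi> j) g) has_sum L2_inner M (T (\<phi> k)) g) I"
    using sd k g unfolding spectral_decomposition_def by blast
  moreover have "L2_inner M (\<phi> k) (\<phi> j) = (if k = j then 1 else 0)" if "j \<in> I" for j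
    using sd k that unfolding spectral_decomposition_def by blast
  then have "((\<lambda>j. complex_of_real (l j) * L2_inner M (\<phi> k) (\<phi> j) * L2_inner M (\<phi> j) g) has_sum L2_inner M (T (\<phi> k)) g) I
      \<longleftrightarrow> ((\<lambda>j. complex_of_real (l k) * L2_inner M (\<phi> k) g) has_sum L2_inner M (T (\<phi> k)) g) {k}"
    using k by (intro has_sum_cong_neutral) auto
  ultimately have "((\<lambda>j. complex_of_real (l k) * L2_inner M (\<phi> k) g) has_sum L2_inner M (T (\<phi> k)) g) {k}" by blast
  then show ?thesis
    using has_sum_finite[of "{k}" "\<lambda>j. complex_of_real (l k) * L2_inner M (\<phi> k) g"] has_sum_unique by fastforce
qed

text \<open>Testing the form of \<open>K\<close> at the cut-off h of an eigenfunction to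
  \<open>U\<close> gives 0 \<le> l_k = <Kh, h> \<le> <h, h> \<le> 1. The last claim says that the
  eigenfunctions, scaled by the roots of the eigenvalues, stay orthogonal when integrated over
  \<open>U\<close> only.\<close>

lemma positive_contraction_compression_spectrum:
  assumes K: "positive_contraction M K" and U: "U \<in> sets M"
    and sd: "spectral_decomposition M (compression U K) I l \<phi>"
  shows "k \<in> I \<Longrightarrow> 0 \<le> l k" and "k \<in> I \<Longrightarrow> l k \<le> 1"
    and "j \<in> I \<Longrightarrow> k \<in> I \<Longrightarrow> complex_of_real (sqrt (l j)) * of_real (sqrt (l k)) * (\<integral>x. indicator U x * (\<phi> j x * cnj (\<phi> k x)) \<partial>M)
        = (if j = k then of_real (l j) else 0)"
proof -
  have \<phi>: "\<phi> k \<in> L2_space M" if "k \<in> I" for k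
    using sd that unfolding spectral_decomposition_def by blast
  have ortho: "L2_inner M (\<phi> j) (\<phi> k) = (if j = k then 1 else 0)" if "j \<in> I" "k \<in> I" for j k
    using sd that unfolding spectral_decomposition_def by blast
  have K_L2: "K f \<in> L2_space M" if "f \<in> L2_space M" for f
    using K that unfolding positive_contraction_def L2_positive_def L2_selfadjoint_def L2_operator_def by blast
  have bounds: "0 \<le> l k \<and> l k \<le> 1" if k: "k \<in> I" for k
  proof -
    define h where "h = (\<lambda>x. indicator U x * \<phi> k x)"
    have h: "h \<in> L2_space M" unfolding h_def using \<phi>[OF k] U by (rule L2_space_mult_indicator)
    have "L2_inner M (compression U K (\<phi> k)) (\<phi> k) = L2_inner M (K h) h"
      unfolding L2_inner_def compression_def h_def
      by (intro Bochner_Integration.integral_cong refl) (simp add: indicator_def)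
    then have Kh: "L2_inner M (K h) h = of_real (l k)"
      using spectral_decomposition_eigenvector[OF sd k \<phi>[OF k]] ortho[OF k k] by simp
    have "0 \<le> Re (L2_inner M (K h) h)"
      using K h unfolding positive_contraction_def L2_positive_def by blast
    moreover have "0 \<le> Re (L2_inner M (\<lambda>x. h x - K h x) h)"
      using K h unfolding positive_contraction_def L2_positive_def by blast
    moreover have "L2_inner M (\<lambda>x. h x - K h x) h = L2_inner M h h - L2_inner M (K h) h"
      unfolding L2_inner_def left_diff_distrib
      using L2_inner_integrable[OF h h] L2_inner_integrable[OF K_L2[OF h] h]
      by (rule Bochner_Integration.integral_diff)
    moreover have "Re (L2_inner M h h) \<le> Re (L2_inner M (\<phi> k) (\<phi> k))"
    proof -
      have sq: "z * cnj z = complex_of_real ((cmod z)\<^sup>2)" for z by (rule complex_norm_square[symmetric])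
      have "(\<integral>x. (cmod (h x))\<^sup>2 \<partial>M) \<le> (\<integral>x. (cmod (\<phi> k x))\<^sup>2 \<partial>M)"
        using h \<phi>[OF k] by (intro integral_mono) (auto simp: L2_space_def h_def indicator_def)
      then show ?thesis
        unfolding L2_inner_def sq integral_complex_of_real Re_complex_of_real .
    qed
    ultimately show ?thesis using Kh ortho[OF k k] by simp
  qed
  show "k \<in> I \<Longrightarrow> 0 \<le> l k" "k \<in> I \<Longrightarrow> l k \<le> 1" using bounds by auto
  assume j: "j \<in> I" and k: "k \<in> I"
  show "complex_of_real (sqrt (l j)) * of_real (sqrt (l k)) * (\<integral>x. indicator U x * (\<phi> j x * cnj (\<phi> k x)) \<partial>M)
        = (if j = k then of_real (l j) else 0)"
  \<comment> \<open>An eigenfunction with nonzero eigenvalue is orthogonal to every function living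
    off \<open>U\<close>, so restricting the integral to \<open>U\<close> loses nothing. For
    eigenvalue 0 the scaling factor removes the term.\<close>
  proof (cases "l j = 0")
    case True
    then show ?thesis by (cases "j = k") simp_all
  next
    case False
    define g where "g = (\<lambda>x. indicator (space M - U) x * \<phi> k x)"
    have g: "g \<in> L2_space M" unfolding g_def using \<phi>[OF k] U by (intro L2_space_mult_indicator) auto
    have "L2_inner M (compression U K (\<phi> j)) g = 0"
      unfolding L2_inner_def compression_def g_def
      by (rule integral_eq_zero_AE) (auto simp: indicator_def)
    then have "L2_inner M (\<phi> j) g = 0"
      using spectral_decomposition_eigenvector[OF sd j g] False by simp
    moreover have "L2_inner M (\<phi> j) (\<phi> k) = (\<integral>x. indicator U x * (\<phi> j x * cnj (\<phi> k x)) \<partial>M) + L2_inner M (\<phi> j) g"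
    proof -
      have "L2_inner M (\<phi> j) (\<phi> k) = (\<integral>x. \<phi> j x * cnj (indicator U x * \<phi> k x) + \<phi> j x * cnj (g x) \<partial>M)"
        unfolding L2_inner_def g_def by (intro Bochner_Integration.integral_cong refl) (auto simp: indicator_def)
      also have "\<dots> = (\<integral>x. \<phi> j x * cnj (indicator U x * \<phi> k x) \<partial>M) + L2_inner M (\<phi> j) g"
        unfolding L2_inner_def
        by (intro Bochner_Integration.integral_add L2_inner_integrable \<phi> j g L2_space_mult_indicator k U)
      also have "(\<integral>x. \<phi> j x * cnj (indicator U x * \<phi> k x) \<partial>M) = (\<integral>x. indicator U x * (\<phi> j x * cnj (\<phi> k x)) \<partial>M)"
        by (intro Bochner_Integration.integral_cong refl) (auto simp: indicator_def)
      finally show ?thesis .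
    qed
    ultimately have "(\<integral>x. indicator U x * (\<phi> j x * cnj (\<phi> k x)) \<partial>M) = (if j = k then 1 else 0)"
      using ortho[OF j k] by simp
    moreover have "complex_of_real (sqrt (l j)) * of_real (sqrt (l j)) = of_real (l j)"
      using bounds[OF j] by (simp flip: of_real_mult)
    ultimately show ?thesis by (cases "j = k") simp_all
  qed
qed

section \<open>Expectations from point probabilities and the passage to the limit\<close>

lemma integral_box_part:
  fixes X :: "nat \<Rightarrow> 'w \<Rightarrow> nat"
  assumes "prob_space P" and X: "\<And>i. i < m \<Longrightarrow> X i \<in> measurable P (count_space UNIV)"
  shows "(\<integral>\<omega>. box_part m R F (\<lambda>i. X i \<omega>) \<partial>P)
    = (\<Sum>k\<in>{..<m} \<rightarrow>\<^sub>E {..R}. F (\<lambda>i. if i < m then k i else 0) * (\<integral>\<omega>. (\<Prod>i<m. of_bool (X i \<omega> = k i)) \<partial>P))"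
    and "integrable P (\<lambda>\<omega>. box_part m R F (\<lambda>i. X i \<omega>))"
proof -
  interpret prob_space P by fact
  have int: "integrable P (\<lambda>\<omega>. \<Prod>i<m. of_bool (X i \<omega> = k i) :: real)" for k
  proof (rule integrable_const_bound[where B = 1])
    have eq: "(\<Prod>i<m. of_bool (X i \<omega> = k i) :: real) = (\<Prod>i<m. of_bool ((if i < m then X i \<omega> else 0) = k i))" for \<omega>
      by (rule prod.cong) simp_all
    show "(\<lambda>\<omega>. \<Prod>i<m. of_bool (X i \<omega> = k i) :: real) \<in> borel_measurable P"
      unfolding eq using borel_measurable_nat_vector[OF X, where G = "\<lambda>u. \<Prod>i<m. of_bool (u i = k i) :: real" and a = "\<lambda>_. 0"] .
    show "AE \<omega> in P. norm (\<Prod>i<m. of_bool (X i \<omega> = k i) :: real) \<le> 1"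
      by (intro AE_I2) (simp add: abs_prod prod_le_1)
  qed
  show "(\<integral>\<omega>. box_part m R F (\<lambda>i. X i \<omega>) \<partial>P)
    = (\<Sum>k\<in>{..<m} \<rightarrow>\<^sub>E {..R}. F (\<lambda>i. if i < m then k i else 0) * (\<integral>\<omega>. (\<Prod>i<m. of_bool (X i \<omega> = k i)) \<partial>P))"
    unfolding box_part_def using int by (subst Bochner_Integration.integral_sum) auto
  show "integrable P (\<lambda>\<omega>. box_part m R F (\<lambda>i. X i \<omega>))"
    unfolding box_part_def using int by auto
qed

lemma box_part_nonneg: "(\<And>u. 0 \<le> F u) \<Longrightarrow> 0 \<le> box_part m R F u"
  by (simp add: box_part_eq)

text \<open>Box parts have equal expectations because they involve finitely many point
  probabilities, and they increase to the full function. Applied in both directions, the inequality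
  shows that the expectations coincide.\<close>

lemma nn_integral_le_of_point_probabilities:
  fixes X :: "nat \<Rightarrow> 'w \<Rightarrow> nat" and Y :: "nat \<Rightarrow> 'v \<Rightarrow> nat"
  assumes P: "prob_space P" and X: "\<And>i. i < m \<Longrightarrow> X i \<in> measurable P (count_space UNIV)"
    and Q: "prob_space Q" and Y: "\<And>i. i < m \<Longrightarrow> Y i \<in> measurable Q (count_space UNIV)"
    and eq: "\<And>k. (\<integral>\<omega>. (\<Prod>i<m. of_bool (X i \<omega> = k i) :: real) \<partial>P) = (\<integral>\<omega>. (\<Prod>i<m. of_bool (Y i \<omega> = k i)) \<partial>Q)"
    and F: "\<And>u. 0 \<le> F u"
  shows "(\<integral>\<^sup>+\<omega>. ennreal (F (\<lambda>i. if i < m then X i \<omega> else 0)) \<partial>P) \<le> (\<integral>\<^sup>+\<omega>. ennreal (F (\<lambda>i. if i < m then Y i \<omega> else 0)) \<partial>Q)"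
proof (rule nn_integral_le_box_part[OF X])
  fix R
  have "(\<integral>\<^sup>+\<omega>. ennreal (box_part m R F (\<lambda>i. X i \<omega>)) \<partial>P) = ennreal (\<integral>\<omega>. box_part m R F (\<lambda>i. X i \<omega>) \<partial>P)"
    using integral_box_part(2)[OF P X] F by (intro nn_integral_eq_integral AE_I2 box_part_nonneg) auto
  also have "\<dots> = ennreal (\<integral>\<omega>. box_part m R F (\<lambda>i. Y i \<omega>) \<partial>Q)"
    using integral_box_part(1)[OF P X, where R = R and F = F] integral_box_part(1)[OF Q Y, where R = R and F = F] eq by simp
  also have "\<dots> = (\<integral>\<^sup>+\<omega>. ennreal (box_part m R F (\<lambda>i. Y i \<omega>)) \<partial>Q)"
    using integral_box_part(2)[OF Q Y] F by (intro nn_integral_eq_integral[symmetric] AE_I2 box_part_nonneg) auto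
  also have "\<dots> \<le> (\<integral>\<^sup>+\<omega>. ennreal (F (\<lambda>i. if i < m then Y i \<omega> else 0)) \<partial>Q)"
    using F by (intro nn_integral_mono ennreal_leI) (simp add: box_part_eq)
  finally show "(\<integral>\<^sup>+\<omega>. ennreal (box_part m R F (\<lambda>i. X i \<omega>)) \<partial>P) \<le> (\<integral>\<^sup>+\<omega>. ennreal (F (\<lambda>i. if i < m then Y i \<omega> else 0)) \<partial>Q)" .
qed auto

lemma (in prob_space) nn_integral_independent_poisson:
  fixes Y :: "nat \<Rightarrow> 'a \<Rightarrow> nat"
  assumes indep: "indep_vars (\<lambda>_. count_space UNIV) Y {..<m}"
    and \<mu>: "\<And>i. 0 \<le> \<mu> i"
    and pois: "\<And>i k. i < m \<Longrightarrow> prob {\<omega> \<in> space M. Y i \<omega> = k} = \<mu> i ^ k / fact k * exp (- \<mu> i)"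
    and F: "\<And>u. 0 \<le> F u" "\<And>u. F (\<lambda>i. if i < m then u i else 0) = F u"
  shows "(\<integral>\<^sup>+\<omega>. ennreal (F (\<lambda>i. Y i \<omega>)) \<partial>M) = (\<integral>\<^sup>+u. ennreal (F u) \<partial>Pi_pmf {..<m} 0 (\<lambda>i. poisson0_pmf (\<mu> i)))"
proof -
  let ?P = "Pi_pmf {..<m} 0 (\<lambda>i. poisson0_pmf (\<mu> i))"
  have Y: "Y i \<in> measurable M (count_space UNIV)" if "i < m" for i
    using indep[unfolded indep_vars_def, THEN conjunct1] that by simp
  have eq: "(\<integral>\<omega>. (\<Prod>i<m. of_bool (Y i \<omega> = k i) :: real) \<partial>M) = (\<integral>u. (\<Prod>i<m. of_bool (u i = k i)) \<partial>measure_pmf ?P)" for k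
  proof -
    have comp: "indep_vars (\<lambda>_. borel) (\<lambda>i \<omega>. of_bool (Y i \<omega> = k i) :: real) {..<m}"
      using indep_vars_compose2[OF indep, of "\<lambda>i y. of_bool (y = k i) :: real" "\<lambda>_. borel"] by simp
    have int: "integrable M (\<lambda>\<omega>. of_bool (Y i \<omega> = k i) :: real)" if "i < m" for i
      using measurable_compose[OF Y[OF that], of "\<lambda>y. of_bool (y = k i) :: real" borel]
      by (intro integrable_const_bound[where B = 1]) auto
    have E: "(\<integral>\<omega>. of_bool (Y i \<omega> = k i) \<partial>M) = pmf (poisson0_pmf (\<mu> i)) (k i)" if "i < m" for i
    proof -
      have "(\<integral>\<omega>. of_bool (Y i \<omega> = k i) \<partial>M) = (\<integral>\<omega>. indicator {\<omega> \<in> space M. Y i \<omega> = k i} \<omega> \<partial>M)"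
        by (intro Bochner_Integration.integral_cong) (auto simp: indicator_def)
      also have "\<dots> = prob {\<omega> \<in> space M. Y i \<omega> = k i}"
        by simp (rule arg_cong[where f = prob], auto)
      finally show ?thesis using pois[OF that] \<mu> by (simp add: pmf_poisson0)
    qed
    have "(\<integral>\<omega>. (\<Prod>i<m. of_bool (Y i \<omega> = k i) :: real) \<partial>M) = (\<Prod>i<m. \<integral>\<omega>. of_bool (Y i \<omega> = k i) \<partial>M)"
      using int by (intro indep_vars_lebesgue_integral comp) auto
    also have "\<dots> = (\<Prod>i<m. \<integral>y. of_bool (y = k i) \<partial>measure_pmf (poisson0_pmf (\<mu> i)))"
    proof (rule prod.cong[OF refl])
      fix i assume "i \<in> {..<m}"
      then have "(\<integral>\<omega>. of_bool (Y i \<omega> = k i) \<partial>M) = pmf (poisson0_pmf (\<mu> i)) (k i)" by (intro E) simp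
      moreover have "(\<integral>y. of_bool (y = k i) \<partial>measure_pmf (poisson0_pmf (\<mu> i))) = pmf (poisson0_pmf (\<mu> i)) (k i)"
        by (subst integral_measure_pmf_real[of "{k i}"]) auto
      ultimately show "(\<integral>\<omega>. (of_bool (Y i \<omega> = k i) :: real) \<partial>M) = (\<integral>y. of_bool (y = k i) \<partial>measure_pmf (poisson0_pmf (\<mu> i)))"
        by (rule trans[OF _ sym])
    qed
    also have "\<dots> = (\<integral>u. (\<Prod>i<m. of_bool (u i = k i)) \<partial>measure_pmf ?P)"
      by (intro expectation_prod_Pi_pmf[symmetric] measure_pmf.integrable_const_bound[where B = 1]) auto
    finally show ?thesis .
  qed
  have F': "F (\<lambda>i. if i < m then u i else 0) = F u" for u by (rule F(2))
  show ?thesis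
  proof (rule antisym)
    show "(\<integral>\<^sup>+\<omega>. ennreal (F (\<lambda>i. Y i \<omega>)) \<partial>M) \<le> (\<integral>\<^sup>+u. ennreal (F u) \<partial>?P)"
      using nn_integral_le_of_point_probabilities[OF prob_space_axioms Y prob_space_measure_pmf, where Y = "\<lambda>i u. u i" and m = m and F = F] eq F(1)
      unfolding F' by auto
    show "(\<integral>\<^sup>+u. ennreal (F u) \<partial>?P) \<le> (\<integral>\<^sup>+\<omega>. ennreal (F (\<lambda>i. Y i \<omega>)) \<partial>M)"
      using nn_integral_le_of_point_probabilities[OF prob_space_measure_pmf _ prob_space_axioms Y, where X = "\<lambda>i u. u i" and m = m and F = F] eq[symmetric] F(1)
      unfolding F' by auto
  qed
qed

lemma nn_integral_Pi_pmf_poisson0_component: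
  fixes m :: nat
  assumes "i < m" "0 \<le> \<mu> i"
  shows "(\<integral>\<^sup>+u. ennreal (real (u i)) \<partial>Pi_pmf {..<m} 0 (\<lambda>i. poisson0_pmf (\<mu> i))) = ennreal (\<mu> i)"
proof -
  have "map_pmf (\<lambda>u. u i) (Pi_pmf {..<m} 0 (\<lambda>i. poisson0_pmf (\<mu> i))) = poisson0_pmf (\<mu> i)"
    using Pi_pmf_component[of "{..<m}" i 0 "\<lambda>i. poisson0_pmf (\<mu> i)"] assms by simp
  then have "(\<integral>\<^sup>+k. ennreal (real k) \<partial>map_pmf (\<lambda>u. u i) (Pi_pmf {..<m} 0 (\<lambda>i. poisson0_pmf (\<mu> i)))) = ennreal (\<mu> i)"
    by (simp only: nn_integral_poisson0_mean[OF assms(2)])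
  then show ?thesis by (simp only: nn_integral_map_pmf)
qed

text \<open>The finite comparison at level \<open>N\<close> has the same right-hand bound for all
  \<open>N\<close>. It is inherited by each box part, passes to the limit there by convergence of
  point probabilities, and extends to \<open>F\<close> by Fatou's lemma.\<close>

lemma generating_function_dcx_bound:
  fixes X :: "nat \<Rightarrow> 'w \<Rightarrow> nat" and A :: "nat \<Rightarrow> nat \<Rightarrow> nat \<Rightarrow> complex"
  assumes P: "prob_space P" and X: "\<And>i. i < m \<Longrightarrow> X i \<in> measurable P (count_space UNIV)"
    and psd: "\<And>d b. b < m \<Longrightarrow> psd d (A b)"
    and gram: "\<And>j k. (\<Sum>b<m. A b j k) = (if j = k then of_real (l j) else 0)"
    and l: "\<And>k. l k \<le> 1"
    and trace: "\<And>b N. b < m \<Longrightarrow> (\<Sum>k<N. Re (A b k k)) \<le> \<mu> b"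
    and gf: "\<And>t. (\<And>b. b < m \<Longrightarrow> \<bar>t b\<bar> \<le> 1) \<Longrightarrow>
      (\<lambda>N. Re (ldet {..<N} (\<lambda>i j. (if i = j then 1 else 0) + (\<Sum>b<m. of_real (t b) * A b i j))))
      \<longlonglongrightarrow> (\<integral>\<omega>. (\<Prod>i<m. (1 + t i) ^ X i \<omega>) \<partial>P)"
    and F: "incr_dcx F" "\<And>u. F (\<lambda>i. if i < m then u i else 0) = F u"
  shows "(\<integral>\<^sup>+\<omega>. ennreal (F (\<lambda>i. X i \<omega>)) \<partial>P) \<le> (\<integral>\<^sup>+u. ennreal (F u) \<partial>Pi_pmf {..<m} 0 (\<lambda>i. poisson0_pmf (\<mu> i)))"
proof -
  interpret prob_space P by fact
  let ?bound = "\<integral>\<^sup>+u. ennreal (F u) \<partial>Pi_pmf {..<m} 0 (\<lambda>i. poisson0_pmf (\<mu> i))"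
  have F_nonneg: "0 \<le> F u" for u using F(1) by (simp add: incr_dcx_def)
  \<comment> \<open>Class \<open>m\<close> receives the defect diag(1 - l), which completes the Gram
    matrices to a partition of unity.\<close>
  define A' where "A' b = (if b < m then A b else (\<lambda>i j. if i = j then 1 - complex_of_real (l i) else 0))" for b
  have A'_less: "A' b = A b" if "b < m" for b using that by (simp add: A'_def)
  have A'_m: "A' m i j = (if i = j then 1 - complex_of_real (l i) else 0)" for i j by (simp add: A'_def)
  have sum_A': "(\<Sum>b\<le>m. z b * A' b i j) = (\<Sum>b<m. z b * A b i j) + z m * A' m i j" for z i j
    unfolding lessThan_Suc_atMost[symmetric] by (simp add: A'_less)
  have psd': "psd d (A' b)" if "b \<le> m" for d b
  proof (cases "b < m")
    case True
    then show ?thesis using psd by (simp add: A'_less)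
  next
    case False
    then have b: "b = m" using that by simp
    have "(\<Sum>j<d. c i * A' m i j * cnj (c j)) = complex_of_real ((1 - l i) * (cmod (c i))\<^sup>2)" if "i < d" for c i
    proof -
      have "(\<Sum>j<d. c i * A' m i j * cnj (c j)) = (\<Sum>j<d. if i = j then (1 - complex_of_real (l i)) * (c i * cnj (c i)) else 0)"
        by (intro sum.cong) (auto simp: A'_m)
      also have "\<dots> = (1 - complex_of_real (l i)) * (c i * cnj (c i))" using that by simp
      also have "\<dots> = complex_of_real ((1 - l i) * (cmod (c i))\<^sup>2)"
        unfolding complex_norm_square[symmetric] by simp
      finally show ?thesis .
    qed
    then have "Re (\<Sum>i<d. \<Sum>j<d. c i * A' m i j * cnj (c j)) = (\<Sum>i<d. (1 - l i) * (cmod (c i))\<^sup>2)" for c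
      by (simp del: of_real_mult of_real_power)
    moreover have "0 \<le> (\<Sum>i<d. (1 - l i) * (cmod (c i))\<^sup>2)" for c
      using l by (intro sum_nonneg mult_nonneg_nonneg) auto
    moreover have "A' m j i = cnj (A' m i j)" for i j by (simp add: A'_m)
    ultimately show ?thesis unfolding b psd_def by metis
  qed
  have unity: "(\<Sum>b\<le>m. A' b i j) = (if i = j then 1 else 0)" for i j
    using sum_A'[of "\<lambda>_. 1" i j] gram[of i j] by (simp add: A'_m)
  define \<Phi> where "\<Phi> N E w \<longleftrightarrow> finite E \<and> (\<forall>S. 0 \<le> w S) \<and> (\<Sum>S\<in>Pow E. w S) = (1::real) \<and>
      (\<forall>z. ldet {..<N} (\<lambda>i j. \<Sum>b\<le>m. z b * A' b i j)
        = (\<Sum>S\<in>Pow E. complex_of_real (w S) * (\<Prod>b\<le>m. z b ^ class_count fst S b))) \<and>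
      (\<forall>H. incr_dcx H \<longrightarrow> ennreal (\<Sum>S\<in>Pow E. w S * H (class_count fst S))
        \<le> (\<integral>\<^sup>+x. ennreal (H x) \<partial>Pi_pmf {..m} 0 (\<lambda>b. poisson0_pmf (\<Sum>i<N. Re (A' b i i)))))"
    for N and E :: "(nat \<times> nat) set" and w
  have "\<exists>E w. \<Phi> N E w" for N
  proof (rule psd_partition_of_unity_dcx[where m = m and d = N and A = A'])
    show "psd N (A' b)" if "b \<le> m" for b by (rule psd'[OF that])
    show "(\<Sum>b\<le>m. A' b i j) = (if i = j then 1 else 0)" for i j by (rule unity)
  next
    fix E :: "(nat \<times> nat) set" and w
    assume "finite E" "\<And>S. 0 \<le> w S" "(\<Sum>S\<in>Pow E. w S) = 1"
      "\<And>z. ldet {..<N} (\<lambda>i j. \<Sum>b\<le>m. z b * A' b i j)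
        = (\<Sum>S\<in>Pow E. complex_of_real (w S) * (\<Prod>b\<le>m. z b ^ class_count fst S b))"
      "\<And>H. incr_dcx H \<Longrightarrow> ennreal (\<Sum>S\<in>Pow E. w S * H (class_count fst S))
        \<le> (\<integral>\<^sup>+x. ennreal (H x) \<partial>Pi_pmf {..m} 0 (\<lambda>b. poisson0_pmf (\<Sum>i<N. Re (A' b i i))))"
    show ?thesis unfolding \<Phi>_def by (intro exI[of _ E] exI[of _ w] conjI allI impI; fact)
  qed
  then obtain E w where Ew: "\<And>N. \<Phi> N (E N) (w N)" by metis
  note Ew' = Ew[unfolded \<Phi>_def]
  have w: "\<And>N S. 0 \<le> w N S" "\<And>N. (\<Sum>S\<in>Pow (E N). w N S) = (1::real)"
    and poly: "\<And>N z. ldet {..<N} (\<lambda>i j. \<Sum>b\<le>m. z b * A' b i j)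
        = (\<Sum>S\<in>Pow (E N). complex_of_real (w N S) * (\<Prod>b\<le>m. z b ^ class_count fst S b))"
    and dcx: "\<And>N H. incr_dcx H \<Longrightarrow> ennreal (\<Sum>S\<in>Pow (E N). w N S * H (class_count fst S))
        \<le> (\<integral>\<^sup>+x. ennreal (H x) \<partial>Pi_pmf {..m} 0 (\<lambda>b. poisson0_pmf (\<Sum>i<N. Re (A' b i i))))"
    by (use Ew' in blast)+
  have conv: "(\<lambda>N. \<Sum>S\<in>Pow (E N). w N S * (\<Prod>i<m. z i ^ class_count fst S i)) \<longlonglongrightarrow> (\<integral>\<omega>. (\<Prod>i<m. z i ^ X i \<omega>) \<partial>P)"
    if z: "\<And>i. 0 \<le> z i \<and> z i \<le> (1::real)" for z
  proof -
    have "(\<Sum>S\<in>Pow (E N). w N S * (\<Prod>i<m. z i ^ class_count fst S i))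
        = Re (ldet {..<N} (\<lambda>i j. (if i = j then 1 else 0) + (\<Sum>b<m. of_real (z b - 1) * A b i j)))" for N
    proof -
      \<comment> \<open>The variable of the extra class is set to 1. Then the homogeneous
        determinant becomes det(I + sum of (z_b - 1) A_b), and the counts of that class drop out of
        the product.\<close>
      define y where "y b = (if b < m then complex_of_real (z b) else 1)" for b
      have "(\<Sum>b\<le>m. y b * A' b i j) = (if i = j then 1 else 0) + (\<Sum>b<m. of_real (z b - 1) * A b i j)" for i j
        unfolding sum_A' using gram[of i j]
        by (simp add: y_def A'_m left_diff_distrib sum_subtractf)
      then have "ldet {..<N} (\<lambda>i j. (if i = j then 1 else 0) + (\<Sum>b<m. of_real (z b - 1) * A b i j))
          = (\<Sum>S\<in>Pow (E N). complex_of_real (w N S) * (\<Prod>b\<le>m. y b ^ class_count fst S b))"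
        using poly[of N y] by simp
      moreover have "(\<Prod>b\<le>m. y b ^ class_count fst S b) = complex_of_real (\<Prod>i<m. z i ^ class_count fst S i)" for S :: "(nat \<times> nat) set"
        unfolding lessThan_Suc_atMost[symmetric] by (simp add: y_def)
      ultimately have "ldet {..<N} (\<lambda>i j. (if i = j then 1 else 0) + (\<Sum>b<m. of_real (z b - 1) * A b i j))
          = complex_of_real (\<Sum>S\<in>Pow (E N). w N S * (\<Prod>i<m. z i ^ class_count fst S i))"
        by (simp only: of_real_sum of_real_mult)
      then show ?thesis by (simp only: Re_complex_of_real)
    qed
    moreover have "(\<lambda>N. Re (ldet {..<N} (\<lambda>i j. (if i = j then 1 else 0) + (\<Sum>b<m. of_real (z b - 1) * A b i j))))
        \<longlonglongrightarrow> (\<integral>\<omega>. (\<Prod>i<m. (1 + (z i - 1)) ^ X i \<omega>) \<partial>P)"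
    proof (rule gf)
      show "\<bar>z b - 1\<bar> \<le> 1" for b using z[of b] by auto
    qed
    ultimately show ?thesis by simp
  qed
  have points: "(\<lambda>N. \<Sum>S\<in>Pow (E N). w N S * (\<Prod>i<m. of_bool (class_count fst S i = k i)))
      \<longlonglongrightarrow> (\<integral>\<omega>. (\<Prod>i<m. of_bool (X i \<omega> = k i)) \<partial>P)" for k
    by (rule generating_functions_determine_point_limits[OF X w conv]) auto
  have finite_bound: "ennreal (\<Sum>S\<in>Pow (E N). w N S * F (class_count fst S)) \<le> ?bound" for N
  proof -
    define \<nu> where "\<nu> b = (\<Sum>i<N. Re (A' b i i))" for b
    have \<nu>_nonneg: "0 \<le> \<nu> b" if "b \<le> m" for b
    proof -
      have "0 \<le> Re (A' b i i)" for i
      proof -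
        let ?c = "\<lambda>j. of_bool (j = i) :: complex"
        have "(\<Sum>k<Suc i. ?c j * A' b j k * cnj (?c k)) = (\<Sum>k<Suc i. if k = i then ?c j * A' b j k else 0)" for j
          by (intro sum.cong) auto
        also have "\<dots> j = (if j = i then A' b j i else 0)" for j by simp
        finally have inner: "(\<Sum>k<Suc i. ?c j * A' b j k * cnj (?c k)) = (if j = i then A' b j i else 0)" for j .
        have "0 \<le> Re (\<Sum>j<Suc i. \<Sum>k<Suc i. ?c j * A' b j k * cnj (?c k))"
          by (rule psd'[OF that, of "Suc i", unfolded psd_def, THEN conjunct2, rule_format])
        then show ?thesis unfolding inner by (simp del: sum.lessThan_Suc)
      qed
      then show ?thesis unfolding \<nu>_def by (intro sum_nonneg)
    qed
    have "ennreal (\<Sum>S\<in>Pow (E N). w N S * F (class_count fst S)) \<le> (\<integral>\<^sup>+x. ennreal (F x) \<partial>Pi_pmf {..m} 0 (\<lambda>b. poisson0_pmf (\<nu> b)))"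
      unfolding \<nu>_def by (rule dcx[OF F(1)])
    also have "\<dots> = (\<integral>\<^sup>+x. ennreal (F x) \<partial>Pi_pmf {..<m} 0 (\<lambda>b. poisson0_pmf (\<nu> b)))"
    proof -
      \<comment> \<open>\<open>F\<close> ignores coordinate \<open>m\<close>, so the Poisson
        variable of the extra class integrates out.\<close>
      have last: "F (u(m := y)) = F u" for u y
      proof -
        have "(\<lambda>i. if i < m then (u(m := y)) i else 0) = (\<lambda>i. if i < m then u i else 0)" by auto
        then show ?thesis using F(2)[of "u(m := y)"] F(2)[of u] by metis
      qed
      have "{..m} = insert m {..<m}" by auto
      then show ?thesis
        by (simp add: Pi_pmf_insert' nn_integral_bind_pmf last measure_pmf.emeasure_space_1)
    qed
    \<comment> \<open>Rates outside the range are reset to 0, since the monotonicity lemma asks for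
      nonnegative and ordered rates at every index.\<close>
    also have "\<dots> = (\<integral>\<^sup>+x. ennreal (F x) \<partial>Pi_pmf {..<m} 0 (\<lambda>b. poisson0_pmf (if b < m then \<nu> b else 0)))"
      by (rule arg_cong[where f = "\<lambda>p. \<integral>\<^sup>+x. ennreal (F x) \<partial>measure_pmf p"], rule Pi_pmf_cong) auto
    \<comment> \<open>The truncated traces are at most the exact means; monotonicity of
      \<open>F\<close> absorbs the difference.\<close>
    also have "\<dots> \<le> (\<integral>\<^sup>+x. ennreal (F x) \<partial>Pi_pmf {..<m} 0 (\<lambda>b. poisson0_pmf (if b < m then \<mu> b else 0)))"
    proof (rule nn_integral_Pi_pmf_poisson0_mono)
      show "ennreal (F x) \<le> ennreal (F (incr i 1 x))" for i x
        using F(1) by (auto simp: incr_dcx_def intro: ennreal_leI)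
      show "(if b < m then \<nu> b else 0) \<le> (if b < m then \<mu> b else 0)" for b
        using trace[of b N] by (auto simp: \<nu>_def A'_less)
    qed (auto simp: \<nu>_nonneg)
    also have "\<dots> = ?bound"
      by (rule arg_cong[where f = "\<lambda>p. \<integral>\<^sup>+x. ennreal (F x) \<partial>measure_pmf p"], rule Pi_pmf_cong) auto
    finally show ?thesis .
  qed
  have "(\<integral>\<^sup>+\<omega>. ennreal (F (\<lambda>i. if i < m then X i \<omega> else 0)) \<partial>P) \<le> ?bound"
  proof (rule nn_integral_le_box_part[OF X])
    fix R
    have "(\<lambda>N. \<Sum>k\<in>{..<m} \<rightarrow>\<^sub>E {..R}. F (\<lambda>i. if i < m then k i else 0) *
        (\<Sum>S\<in>Pow (E N). w N S * (\<Prod>i<m. of_bool (class_count fst S i = k i))))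
      \<longlonglongrightarrow> (\<integral>\<omega>. box_part m R F (\<lambda>i. X i \<omega>) \<partial>P)"
    proof -
      have eq: "(\<integral>\<omega>. box_part m R F (\<lambda>i. X i \<omega>) \<partial>P)
          = (\<Sum>k\<in>{..<m} \<rightarrow>\<^sub>E {..R}. F (\<lambda>i. if i < m then k i else 0) * (\<integral>\<omega>. (\<Prod>i<m. of_bool (X i \<omega> = k i)) \<partial>P))"
        by (rule integral_box_part(1)[OF P X])
      show ?thesis unfolding eq by (intro tendsto_sum tendsto_mult tendsto_const points)
    qed
    moreover have "(\<Sum>k\<in>{..<m} \<rightarrow>\<^sub>E {..R}. F (\<lambda>i. if i < m then k i else 0) *
        (\<Sum>S\<in>Pow (E N). w N S * (\<Prod>i<m. of_bool (class_count fst S i = k i))))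
      = (\<Sum>S\<in>Pow (E N). w N S * box_part m R F (class_count fst S))" for N
      unfolding box_part_def sum_distrib_left by (subst sum.swap) (simp add: mult_ac)
    ultimately have lim: "(\<lambda>N. \<Sum>S\<in>Pow (E N). w N S * box_part m R F (class_count fst S)) \<longlonglongrightarrow> (\<integral>\<omega>. box_part m R F (\<lambda>i. X i \<omega>) \<partial>P)"
      by simp
    have "ennreal (\<Sum>S\<in>Pow (E N). w N S * box_part m R F (class_count fst S)) \<le> ?bound" for N
    proof -
      have "(\<Sum>S\<in>Pow (E N). w N S * box_part m R F (class_count fst S)) \<le> (\<Sum>S\<in>Pow (E N). w N S * F (class_count fst S))"
        using F_nonneg w(1) by (intro sum_mono mult_left_mono) (auto simp: box_part_eq F(2))
      then show ?thesis using finite_bound[of N] ennreal_leI order.trans by blast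
    qed
    then have "ennreal (\<integral>\<omega>. box_part m R F (\<lambda>i. X i \<omega>) \<partial>P) \<le> ?bound"
      by (intro LIMSEQ_le_const2[OF tendsto_ennrealI[OF lim]]) auto
    moreover have "(\<integral>\<^sup>+\<omega>. ennreal (box_part m R F (\<lambda>i. X i \<omega>)) \<partial>P) = ennreal (\<integral>\<omega>. box_part m R F (\<lambda>i. X i \<omega>) \<partial>P)"
      using integral_box_part(2)[OF P X] F_nonneg by (intro nn_integral_eq_integral AE_I2 box_part_nonneg) auto
    ultimately show "(\<integral>\<^sup>+\<omega>. ennreal (box_part m R F (\<lambda>i. X i \<omega>)) \<partial>P) \<le> ?bound" by simp
  qed auto
  then show ?thesis by (simp add: F(2)[of "\<lambda>i. X i _"])
qed

section \<open>Directionally convex functions on the lattice\<close>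

text \<open>By directional convexity the first differences are increasing in every coordinate, so
  they are smallest at the origin, where they equal \<open>a i\<close>. Subtracting the affine
  function with these slopes leaves nonnegative increments and the value 0 at the origin.\<close>

lemma directionally_convex_lattice:
  fixes f :: "real Matrix.vec \<Rightarrow> real"
  assumes f: "directionally_convex m f"
  defines "F0 \<equiv> \<lambda>u :: nat \<Rightarrow> nat. f (Matrix.vec m (\<lambda>i. real (u i)))"
  defines "a \<equiv> \<lambda>i. F0 (incr i 1 (\<lambda>_. 0)) - F0 (\<lambda>_. 0)"
  shows "incr_dcx (\<lambda>u. F0 u - F0 (\<lambda>_. 0) - (\<Sum>i<m. real (u i) * a i))"
    and "F0 (\<lambda>i. if i < m then u i else 0) = F0 u"
proof -
  show dep: "F0 (\<lambda>i. if i < m then u i else 0) = F0 u" for u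
    unfolding F0_def by (intro arg_cong[where f = f] eq_vecI) auto
  have incr_out: "F0 (incr i 1 u) = F0 u" if "\<not> i < m" for i u
    unfolding F0_def using that by (intro arg_cong[where f = f] eq_vecI) (auto simp: incr_def)
  have step: "Matrix.vec m (\<lambda>j. real (incr i 1 u j)) = Matrix.vec m (\<lambda>j. real (u j)) + 1 \<cdot>\<^sub>v unit_vec m i" if "i < m" for i u
    using that by (intro eq_vecI) (auto simp: incr_def unit_vec_def)
  define D where "D i u = F0 (incr i 1 u) - F0 u" for i u
  have D_ordered: "D i u \<le> D i (incr j 1 u)" if "i \<le> j" "j < m" for i j u
  proof -
    have "0 \<le> diff_op m j 1 (diff_op m i 1 f) (Matrix.vec m (\<lambda>j. real (u j)))"
    proof (rule f[unfolded directionally_convex_def, rule_format])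
      show "Matrix.vec m (\<lambda>j. real (u j)) \<in> carrier_vec m" by simp
      show "i \<le> j \<and> j < m \<and> 0 < (1::real) \<and> 0 < (1::real)" using that by simp
    qed
    moreover have "i < m" using that by simp
    ultimately show ?thesis
      unfolding diff_op_def D_def F0_def step[OF that(2), symmetric] step[OF \<open>i < m\<close>, symmetric] by simp
  qed
  \<comment> \<open>The assumption covers \<open>i \<le> j\<close> only; the mixed difference is
    symmetric, which settles the other order. Coordinates outside the range have no effect on
    \<open>F0\<close>.\<close>
  have D_mono: "D i u \<le> D i (incr j 1 u)" for i j u
  proof (cases "i < m \<and> j < m")
    case True
    show ?thesis
    proof (cases "i \<le> j")
      case True
      then show ?thesis using D_ordered \<open>i < m \<and> j < m\<close> by simp
    next
      case False
      then have "D j u \<le> D j (incr i 1 u)" using D_ordered[of j i u] \<open>i < m \<and> j < m\<close> by simp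
      then show ?thesis by (simp add: D_def incr_commute[of j _ i])
    qed
  next
    case False
    then consider "\<not> i < m" | "\<not> j < m" by blast
    then show ?thesis
    proof cases
      case 1
      then show ?thesis unfolding D_def incr_out[OF 1] by simp
    next
      case 2
      then show ?thesis unfolding D_def incr_commute[of i _ j] incr_out[OF 2] by simp
    qed
  qed
  have D_ge: "a i \<le> D i u" if "i < m" for i u
  proof -
    have "D i (\<lambda>_. 0) \<le> D i (\<lambda>j. if j < m then u j else 0)"
      by (rule incr_mono_le[where g = "D i" and A = "{..<m}", OF D_mono]) auto
    also have "D i (\<lambda>j. if j < m then u j else 0) = D i u"
    proof -
      have "incr i 1 (\<lambda>j. if j < m then u j else 0) = (\<lambda>j. if j < m then incr i 1 u j else 0)"
        using that by (auto simp: incr_def)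
      then show ?thesis by (simp add: D_def dep)
    qed
    finally show ?thesis by (simp add: D_def a_def)
  qed
  define G where "G u = F0 u - F0 (\<lambda>_. 0) - (\<Sum>i<m. real (u i) * a i)" for u
  have lin: "(\<Sum>j<m. real (incr i 1 u j) * a j) = (\<Sum>j<m. real (u j) * a j) + (if i < m then a i else 0)" for i u
  proof -
    have "(\<Sum>j<m. real (incr i 1 u j) * a j) = (\<Sum>j<m. real (u j) * a j + (if j = i then a j else 0))"
      by (intro sum.cong) (auto simp: incr_def algebra_simps)
    then show ?thesis by (simp add: sum.distrib)
  qed
  have G_diff: "G (incr i 1 u) - G u = D i u - (if i < m then a i else 0)" for i u
    unfolding G_def D_def lin by simp
  have G_mono: "G u \<le> G (incr i 1 u)" for i u
  proof (cases "i < m")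
    case True
    then show ?thesis using G_diff[of i u] D_ge[OF True, of u] by simp
  next
    case False
    then show ?thesis using G_diff[of i u] incr_out[OF False, of u] by (simp add: D_def)
  qed
  have G_nonneg: "0 \<le> G u" for u
  proof -
    have "G (\<lambda>_. 0) \<le> G (\<lambda>j. if j < m then u j else 0)"
      by (rule incr_mono_le[where g = G and A = "{..<m}", OF G_mono]) auto
    moreover have "G (\<lambda>j. if j < m then u j else 0) = G u" by (simp add: G_def dep)
    ultimately show ?thesis by (simp add: G_def)
  qed
  have "G (incr i 1 u) + G (incr j 1 u) \<le> G (incr i 1 (incr j 1 u)) + G u" for i j u
    using G_diff[of i u] G_diff[of i "incr j 1 u"] D_mono[of i u j] by simp
  then have "incr_dcx G" unfolding incr_dcx_def using G_mono G_nonneg by blast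
  then show "incr_dcx (\<lambda>u. F0 u - F0 (\<lambda>_. 0) - (\<Sum>i<m. real (u i) * a i))"
    by (simp add: G_def[abs_def])
qed

text \<open>The affine correction has the same expectation on both sides, since the means are the
  same \<open>\<mu> i\<close>, and it cancels at the end. Both corrected functions are integrable,
  so the extended inequality is one between real numbers.\<close>

lemma expectation_le_of_incr_dcx:
  fixes X :: "nat \<Rightarrow> 'w \<Rightarrow> nat" and Y :: "nat \<Rightarrow> 'v \<Rightarrow> nat" and f :: "real Matrix.vec \<Rightarrow> real"
  assumes "prob_space P" "prob_space Q"
    and f: "directionally_convex m f"
      "integrable P (\<lambda>\<omega>. f (Matrix.vec m (\<lambda>i. real (X i \<omega>))))" "integrable Q (\<lambda>\<omega>. f (Matrix.vec m (\<lambda>i. real (Y i \<omega>))))"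
    and X: "\<And>i. i < m \<Longrightarrow> has_bochner_integral P (\<lambda>\<omega>. real (X i \<omega>)) (\<mu> i)"
    and Y: "\<And>i. i < m \<Longrightarrow> has_bochner_integral Q (\<lambda>\<omega>. real (Y i \<omega>)) (\<mu> i)"
    and le: "\<And>F. incr_dcx F \<Longrightarrow> (\<And>u. F (\<lambda>i. if i < m then u i else 0) = F u) \<Longrightarrow>
      (\<integral>\<^sup>+\<omega>. ennreal (F (\<lambda>i. X i \<omega>)) \<partial>P) \<le> (\<integral>\<^sup>+\<omega>. ennreal (F (\<lambda>i. Y i \<omega>)) \<partial>Q)"
  shows "(\<integral>\<omega>. f (Matrix.vec m (\<lambda>i. real (X i \<omega>))) \<partial>P) \<le> (\<integral>\<omega>. f (Matrix.vec m (\<lambda>i. real (Y i \<omega>))) \<partial>Q)"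
proof -
  interpret P: prob_space P by fact
  interpret Q: prob_space Q by fact
  define F0 where "F0 u = f (Matrix.vec m (\<lambda>i. real (u i)))" for u :: "nat \<Rightarrow> nat"
  define a where "a i = F0 (incr i 1 (\<lambda>_. 0)) - F0 (\<lambda>_. 0)" for i
  define F where "F u = F0 u - F0 (\<lambda>_. 0) - (\<Sum>i<m. real (u i) * a i)" for u
  have dcx: "incr_dcx F"
    using directionally_convex_lattice(1)[OF f(1)] unfolding F_def[abs_def] a_def F0_def .
  have dep: "F (\<lambda>i. if i < m then u i else 0) = F u" for u
    using directionally_convex_lattice(2)[OF f(1), of u] by (simp add: F_def F0_def)
  have nonneg: "0 \<le> F u" for u using dcx by (simp add: incr_dcx_def)
  have XF: "has_bochner_integral P (\<lambda>\<omega>. F (\<lambda>i. X i \<omega>))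
      ((\<integral>\<omega>. f (Matrix.vec m (\<lambda>i. real (X i \<omega>))) \<partial>P) - F0 (\<lambda>_. 0) - (\<Sum>i<m. \<mu> i * a i))"
    unfolding F_def
  proof (intro has_bochner_integral_diff has_bochner_integral_sum has_bochner_integral_mult_left X)
    show "has_bochner_integral P (\<lambda>\<omega>. F0 (\<lambda>i. X i \<omega>)) (\<integral>\<omega>. f (Matrix.vec m (\<lambda>i. real (X i \<omega>))) \<partial>P)"
      unfolding F0_def using f(2) by (rule has_bochner_integral_integrable)
    show "has_bochner_integral P (\<lambda>_. F0 (\<lambda>_. 0)) (F0 (\<lambda>_. 0))"
      by (simp add: has_bochner_integral_iff P.prob_space)
  qed auto
  have YF: "has_bochner_integral Q (\<lambda>\<omega>. F (\<lambda>i. Y i \<omega>))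
      ((\<integral>\<omega>. f (Matrix.vec m (\<lambda>i. real (Y i \<omega>))) \<partial>Q) - F0 (\<lambda>_. 0) - (\<Sum>i<m. \<mu> i * a i))"
    unfolding F_def
  proof (intro has_bochner_integral_diff has_bochner_integral_sum has_bochner_integral_mult_left Y)
    show "has_bochner_integral Q (\<lambda>\<omega>. F0 (\<lambda>i. Y i \<omega>)) (\<integral>\<omega>. f (Matrix.vec m (\<lambda>i. real (Y i \<omega>))) \<partial>Q)"
      unfolding F0_def using f(3) by (rule has_bochner_integral_integrable)
    show "has_bochner_integral Q (\<lambda>_. F0 (\<lambda>_. 0)) (F0 (\<lambda>_. 0))"
      by (simp add: has_bochner_integral_iff Q.prob_space)
  qed auto
  have "(\<integral>\<^sup>+\<omega>. ennreal (F (\<lambda>i. X i \<omega>)) \<partial>P) \<le> (\<integral>\<^sup>+\<omega>. ennreal (F (\<lambda>i. Y i \<omega>)) \<partial>Q)"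
    by (rule le[OF dcx dep])
  then have "ennreal (\<integral>\<omega>. F (\<lambda>i. X i \<omega>) \<partial>P) \<le> ennreal (\<integral>\<omega>. F (\<lambda>i. Y i \<omega>) \<partial>Q)"
    using XF YF nonneg by (simp add: nn_integral_eq_integral has_bochner_integral_iff)
  then have "(\<integral>\<omega>. F (\<lambda>i. X i \<omega>) \<partial>P) \<le> (\<integral>\<omega>. F (\<lambda>i. Y i \<omega>) \<partial>Q)"
    using nonneg by (subst (asm) ennreal_le_iff) (auto intro: integral_nonneg_AE)
  then show ?thesis
    unfolding has_bochner_integral_integral_eq[OF XF] has_bochner_integral_integral_eq[OF YF] by simp
qed

section \<open>Point processes\<close>

text \<open>On relatively compact sets a point process has finite integer mass, so neither the
  passage to reals nor the floor loses anything; elsewhere the value is merely conventional.\<close>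

definition pt_count :: "'a measure \<Rightarrow> 'a set \<Rightarrow> nat" where
  "pt_count \<mu> B = nat \<lfloor>measure \<mu> B\<rfloor>"

lemma pt_count_measurable_ennreal: "(\<lambda>e. nat \<lfloor>enn2real e\<rfloor>) \<in> measurable borel (count_space UNIV)"
proof -
  have "(\<lambda>e. \<lfloor>enn2real e\<rfloor>) \<in> measurable borel (count_space UNIV)"
    by (rule measurable_compose[OF borel_measurable_enn2real[OF measurable_ident_sets[OF refl]] measurable_real_floor, unfolded id_def])
  then show ?thesis by (rule measurable_compose) simp
qed

lemma point_process_pt_count:
  assumes "point_process P \<eta>" "B \<in> sets borel" "relatively_compact B"
  shows "\<omega> \<in> space P \<Longrightarrow> emeasure (\<eta> \<omega>) B = of_nat (pt_count (\<eta> \<omega>) B)"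
    and "\<omega> \<in> space P \<Longrightarrow> measure (\<eta> \<omega>) B = real (pt_count (\<eta> \<omega>) B)"
    and "(\<lambda>\<omega>. pt_count (\<eta> \<omega>) B) \<in> measurable P (count_space UNIV)"
proof -
  assume "\<omega> \<in> space P"
  then have "\<exists>n::nat. emeasure (\<eta> \<omega>) B = of_nat n"
    using assms unfolding point_process_def by blast
  then obtain n :: nat where n: "emeasure (\<eta> \<omega>) B = of_nat n" ..
  then have "measure (\<eta> \<omega>) B = real n" by (simp add: measure_def ennreal_of_nat_eq_real_of_nat)
  then show "emeasure (\<eta> \<omega>) B = of_nat (pt_count (\<eta> \<omega>) B)" "measure (\<eta> \<omega>) B = real (pt_count (\<eta> \<omega>) B)"
    using n by (simp_all add: pt_count_def)
next
  have "(\<lambda>\<omega>. emeasure (\<eta> \<omega>) B) \<in> borel_measurable P"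
    using assms unfolding point_process_def by blast
  then show "(\<lambda>\<omega>. pt_count (\<eta> \<omega>) B) \<in> measurable P (count_space UNIV)"
    unfolding pt_count_def measure_def by (rule measurable_compose[OF _ pt_count_measurable_ennreal])
qed

lemma tuple_count_1: "tuple_count (Suc 0) c k = k (c 0)"
proof -
  have "{..<Suc 0} = {0::nat}" by auto
  then show ?thesis
    using card_PiE[of "{0::nat}" "\<lambda>j. {c j} \<times> {..<k (c j)}"] by (simp add: tuple_count_def)
qed

lemma tuple_count_0: "tuple_count 0 c k = 1"
  by (simp add: tuple_count_def)

text \<open>For a simple process the mass of a set is the number of its atoms. Tuples of distinct
  atoms, as they occur in correlation functions, can therefore be counted from the counts of the
  sets alone.\<close>

lemma simple_point_process_tuple_count:
  fixes \<eta> :: "'w \<Rightarrow> 'a::polish_space measure"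
  assumes \<eta>: "simple_point_process P \<eta>"
    and B: "\<And>i. i < m \<Longrightarrow> B i \<in> sets borel \<and> relatively_compact (B i)" "disjoint_family_on B {..<m}"
    and c: "c \<in> {..<n} \<rightarrow> {..<m}"
  shows "AE \<omega> in P. card {x \<in> \<Pi>\<^sub>E i\<in>{..<n}. B (c i). inj_on x {..<n} \<and> (\<forall>i<n. emeasure (\<eta> \<omega>) {x i} \<noteq> 0)}
    = tuple_count n c (\<lambda>i. pt_count (\<eta> \<omega>) (B i))"
proof -
  have pp: "point_process P \<eta>" using \<eta> by (simp add: simple_point_process_def)
  have "AE \<omega> in P. \<forall>x. emeasure (\<eta> \<omega>) {x} \<le> 1" using \<eta> by (simp add: simple_point_process_def)
  then show ?thesis
  proof (rule AE_mp, intro AE_I2 impI)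
    fix \<omega> assume \<omega>: "\<omega> \<in> space P" and simple: "\<forall>x. emeasure (\<eta> \<omega>) {x} \<le> 1"
    define S where "S i = {y \<in> B i. emeasure (\<eta> \<omega>) {y} \<noteq> 0}" for i
    have sets: "sets (\<eta> \<omega>) = sets borel" using pp \<omega> by (simp add: point_process_def)
    have atoms: "finite (S i)" "emeasure (\<eta> \<omega>) (B i) = of_nat (card (S i))" if "i < m" for i
    proof -
      have "\<exists>n::nat. emeasure (\<eta> \<omega>) A = of_nat n" if "A \<in> sets borel" "A \<subseteq> B i" for A
        using pp \<omega> that relatively_compact_subset[of "B i" A] B(1)[OF \<open>i < m\<close>] by (auto simp: point_process_def)
      then show "finite (S i)" "emeasure (\<eta> \<omega>) (B i) = of_nat (card (S i))"
        unfolding S_def using B(1)[OF that] simple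
        by (auto intro!: emeasure_eq_card_atoms sets)
    qed
    have card: "card (S i) = pt_count (\<eta> \<omega>) (B i)" if "i < m" for i
      using atoms(2)[OF that] point_process_pt_count(1)[OF pp _ _ \<omega>, of "B i"] B(1)[OF that] by simp
    have "{x \<in> \<Pi>\<^sub>E i\<in>{..<n}. B (c i). inj_on x {..<n} \<and> (\<forall>i<n. emeasure (\<eta> \<omega>) {x i} \<noteq> 0)}
        = {x \<in> \<Pi>\<^sub>E i\<in>{..<n}. S (c i). inj_on x {..<n}}"
      by (auto simp: S_def PiE_def Pi_def)
    also have "card \<dots> = tuple_count n c (\<lambda>i. card (S i))"
      using B(2) by (intro card_inj_PiE_eq_tuple_count[OF _ atoms(1) c]) (auto simp: disjoint_family_on_def S_def)
    also have "\<dots> = tuple_count n (restrict c {..<n}) (\<lambda>i. card (S i))"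
      unfolding tuple_count_def by (intro arg_cong[where f = card] Collect_cong conj_cong arg_cong2[where f = "(\<in>)"] refl PiE_cong) auto
    also have "\<dots> = tuple_count n (restrict c {..<n}) (\<lambda>i. pt_count (\<eta> \<omega>) (B i))"
      using c card by (intro tuple_count_cong[where m = m]) auto
    also have "\<dots> = tuple_count n c (\<lambda>i. pt_count (\<eta> \<omega>) (B i))"
      unfolding tuple_count_def by (intro arg_cong[where f = card] Collect_cong conj_cong arg_cong2[where f = "(\<in>)"] refl PiE_cong) auto
    finally show "card {x \<in> \<Pi>\<^sub>E i\<in>{..<n}. B (c i). inj_on x {..<n} \<and> (\<forall>i<n. emeasure (\<eta> \<omega>) {x i} \<noteq> 0)}
        = tuple_count n c (\<lambda>i. pt_count (\<eta> \<omega>) (B i))" .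
  qed
qed

text \<open>The case n = 1, with the product over one index identified with the space itself.
  \<open>C\<close> is kept general because both the sets and their intersections with a null set are
  inserted.\<close>

lemma determinantal_intensity:
  fixes \<eta> :: "'w \<Rightarrow> 'a::polish_space measure"
  assumes \<eta>: "simple_point_process P \<eta>" and M: "sigma_finite_measure M" "sets M = sets borel"
    and \<kappa>: "(\<lambda>(x, y). \<kappa> x y) \<in> borel_measurable (M \<Otimes>\<^sub>M M)"
    and corr: "correlation_function P \<eta> M 1 (\<lambda>x. Re (Determinant.det (Matrix.mat 1 1 (\<lambda>(i, j). \<kappa> (x i) (x j)))))"
    and C: "C \<in> sets borel" "relatively_compact C"
  shows "(\<integral>\<^sup>+\<omega>. emeasure (\<eta> \<omega>) C \<partial>P) = (\<integral>\<^sup>+x. indicator C x * ennreal (Re (\<kappa> x x)) \<partial>M)"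
proof -
  interpret sigma_finite_measure M by (rule M)
  interpret product_sigma_finite "\<lambda>_::nat. M" by unfold_locales
  have pp: "point_process P \<eta>" using \<eta> by (simp add: simple_point_process_def)
  have diag: "(\<lambda>x. \<kappa> x x) \<in> borel_measurable M"
    using measurable_compose[OF measurable_Pair[OF measurable_ident_sets[OF refl] measurable_ident_sets[OF refl]] \<kappa>] by simp
  have Re_diag: "(\<lambda>x. indicator C x * ennreal (Re (\<kappa> x x))) \<in> borel_measurable M"
    using diag C(1) M(2) by auto
  have one: "{..<1} = {0::nat}" by auto
  have "AE \<omega> in P. card {x \<in> \<Pi>\<^sub>E i\<in>{..<1::nat}. C. inj_on x {..<1} \<and> (\<forall>i<1. emeasure (\<eta> \<omega>) {x i} \<noteq> 0)}
      = tuple_count 1 (\<lambda>_. 0) (\<lambda>i. pt_count (\<eta> \<omega>) C)"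
    by (rule simple_point_process_tuple_count[OF \<eta>, where B = "\<lambda>_. C" and m = 1]) (auto simp: C disjoint_family_on_def)
  then have "AE \<omega> in P. emeasure (\<eta> \<omega>) C = of_nat (card {x \<in> \<Pi>\<^sub>E i\<in>{..<1::nat}. C. inj_on x {..<1} \<and> (\<forall>i<1. emeasure (\<eta> \<omega>) {x i} \<noteq> 0)})"
    by (rule AE_mp, intro AE_I2 impI) (simp add: tuple_count_1 point_process_pt_count(1)[OF pp C])
  then have "(\<integral>\<^sup>+\<omega>. emeasure (\<eta> \<omega>) C \<partial>P)
      = (\<integral>\<^sup>+\<omega>. of_nat (card {x \<in> \<Pi>\<^sub>E i\<in>{..<1::nat}. C. inj_on x {..<1} \<and> (\<forall>i<1. emeasure (\<eta> \<omega>) {x i} \<noteq> 0)}) \<partial>P)"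
    by (rule nn_integral_cong_AE)
  also have "\<dots> = (\<integral>\<^sup>+x\<in>(\<Pi>\<^sub>E i\<in>{..<1}. C).
      ennreal (Re (Determinant.det (Matrix.mat 1 1 (\<lambda>(i, j). \<kappa> (x i) (x j))))) \<partial>(\<Pi>\<^sub>M i\<in>{..<1}. M))"
    by (rule corr[unfolded correlation_function_def, THEN conjunct2, THEN conjunct2, THEN spec[where x = "\<lambda>_. C"], THEN mp])
      (simp add: C)
  also have "\<dots> = (\<integral>\<^sup>+x. indicator C (x 0) * ennreal (Re (\<kappa> (x 0) (x 0))) \<partial>(\<Pi>\<^sub>M i\<in>{0::nat}. M))"
    unfolding one
  proof (rule nn_integral_cong)
    fix x :: "nat \<Rightarrow> 'a" assume "x \<in> space (\<Pi>\<^sub>M i\<in>{0::nat}. M)"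
    then have "x \<in> extensional {0}" by (simp add: space_PiM PiE_def)
    then have "(indicator (\<Pi>\<^sub>E i\<in>{0::nat}. C) x :: ennreal) = indicator C (x 0)"
      by (auto simp: indicator_def PiE_def Pi_def)
    moreover have "Determinant.det (Matrix.mat 1 1 (\<lambda>(i, j). \<kappa> (x i) (x j))) = \<kappa> (x 0) (x 0)"
      by (subst det_single) simp_all
    ultimately show "ennreal (Re (Determinant.det (Matrix.mat 1 1 (\<lambda>(i, j). \<kappa> (x i) (x j))))) * indicator (\<Pi>\<^sub>E i\<in>{0::nat}. C) x
        = indicator C (x 0) * ennreal (Re (\<kappa> (x 0) (x 0)))"
      by (simp add: mult.commute)
  qed
  also have "\<dots> = (\<integral>\<^sup>+x. indicator C x * ennreal (Re (\<kappa> x x)) \<partial>M)"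
    by (rule product_nn_integral_singleton[OF Re_diag])
  finally show ?thesis .
qed

section \<open>The determinantal process and its Poisson majorant\<close>

text \<open>The kernel expansion is valid off a null set \<open>N0\<close>. By the intensity formula
  the process almost surely has no points of the sets in \<open>N0\<close>, so \<open>N0\<close> may
  be removed; afterwards the correlation functions are the limits of the truncated determinants and
  yield the generating function.\<close>

lemma determinantal_process_dcx_bound:
  fixes M :: "'a::polish_space measure" and \<eta> :: "'w \<Rightarrow> 'a measure" and m :: nat
  assumes lc: "locally_compact_space (euclidean :: 'a topology)" and M: "radon_measure M"
    and K: "positive_contraction M K" and dpp: "determinantal_process P \<eta> M K"
    and B: "\<And>i. i < m \<Longrightarrow> B i \<in> sets borel \<and> relatively_compact (B i)" "disjoint_family_on B {..<m}"
    and finite: "\<And>i. i < m \<Longrightarrow> emeasure (intensity_measure P \<eta>) (B i) \<noteq> \<infinity>"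
    and F: "incr_dcx F" "\<And>u. F (\<lambda>i. if i < m then u i else 0) = F u"
  shows "(\<integral>\<^sup>+\<omega>. ennreal (F (\<lambda>i. pt_count (\<eta> \<omega>) (B i))) \<partial>P)
    \<le> (\<integral>\<^sup>+u. ennreal (F u) \<partial>Pi_pmf {..<m} 0 (\<lambda>i. poisson0_pmf (measure (intensity_measure P \<eta>) (B i))))"
proof -
  have sets_M: "sets M = sets borel" using M by (simp add: radon_measure_def)
  have sfm: "sigma_finite_measure M" using lc M by (rule radon_measure_sigma_finite)
  have simple: "simple_point_process P \<eta>" using dpp by (simp add: determinantal_process_def)
  then have pp: "point_process P \<eta>" by (simp add: simple_point_process_def)
  then have prob: "prob_space P" by (simp add: point_process_def)
  have "\<exists>\<kappa>. local_kernel M K \<kappa> \<and> (\<forall>n\<ge>1. correlation_function P \<eta> M n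
      (\<lambda>x. Re (Determinant.det (Matrix.mat n n (\<lambda>(i, j). \<kappa> (x i) (x j))))))"
    using dpp unfolding determinantal_process_def by (rule conjunct2)
  then obtain \<kappa> where \<kappa>: "local_kernel M K \<kappa>"
    and corr': "\<forall>n\<ge>1. correlation_function P \<eta> M n (\<lambda>x. Re (Determinant.det (Matrix.mat n n (\<lambda>(i, j). \<kappa> (x i) (x j)))))"
    by (elim exE conjE)
  have corr: "correlation_function P \<eta> M n (\<lambda>x. Re (Determinant.det (Matrix.mat n n (\<lambda>(i, j). \<kappa> (x i) (x j)))))"
    if "1 \<le> n" for n by (rule corr'[rule_format, OF that])
  have \<kappa>_meas: "(\<lambda>(x, y). \<kappa> x y) \<in> borel_measurable (M \<Otimes>\<^sub>M M)"
    using \<kappa> unfolding local_kernel_def by (rule conjunct1)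
  \<comment> \<open>A single spectral decomposition on the union serves all the sets; decompositions
    of the separate sets would have unrelated eigenfunctions and say nothing about joint
    counts.\<close>
  define U where "U = (\<Union>i<m. B i)"
  have U: "U \<in> sets borel" "relatively_compact U"
  proof -
    show "U \<in> sets borel" unfolding U_def by (rule sets.finite_UN) (simp_all add: B(1))
    show "relatively_compact U" unfolding U_def by (rule relatively_compact_UN) (simp_all add: B(1))
  qed
  have "\<exists>I l \<phi>. spectral_decomposition M (compression U K) I l \<phi> \<and> (\<exists>N\<in>null_sets M. \<forall>x\<in>U - N. \<forall>y\<in>U - N.
      ((\<lambda>k. complex_of_real (l k) * \<phi> k x * cnj (\<phi> k y)) has_sum \<kappa> x y) I)"
    by (rule \<kappa>[unfolded local_kernel_def, THEN conjunct2, THEN conjunct2, rule_format, OF U])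
  then obtain I l \<phi> N0 where sd: "spectral_decomposition M (compression U K) I l \<phi>" and N0: "N0 \<in> null_sets M"
    and hs: "\<forall>x\<in>U - N0. \<forall>y\<in>U - N0. ((\<lambda>k. complex_of_real (l k) * \<phi> k x * cnj (\<phi> k y)) has_sum \<kappa> x y) I"
    by (elim exE conjE bexE)
  have U_M: "U \<in> sets M" using U sets_M by simp
  note spectrum = positive_contraction_compression_spectrum[OF K U_M sd]
  have \<phi>: "\<phi> k \<in> L2_space M" if "k \<in> I" for k
    using sd that unfolding spectral_decomposition_def by blast
  define B' where "B' i = B i - N0" for i
  have N0_borel: "N0 \<in> sets borel" using N0 sets_M by auto
  have B': "B' i \<in> sets borel" "relatively_compact (B' i)" if "i < m" for i
    unfolding B'_def using B(1)[OF that] N0_borel by (auto intro: relatively_compact_subset)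
  have B'_U: "B' i \<subseteq> U - N0" if "i < m" for i using that by (auto simp: B'_def U_def)
  have B'_disj: "disjoint_family_on B' {..<m}"
    using B(2) by (auto simp: disjoint_family_on_def B'_def)
  \<comment> \<open>Indices outside \<open>I\<close> are filled with zero functions, and
    \<open>l'\<close> with zeros, so that sums may run over all natural numbers even if the rank is
    finite.\<close>
  define \<psi> where "\<psi> k x = (if k \<in> I then complex_of_real (sqrt (l k)) * (indicator U x * \<phi> k x) else 0)" for k x
  define l' where "l' k = (if k \<in> I then l k else 0)" for k
  have \<psi>_L2: "\<psi> k \<in> L2_space M" for k
  proof (cases "k \<in> I")
    case True
    have "(\<lambda>x. indicator U x * \<phi> k x) \<in> L2_space M" by (rule L2_space_mult_indicator[OF \<phi>[OF True] U_M])
    then show ?thesis using True by (auto simp: L2_space_def \<psi>_def[abs_def] norm_mult power_mult_distrib)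
  qed (simp add: L2_space_def \<psi>_def[abs_def])
  have kernel: "(\<lambda>k. \<psi> k x * cnj (\<psi> k y)) sums \<kappa> x y" if "x \<in> U - N0" "y \<in> U - N0" for x y
  proof (rule has_sum_imp_sums)
    have "complex_of_real (l k) * \<phi> k x * cnj (\<phi> k y) = \<psi> k x * cnj (\<psi> k y)" if "k \<in> I" for k
    proof -
      have "complex_of_real (sqrt (l k)) * complex_of_real (sqrt (l k)) = complex_of_real (l k)"
        using spectrum(1)[OF that] by (simp flip: of_real_mult)
      then have "\<psi> k x * cnj (\<psi> k y) = complex_of_real (l k) * (\<phi> k x * cnj (\<phi> k y))"
        using \<open>x \<in> U - N0\<close> \<open>y \<in> U - N0\<close> that by (simp add: \<psi>_def)
      then show ?thesis by (simp add: mult.assoc)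
    qed
    then have "((\<lambda>k. complex_of_real (l k) * \<phi> k x * cnj (\<phi> k y)) has_sum \<kappa> x y) I
        \<longleftrightarrow> ((\<lambda>k. \<psi> k x * cnj (\<psi> k y)) has_sum \<kappa> x y) UNIV"
      by (intro has_sum_cong_neutral) (auto simp: \<psi>_def)
    then show "((\<lambda>k. \<psi> k x * cnj (\<psi> k y)) has_sum \<kappa> x y) UNIV" using hs[rule_format, OF that] by (rule iffD1)
  qed
  have diag_nonneg: "0 \<le> Re (\<kappa> x x)" if "x \<in> U - N0" for x
  proof (rule sums_le[OF _ sums_zero sums_Re[OF kernel[OF that that]]])
    show "0 \<le> Re (\<psi> k x * cnj (\<psi> k x))" for k by simp
  qed
  have gram: "(\<Sum>b<m. \<integral>x. indicator (B' b) x * (\<psi> j x * cnj (\<psi> k x)) \<partial>M) = (if j = k then complex_of_real (l' j) else 0)" for j k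
  proof -
    have int: "integrable M (\<lambda>x. indicator (B' b) x * (\<psi> j x * cnj (\<psi> k x)))" if "b < m" for b
    proof -
      have "(\<lambda>x. indicator (B' b) x * \<psi> j x) \<in> L2_space M"
        by (rule L2_space_mult_indicator[OF \<psi>_L2]) (simp add: sets_M B' that)
      from L2_inner_integrable[OF this \<psi>_L2[of k]] show ?thesis by (simp add: mult.assoc)
    qed
    have "(\<Sum>b<m. \<integral>x. indicator (B' b) x * (\<psi> j x * cnj (\<psi> k x)) \<partial>M)
        = (\<integral>x. (\<Sum>b<m. indicator (B' b) x * (\<psi> j x * cnj (\<psi> k x))) \<partial>M)"
      using int by (subst Bochner_Integration.integral_sum) auto
    also have "\<dots> = (\<integral>x. \<psi> j x * cnj (\<psi> k x) \<partial>M)"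
    proof (rule integral_cong_AE)
      show "(\<lambda>x. \<Sum>b<m. indicator (B' b) x * (\<psi> j x * cnj (\<psi> k x))) \<in> borel_measurable M"
        using int by (intro borel_measurable_sum borel_measurable_integrable) auto
      show "(\<lambda>x. \<psi> j x * cnj (\<psi> k x)) \<in> borel_measurable M"
        using L2_inner_integrable[OF \<psi>_L2 \<psi>_L2] by (rule borel_measurable_integrable)
      show "AE x in M. (\<Sum>b<m. indicator (B' b) x * (\<psi> j x * cnj (\<psi> k x))) = \<psi> j x * cnj (\<psi> k x)"
      proof (rule AE_mp[OF AE_not_in[OF N0]], intro AE_I2 impI)
        fix x assume x: "x \<notin> N0"
        show "(\<Sum>b<m. indicator (B' b) x * (\<psi> j x * cnj (\<psi> k x))) = \<psi> j x * cnj (\<psi> k x)"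
        proof (cases "x \<in> U")
          case True
          then obtain b where b: "b < m" "x \<in> B' b" using x by (auto simp: U_def B'_def)
          have "indicator (B' b') x = (if b' = b then 1 else (0::complex))" if "b' < m" for b'
            using B'_disj b that by (auto simp: disjoint_family_on_def indicator_def)
          then have "(\<Sum>b'<m. indicator (B' b') x * (\<psi> j x * cnj (\<psi> k x))) = (\<Sum>b'<m. if b' = b then \<psi> j x * cnj (\<psi> k x) else 0)"
            by (intro sum.cong) auto
          then show ?thesis using b by simp
        next
          case False
          then show ?thesis by (simp add: \<psi>_def)
        qed
      qed
    qed
    also have "\<dots> = (if j = k then complex_of_real (l' j) else 0)"
    proof (cases "j \<in> I \<and> k \<in> I")
      case True
      have "(\<integral>x. \<psi> j x * cnj (\<psi> k x) \<partial>M)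
          = (\<integral>x. complex_of_real (sqrt (l j)) * complex_of_real (sqrt (l k)) * (indicator U x * (\<phi> j x * cnj (\<phi> k x))) \<partial>M)"
        using True by (intro Bochner_Integration.integral_cong refl) (auto simp: \<psi>_def indicator_def)
      also have "\<dots> = complex_of_real (sqrt (l j)) * complex_of_real (sqrt (l k)) * (\<integral>x. indicator U x * (\<phi> j x * cnj (\<phi> k x)) \<partial>M)"
        by (rule integral_mult_right_zero)
      finally show ?thesis using spectrum(3)[of j k] True by (simp add: l'_def)
    next
      case False
      then show ?thesis by (auto simp: \<psi>_def l'_def)
    qed
    finally show ?thesis .
  qed
  note intensity = determinantal_intensity[OF simple sfm sets_M \<kappa>_meas corr[OF order_refl]]
  \<comment> \<open>The expected number of points in \<open>B i \<inter> N0\<close> is the integral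
    of the diagonal over a null set.\<close>
  have null: "AE \<omega> in P. emeasure (\<eta> \<omega>) (B i \<inter> N0) = 0" if "i < m" for i
  proof -
    have C: "B i \<inter> N0 \<in> sets borel" "relatively_compact (B i \<inter> N0)"
      using B(1)[OF that] N0_borel by (auto intro: relatively_compact_subset)
    have "AE x in M. indicator (B i \<inter> N0) x * ennreal (Re (\<kappa> x x)) = 0"
      by (rule AE_mp[OF AE_not_in[OF N0]]) (auto simp: indicator_def)
    then have "(\<integral>\<^sup>+\<omega>. emeasure (\<eta> \<omega>) (B i \<inter> N0) \<partial>P) = (\<integral>\<^sup>+x. 0 \<partial>M)"
      unfolding intensity[OF C] by (rule nn_integral_cong_AE)
    moreover have "(\<lambda>\<omega>. emeasure (\<eta> \<omega>) (B i \<inter> N0)) \<in> borel_measurable P"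
      using pp C(1) unfolding point_process_def by blast
    ultimately show ?thesis by (simp add: nn_integral_0_iff_AE)
  qed
  have same: "AE \<omega> in P. \<forall>i<m. emeasure (\<eta> \<omega>) (B' i) = emeasure (\<eta> \<omega>) (B i)"
  proof -
    have "AE \<omega> in P. \<forall>i\<in>{..<m}. emeasure (\<eta> \<omega>) (B i \<inter> N0) = 0"
      by (rule AE_finite_allI) (auto intro: null)
    then show ?thesis
    proof (rule AE_mp, intro AE_I2 impI allI)
      fix \<omega> i assume \<omega>: "\<omega> \<in> space P" "\<forall>i\<in>{..<m}. emeasure (\<eta> \<omega>) (B i \<inter> N0) = 0" "i < m"
      have sets: "sets (\<eta> \<omega>) = sets borel" using pp \<omega> by (simp add: point_process_def)
      have "B' i \<union> (B i \<inter> N0) = B i" by (auto simp: B'_def)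
      moreover have "emeasure (\<eta> \<omega>) (B' i) + emeasure (\<eta> \<omega>) (B i \<inter> N0) = emeasure (\<eta> \<omega>) (B' i \<union> (B i \<inter> N0))"
        using B'[OF \<omega>(3)] B(1)[OF \<omega>(3)] N0_borel
        by (intro plus_emeasure) (auto simp: sets B'_def)
      ultimately show "emeasure (\<eta> \<omega>) (B' i) = emeasure (\<eta> \<omega>) (B i)" using \<omega> by simp
    qed
  qed
  have same_count: "AE \<omega> in P. \<forall>i<m. pt_count (\<eta> \<omega>) (B' i) = pt_count (\<eta> \<omega>) (B i)"
    using same by (rule AE_mp) (auto simp: pt_count_def measure_def)
  define \<mu> where "\<mu> i = measure (intensity_measure P \<eta>) (B i)" for i
  have int_\<mu>: "(\<integral>\<^sup>+x. ennreal (indicator (B' i) x * Re (\<kappa> x x)) \<partial>M) = ennreal (\<mu> i)" if "i < m" for i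
  proof -
    have "ennreal (indicator (B' i) x * Re (\<kappa> x x)) = indicator (B' i) x * ennreal (Re (\<kappa> x x))" for x
      by (simp add: indicator_def)
    then have "(\<integral>\<^sup>+x. ennreal (indicator (B' i) x * Re (\<kappa> x x)) \<partial>M) = (\<integral>\<^sup>+\<omega>. emeasure (\<eta> \<omega>) (B' i) \<partial>P)"
      using intensity[OF B'[OF that]] by simp
    also have "\<dots> = (\<integral>\<^sup>+\<omega>. emeasure (\<eta> \<omega>) (B i) \<partial>P)"
      by (rule nn_integral_cong_AE, rule AE_mp[OF same]) (use that in auto)
    also have "\<dots> = emeasure (intensity_measure P \<eta>) (B i)"
      using B(1)[OF that] by (intro emeasure_intensity_measure[symmetric] pp) auto
    also have "\<dots> = ennreal (\<mu> i)"
      unfolding \<mu>_def using finite[OF that] by (intro emeasure_eq_ennreal_measure) auto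
    finally show ?thesis .
  qed
  have diag_meas: "(\<lambda>x. indicator (B' i) x * Re (\<kappa> x x)) \<in> borel_measurable M" if "i < m" for i
  proof -
    have "(\<lambda>x. \<kappa> x x) \<in> borel_measurable M"
      using measurable_compose[OF measurable_Pair[OF measurable_ident_sets[OF refl] measurable_ident_sets[OF refl]] \<kappa>_meas] by simp
    then show ?thesis using B'(1)[OF that] sets_M by auto
  qed
  have diag: "has_bochner_integral M (\<lambda>x. indicator (B' i) x * Re (\<kappa> x x)) (\<mu> i)" if "i < m" for i
  proof (rule has_bochner_integral_nn_integral[OF diag_meas[OF that] _ _ int_\<mu>[OF that]])
    show "AE x in M. 0 \<le> indicator (B' i) x * Re (\<kappa> x x)"
      using diag_nonneg B'_U[OF that] by (intro AE_I2) (auto simp: indicator_def)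
    show "0 \<le> \<mu> i" by (simp add: \<mu>_def)
  qed
  interpret frk: finite_rank_kernels M \<psi> B' m l' \<kappa>
  proof
    show "B' b \<in> sets M" if "b < m" for b using B'(1)[OF that] sets_M by simp
    show "\<psi> k \<in> borel_measurable M" "integrable M (\<lambda>x. (cmod (\<psi> k x))\<^sup>2)" for k
      using \<psi>_L2[of k] by (auto simp: L2_space_def)
    show "0 \<le> l' k" for k using spectrum(1) by (simp add: l'_def)
    show "(\<lambda>k. \<psi> k x * cnj (\<psi> k y)) sums \<kappa> x y" if "b < m" "b' < m" "x \<in> B' b" "y \<in> B' b'" for x y b b'
      using that B'_U by (intro kernel) auto
    show "integrable M (\<lambda>x. indicator (B' b) x * Re (\<kappa> x x))" if "b < m" for b
      using diag[OF that] by (simp add: has_bochner_integral_iff)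
  qed (use sfm gram in \<open>auto simp: sigma_finite_measure_def\<close>)
  have moments: "(\<integral>\<^sup>+\<omega>. of_nat (tuple_count n c (\<lambda>i. pt_count (\<eta> \<omega>) (B i))) \<partial>P) = ennreal (frk.kernel_moment n c)"
    if c: "c \<in> {..<n} \<rightarrow>\<^sub>E {..<m}" for n c
  \<comment> \<open>Correlation functions are prescribed for n \<ge> 1 only. For n = 0 there is just
    the empty tuple, and both sides are 1.\<close>
  proof (cases "n = 0")
    case True
    have "frk.kernel_moment 0 c = 1"
      by (simp add: frk.kernel_moment_def ldet_def PiM_empty lebesgue_integral_count_space_finite)
    then show ?thesis using True prob by (simp add: tuple_count_0 prob_space.emeasure_space_1)
  next
    case False
    then have n: "1 \<le> n" by simp
    have c_less: "c i < m" if "i < n" for i using PiE_mem[OF c, of i] that by simp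
    let ?\<rho> = "\<lambda>x. Re (Determinant.det (Matrix.mat n n (\<lambda>(i, j). \<kappa> (x i) (x j))))"
    have \<rho>: "?\<rho> x = Re (ldet {..<n} (\<lambda>i j. \<kappa> (x i) (x j)))" for x by (simp only: ldet_eq_det)
    have "AE \<omega> in P. card {x \<in> \<Pi>\<^sub>E i\<in>{..<n}. B' (c i). inj_on x {..<n} \<and> (\<forall>i<n. emeasure (\<eta> \<omega>) {x i} \<noteq> 0)}
        = tuple_count n c (\<lambda>i. pt_count (\<eta> \<omega>) (B' i))"
      using B' B'_disj c by (intro simple_point_process_tuple_count[OF simple]) auto
    moreover have "AE \<omega> in P. tuple_count n c (\<lambda>i. pt_count (\<eta> \<omega>) (B' i)) = tuple_count n c (\<lambda>i. pt_count (\<eta> \<omega>) (B i))"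
      using same_count by (rule AE_mp) (intro AE_I2 impI tuple_count_cong[OF c], simp)
    ultimately have "AE \<omega> in P. of_nat (tuple_count n c (\<lambda>i. pt_count (\<eta> \<omega>) (B i)))
        = (of_nat (card {x \<in> \<Pi>\<^sub>E i\<in>{..<n}. B' (c i). inj_on x {..<n} \<and> (\<forall>i<n. emeasure (\<eta> \<omega>) {x i} \<noteq> 0)}) :: ennreal)"
      by eventually_elim simp
    then have "(\<integral>\<^sup>+\<omega>. of_nat (tuple_count n c (\<lambda>i. pt_count (\<eta> \<omega>) (B i))) \<partial>P)
        = (\<integral>\<^sup>+\<omega>. of_nat (card {x \<in> \<Pi>\<^sub>E i\<in>{..<n}. B' (c i). inj_on x {..<n} \<and> (\<forall>i<n. emeasure (\<eta> \<omega>) {x i} \<noteq> 0)}) \<partial>P)"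
      by (rule nn_integral_cong_AE)
    also have "\<dots> = (\<integral>\<^sup>+x\<in>(\<Pi>\<^sub>E i\<in>{..<n}. B' (c i)). ennreal (?\<rho> x) \<partial>(\<Pi>\<^sub>M i\<in>{..<n}. M))"
    proof -
      have "\<forall>i<n. B' (c i) \<in> sets borel \<and> relatively_compact (B' (c i))" using B' c_less by auto
      then show ?thesis
        by (rule corr[OF n, unfolded correlation_function_def, THEN conjunct2, THEN conjunct2, THEN spec[where x = "\<lambda>i. B' (c i)"], THEN mp])
    qed
    also have "\<dots> = (\<integral>\<^sup>+x. ennreal ((\<Prod>i<n. indicator (B' (c i)) (x i)) * Re (ldet {..<n} (\<lambda>i j. \<kappa> (x i) (x j)))) \<partial>(\<Pi>\<^sub>M i\<in>{..<n}. M))"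
    proof (rule nn_integral_cong)
      fix x assume "x \<in> space (\<Pi>\<^sub>M i\<in>{..<n}. M)"
      then have ext: "x \<in> extensional {..<n}" by (simp add: space_PiM PiE_def)
      show "ennreal (?\<rho> x) * indicator (\<Pi>\<^sub>E i\<in>{..<n}. B' (c i)) x
          = ennreal ((\<Prod>i<n. indicator (B' (c i)) (x i)) * Re (ldet {..<n} (\<lambda>i j. \<kappa> (x i) (x j))))"
      proof (cases "\<forall>i<n. x i \<in> B' (c i)")
        case True
        then have "x \<in> (\<Pi>\<^sub>E i\<in>{..<n}. B' (c i))" using ext by (simp add: PiE_def)
        moreover have "(\<Prod>i<n. indicator (B' (c i)) (x i) :: real) = 1" using True by (intro prod.neutral) auto
        ultimately show ?thesis unfolding \<rho> by simp
      next
        case False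
        then obtain i where i: "i < n" "x i \<notin> B' (c i)" by blast
        then have "x \<notin> (\<Pi>\<^sub>E i\<in>{..<n}. B' (c i))" using PiE_mem[of x "{..<n}" "\<lambda>i. B' (c i)" i] by auto
        moreover have "(\<Prod>i<n. indicator (B' (c i)) (x i) :: real) = 0" using i by (intro prod_zero bexI[of _ i]) auto
        ultimately show ?thesis by (simp only: mult_zero_left mult_zero_right ennreal_0 indicator_simps not_False_eq_True)
      qed
    qed
    also have "\<dots> = ennreal (frk.kernel_moment n c)"
      unfolding frk.kernel_moment_def
    proof (rule nn_integral_eq_integral)
      show "integrable (\<Pi>\<^sub>M i\<in>{..<n}. M) (\<lambda>x. (\<Prod>i<n. indicator (B' (c i)) (x i)) * Re (ldet {..<n} (\<lambda>i j. \<kappa> (x i) (x j))))"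
        using c_less by (rule frk.kernel_moment_limit(1))
      have "AE x in (\<Pi>\<^sub>M i\<in>{..<n}. M). 0 \<le> ?\<rho> x"
        by (rule corr[OF n, unfolded correlation_function_def, THEN conjunct2, THEN conjunct1])
      then show "AE x in (\<Pi>\<^sub>M i\<in>{..<n}. M). 0 \<le> (\<Prod>i<n. indicator (B' (c i)) (x i)) * Re (ldet {..<n} (\<lambda>i j. \<kappa> (x i) (x j)))"
        unfolding \<rho> by (rule AE_mp) (intro AE_I2 impI mult_nonneg_nonneg prod_nonneg, auto)
    qed
    finally show ?thesis .
  qed
  have X: "(\<lambda>\<omega>. pt_count (\<eta> \<omega>) (B i)) \<in> measurable P (count_space UNIV)" if "i < m" for i
    using point_process_pt_count(3)[OF pp] B(1)[OF that] by blast
  have "(\<integral>\<^sup>+\<omega>. ennreal (F (\<lambda>i. pt_count (\<eta> \<omega>) (B i))) \<partial>P) \<le> (\<integral>\<^sup>+u. ennreal (F u) \<partial>Pi_pmf {..<m} 0 (\<lambda>i. poisson0_pmf (\<mu> i)))"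
  proof (rule generating_function_dcx_bound[where A = frk.A and l = l' and X = "\<lambda>i \<omega>. pt_count (\<eta> \<omega>) (B i)", OF prob X])
    show "psd d (frk.A b)" if "b < m" for d b by (rule frk.psd_A[OF that])
    show "(\<Sum>b<m. frk.A b j k) = (if j = k then complex_of_real (l' j) else 0)" for j k
      unfolding frk.A_def by (rule gram)
    \<comment> \<open>This is where K \<le> I enters: it makes the defect diag(1 - l') positive
      semidefinite.\<close>
    show "l' k \<le> 1" for k using spectrum(2) by (simp add: l'_def)
    show "(\<Sum>k<N. Re (frk.A b k k)) \<le> \<mu> b" if "b < m" for b N
      using frk.trace_le[OF that, of N] diag[OF that] by (simp add: has_bochner_integral_iff)
  next
    fix t :: "nat \<Rightarrow> real" assume t: "\<And>b. b < m \<Longrightarrow> \<bar>t b\<bar> \<le> 1"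
    have "(\<lambda>n. (\<Sum>c\<in>{..<n} \<rightarrow>\<^sub>E {..<m}. (\<Prod>j<n. t (c j)) * frk.kernel_moment n c) / fact n)
        sums (\<integral>\<omega>. (\<Prod>i<m. (1 + t i) ^ pt_count (\<eta> \<omega>) (B i)) \<partial>P)"
    proof (rule expectation_generating_function[where C = frk.trace_bound])
      show "0 \<le> frk.kernel_moment n c" if "c \<in> {..<n} \<rightarrow>\<^sub>E {..<m}" for n c
        using PiE_mem[OF that] by (intro frk.kernel_moment_nonneg) simp
    qed (use X moments t frk.sum_kernel_moment_le in auto)
    note expectation = sums_unique[OF this]
    show "(\<lambda>N. Re (ldet {..<N} (\<lambda>i j. (if i = j then 1 else 0) + (\<Sum>b<m. complex_of_real (t b) * frk.A b i j))))
        \<longlonglongrightarrow> (\<integral>\<omega>. (\<Prod>i<m. (1 + t i) ^ pt_count (\<eta> \<omega>) (B i)) \<partial>P)"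
      unfolding expectation by (rule frk.ldet_limit) (rule t)
  qed (use F in auto)
  then show ?thesis by (simp add: \<mu>_def)
qed

theorem corollary4p11:
  fixes M :: "'a::polish_space measure"
    and K :: "('a \<Rightarrow> complex) \<Rightarrow> 'a \<Rightarrow> complex"
    and P :: "'w measure" and \<eta> :: "'w \<Rightarrow> 'a measure"
    and Q :: "'v measure" and \<eta>\<^sub>2 :: "'v \<Rightarrow> 'a measure"
  assumes "locally_compact_space (euclidean :: 'a topology)"
    and "radon_measure M"
    and "positive_contraction M K"
    and "locally_trace_class M K"
    and "determinantal_process P \<eta> M K"
    and "poisson_process Q \<eta>\<^sub>2 (intensity_measure P \<eta>)"
  shows "dcx_less_pp P \<eta> Q \<eta>\<^sub>2"
  unfolding dcx_less_pp_def dcx_less_def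
proof (intro allI impI, elim conjE)
  fix m :: nat and B :: "nat \<Rightarrow> 'a set" and f
  assume B: "\<forall>i<m. B i \<in> sets borel \<and> relatively_compact (B i)" "disjoint_family_on B {..<m}"
    and f: "directionally_convex m f" "integrable P (\<lambda>\<omega>. f (count_vec m B (\<eta> \<omega>)))" "integrable Q (\<lambda>\<omega>. f (count_vec m B (\<eta>\<^sub>2 \<omega>)))"
  let ?\<Lambda> = "intensity_measure P \<eta>"
  have pp: "point_process P \<eta>"
    using assms(5) by (simp add: determinantal_process_def simple_point_process_def)
  then have P: "prob_space P" by (simp add: point_process_def)
  have pp2: "point_process Q \<eta>\<^sub>2" using assms(6) by (simp add: poisson_process_def)
  then have Q: "prob_space Q" by (simp add: point_process_def)
  interpret Q: prob_space Q by (rule Q)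
  have law: "\<forall>B\<in>sets borel. if emeasure ?\<Lambda> B = \<infinity> then (AE \<omega> in Q. emeasure (\<eta>\<^sub>2 \<omega>) B = \<infinity>)
      else (\<forall>k::nat. measure Q {\<omega> \<in> space Q. emeasure (\<eta>\<^sub>2 \<omega>) B = of_nat k}
        = measure ?\<Lambda> B ^ k / fact k * exp (- measure ?\<Lambda> B))"
    using assms(6) unfolding poisson_process_def by (elim conjE)
  note cnt = point_process_pt_count[OF pp] and cnt2 = point_process_pt_count[OF pp2]
  \<comment> \<open>Infinite intensity would make the Poisson count almost surely infinite, against
    the local finiteness of a point process.\<close>
  have finite: "emeasure ?\<Lambda> (B i) \<noteq> \<infinity>" if "i < m" for i
  proof
    assume "emeasure ?\<Lambda> (B i) = \<infinity>"
    then have "AE \<omega> in Q. emeasure (\<eta>\<^sub>2 \<omega>) (B i) = \<infinity>"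
      using bspec[OF law, of "B i"] B(1) that by simp
    then have "AE \<omega> in Q. False"
      by (rule AE_mp) (use B(1) that in \<open>auto simp: cnt2(1)\<close>)
    then show False by simp
  qed
  \<comment> \<open>The value 0 beyond \<open>m\<close> keeps the rates nonnegative and equal to
    those of the actual sets wherever they are used.\<close>
  define \<mu> where "\<mu> i = (if i < m then measure ?\<Lambda> (B i) else 0)" for i
  have \<mu>_nonneg: "0 \<le> \<mu> i" for i by (simp add: \<mu>_def)
  have Pi_\<mu>: "Pi_pmf {..<m} 0 (\<lambda>i. poisson0_pmf (measure ?\<Lambda> (B i))) = Pi_pmf {..<m} 0 (\<lambda>i. poisson0_pmf (\<mu> i))"
    by (rule Pi_pmf_cong) (auto simp: \<mu>_def)
  define X where "X i \<omega> = pt_count (\<eta> \<omega>) (B i)" for i \<omega>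
  define Y where "Y i \<omega> = pt_count (\<eta>\<^sub>2 \<omega>) (B i)" for i \<omega>
  have vec: "count_vec m B (\<eta> \<omega>) = Matrix.vec m (\<lambda>i. real (X i \<omega>))" if "\<omega> \<in> space P" for \<omega>
    unfolding count_vec_def X_def using B(1) that by (intro eq_vecI) (auto simp: cnt(2))
  have vec2: "count_vec m B (\<eta>\<^sub>2 \<omega>) = Matrix.vec m (\<lambda>i. real (Y i \<omega>))" if "\<omega> \<in> space Q" for \<omega>
    unfolding count_vec_def Y_def using B(1) that by (intro eq_vecI) (auto simp: cnt2(2))
  have indep: "Q.indep_vars (\<lambda>_. count_space UNIV) Y {..<m}"
  proof -
    have "Q.indep_vars (\<lambda>_. borel) (\<lambda>i \<omega>. emeasure (\<eta>\<^sub>2 \<omega>) (B i)) {..<m}"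
      using assms(6) B unfolding poisson_process_def by blast
    from Q.indep_vars_compose2[OF this, where Y = "\<lambda>_ e. nat \<lfloor>enn2real e\<rfloor>" and N = "\<lambda>_. count_space UNIV"]
    show ?thesis by (simp add: Y_def[abs_def] pt_count_def measure_def pt_count_measurable_ennreal)
  qed
  have pois: "Q.prob {\<omega> \<in> space Q. Y i \<omega> = k} = \<mu> i ^ k / fact k * exp (- \<mu> i)" if "i < m" for i k
  proof -
    have "{\<omega> \<in> space Q. Y i \<omega> = k} = {\<omega> \<in> space Q. emeasure (\<eta>\<^sub>2 \<omega>) (B i) = of_nat k}"
      using B(1) that by (auto simp: Y_def cnt2(1))
    moreover have "Q.prob {\<omega> \<in> space Q. emeasure (\<eta>\<^sub>2 \<omega>) (B i) = of_nat k} = measure ?\<Lambda> (B i) ^ k / fact k * exp (- measure ?\<Lambda> (B i))"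
      using bspec[OF law, of "B i"] B(1) that finite[OF that] by simp
    ultimately show ?thesis using that by (simp add: \<mu>_def)
  qed
  have Y_meas: "Y i \<in> measurable Q (count_space UNIV)" if "i < m" for i
    unfolding Y_def using B(1) that by (intro cnt2(3)) auto
  have X_meas: "X i \<in> measurable P (count_space UNIV)" if "i < m" for i
    unfolding X_def using B(1) that by (intro cnt(3)) auto
  \<comment> \<open>Independence and the Poisson marginals fix all point probabilities of the
    counts, hence the expectation of every nonnegative function of the first \<open>m\<close>
    coordinates.\<close>
  have to_Y: "(\<integral>\<^sup>+\<omega>. ennreal (F (\<lambda>i. Y i \<omega>)) \<partial>Q) = (\<integral>\<^sup>+u. ennreal (F u) \<partial>Pi_pmf {..<m} 0 (\<lambda>i. poisson0_pmf (\<mu> i)))"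
    if "\<And>u. 0 \<le> F u" "\<And>u. F (\<lambda>i. if i < m then u i else 0) = F u" for F
    by (rule Q.nn_integral_independent_poisson[where Y = Y and \<mu> = \<mu> and F = F and m = m])
      (simp_all add: indep \<mu>_nonneg pois that(1), rule that(2))
  have "(\<integral>\<omega>. f (Matrix.vec m (\<lambda>i. real (X i \<omega>))) \<partial>P) \<le> (\<integral>\<omega>. f (Matrix.vec m (\<lambda>i. real (Y i \<omega>))) \<partial>Q)"
  proof (rule expectation_le_of_incr_dcx[OF P Q f(1), where \<mu> = \<mu>])
    show "integrable P (\<lambda>\<omega>. f (Matrix.vec m (\<lambda>i. real (X i \<omega>))))"
      using f(2) by (rule Bochner_Integration.integrable_cong[THEN iffD1, rotated -1]) (simp_all add: vec)
    show "integrable Q (\<lambda>\<omega>. f (Matrix.vec m (\<lambda>i. real (Y i \<omega>))))"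
      using f(3) by (rule Bochner_Integration.integrable_cong[THEN iffD1, rotated -1]) (simp_all add: vec2)
  next
    fix i assume i: "i < m"
    have "(\<integral>\<^sup>+\<omega>. ennreal (real (X i \<omega>)) \<partial>P) = (\<integral>\<^sup>+\<omega>. emeasure (\<eta> \<omega>) (B i) \<partial>P)"
      using B(1) i by (intro nn_integral_cong) (simp add: X_def cnt(1) ennreal_of_nat_eq_real_of_nat)
    also have "\<dots> = emeasure ?\<Lambda> (B i)"
      using B(1) i by (intro emeasure_intensity_measure[symmetric] pp) auto
    also have "\<dots> = ennreal (\<mu> i)"
      using finite[OF i] i by (simp add: \<mu>_def emeasure_eq_ennreal_measure)
    finally show "has_bochner_integral P (\<lambda>\<omega>. real (X i \<omega>)) (\<mu> i)"
      using measurable_compose[OF X_meas[OF i], of real borel] \<mu>_nonneg[of i]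
      by (intro has_bochner_integral_nn_integral) auto
    have "(\<integral>\<^sup>+\<omega>. ennreal (real (Y i \<omega>)) \<partial>Q) = ennreal (\<mu> i)"
      using to_Y[of "\<lambda>u. real (u i)"] nn_integral_Pi_pmf_poisson0_component[OF i \<mu>_nonneg] i by simp
    then show "has_bochner_integral Q (\<lambda>\<omega>. real (Y i \<omega>)) (\<mu> i)"
      using measurable_compose[OF Y_meas[OF i], of real borel] \<mu>_nonneg[of i]
      by (intro has_bochner_integral_nn_integral) auto
  next
    fix F :: "(nat \<Rightarrow> nat) \<Rightarrow> real"
    assume F: "incr_dcx F" "\<And>u. F (\<lambda>i. if i < m then u i else 0) = F u"
    have "(\<integral>\<^sup>+\<omega>. ennreal (F (\<lambda>i. X i \<omega>)) \<partial>P) \<le> (\<integral>\<^sup>+u. ennreal (F u) \<partial>Pi_pmf {..<m} 0 (\<lambda>i. poisson0_pmf (\<mu> i)))"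
      unfolding X_def Pi_\<mu>[symmetric]
      using assms(1,2,3,5) B finite F by (intro determinantal_process_dcx_bound) auto
    also have "\<dots> = (\<integral>\<^sup>+\<omega>. ennreal (F (\<lambda>i. Y i \<omega>)) \<partial>Q)"
      using F by (intro to_Y[symmetric]) (auto simp: incr_dcx_def)
    finally show "(\<integral>\<^sup>+\<omega>. ennreal (F (\<lambda>i. X i \<omega>)) \<partial>P) \<le> (\<integral>\<^sup>+\<omega>. ennreal (F (\<lambda>i. Y i \<omega>)) \<partial>Q)" .
  qed
  moreover have "(\<integral>\<omega>. f (count_vec m B (\<eta> \<omega>)) \<partial>P) = (\<integral>\<omega>. f (Matrix.vec m (\<lambda>i. real (X i \<omega>))) \<partial>P)"
    by (intro Bochner_Integration.integral_cong refl) (simp add: vec)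
  moreover have "(\<integral>\<omega>. f (count_vec m B (\<eta>\<^sub>2 \<omega>)) \<partial>Q) = (\<integral>\<omega>. f (Matrix.vec m (\<lambda>i. real (Y i \<omega>))) \<partial>Q)"
    by (intro Bochner_Integration.integral_cong refl) (simp add: vec2)
  ultimately show "(\<integral>\<omega>. f (count_vec m B (\<eta> \<omega>)) \<partial>P) \<le> (\<integral>\<omega>. f (count_vec m B (\<eta>\<^sub>2 \<omega>)) \<partial>Q)" by simp
qed

end
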